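(* Let $(S,\|\cdot\|)$ be a complete $RN$ module over $K$ with base $(\Omega,\mathcal F,P)$, and let $\{T(t):t\geq0\}$ be a $C_{0}$--semigroup on $S$ with infinitesimal generator $(A,D(A))$. For $x\in D(A)$ let $f_x:[0,+\infty)\to S$, $f_x(t)=T(t)x$. Then $\{T(t):t\geq0\}$ is a.s. bounded if and only if, for every $x\in D(A)$ and every finite real closed interval $[0,r]$, $f_x$ is $L^{0}$-Lipschitz on $[0,r]$ (i.e. there is $\xi\in L^0_+(\mathcal F)$ with $\|f_x(t_1)-f_x(t_2)\|\le\xi|t_1-t_2|$ for all $t_1,t_2\in[0,r]$).
   Context: $(\Omega,\mathcal F,P)$ is a probability space; $L^{0}(\mathcal F,K)$ ($K=R$ or $C$) is the algebra of equivalence classes of $K$-valued $\mathcal F$-measurable random variables, ordered a.s.; $L^{0}_{+}(\mathcal F)=\{\xi\in L^0(\mathcal F,R):\xi\ge 0\}$. Suprema are taken in the complete lattice of extended random variables. An $RN$ module over $K$ with base $(\Omega,\mathcal F,P)$ is a left $L^0(\mathcal F,K)$-module $S$ with a map $\|\cdot\|:S\to L^0_+(\mathcal F)$ such that $\|\xi x\|=|\xi|\|x\|$, $\|x+y\|\le\|x\|+\|y\|$, $\|x\|=0\Rightarrow x=0$; it carries the $(\varepsilon,\lambda)$-topology, in which $x_n\to x$ iff $\|x_n-x\|\to0$ in probability; completeness refers to this topology. $B(S)$ is the set of continuous module homomorphisms $S\to S$, with $\|T\|=\bigwedge\{\xi\in L^0_+(\mathcal F):\|Tx\|\le\xi\|x\|\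 \forall x\}$. A $C_0$--semigroup is $\{T(t):t\ge0\}\subset B(S)$ with $T(0)=I$, $T(s)T(t)=T(s+t)$, $\lim_{t\downarrow0}T(t)x=x$ for all $x$. It is a.s. bounded if there is a real $L>0$ with $\bigvee_{t\in[0,L]}\|T(t)\|\in L^0_+(\mathcal F)$. Its infinitesimal generator is $Ax=\lim_{t\downarrow0}\frac{T(t)x-x}{t}$ on $D(A)=\{x:\text{the limit exists}\}$. *)

theory Defs
  imports "HOL-Probability.Probability"
begin

text \<open>Random variables over a probability space M are represented by measurable
functions; equalities/inequalities between elements of L0 are understood almost surely.
An RN module over K with base M: an abelian group 'v with an L0(F,K)-action smul and a
random norm nrm.\<close>

definition ae_le :: "'w measure \<Rightarrow> ('w \<Rightarrow> 'b::order) \<Rightarrow> ('w \<Rightarrow> 'b) \<Rightarrow> bool" where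
  "ae_le M f g \<longleftrightarrow> (AE \<omega> in M. f \<omega> \<le> g \<omega>)"

definition L0p :: "'w measure \<Rightarrow> ('w \<Rightarrow> real) \<Rightarrow> bool" where
  "L0p M \<xi> \<longleftrightarrow> \<xi> \<in> borel_measurable M \<and> (AE \<omega> in M. 0 \<le> \<xi> \<omega>)"

definition rn_module ::
  "'w measure \<Rightarrow> (('w \<Rightarrow> 'k::{real_normed_field,second_countable_topology}) \<Rightarrow> 'v::ab_group_add \<Rightarrow> 'v)
     \<Rightarrow> ('v \<Rightarrow> 'w \<Rightarrow> real) \<Rightarrow> bool" where
  "rn_module M smul nrm \<longleftrightarrow>
     prob_space M \<and>
     (\<forall>x. L0p M (nrm x)) \<and>
     (\<forall>\<xi>\<in>borel_measurable M. \<forall>\<eta>\<in>borel_measurable M.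
         (AE \<omega> in M. \<xi> \<omega> = \<eta> \<omega>) \<longrightarrow> (\<forall>x. smul \<xi> x = smul \<eta> x)) \<and>
     (\<forall>\<xi>\<in>borel_measurable M. \<forall>x y. smul \<xi> (x + y) = smul \<xi> x + smul \<xi> y) \<and>
     (\<forall>\<xi>\<in>borel_measurable M. \<forall>\<eta>\<in>borel_measurable M. \<forall>x.
         smul (\<lambda>\<omega>. \<xi> \<omega> + \<eta> \<omega>) x = smul \<xi> x + smul \<eta> x) \<and>
     (\<forall>\<xi>\<in>borel_measurable M. \<forall>\<eta>\<in>borel_measurable M. \<forall>x.
         smul (\<lambda>\<omega>. \<xi> \<omega> * \<eta> \<omega>) x = smul \<xi> (smul \<eta> x)) \<and>
     (\<forall>x. smul (\<lambda>\<omega>. 1) x = x) \<and>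
     (\<forall>\<xi>\<in>borel_measurable M. \<forall>x. AE \<omega> in M. nrm (smul \<xi> x) \<omega> = norm (\<xi> \<omega>) * nrm x \<omega>) \<and>
     (\<forall>x y. AE \<omega> in M. nrm (x + y) \<omega> \<le> nrm x \<omega> + nrm y \<omega>) \<and>
     (\<forall>x. (AE \<omega> in M. nrm x \<omega> = 0) \<longrightarrow> x = 0)"

text \<open>Convergence in the (epsilon,lambda)-topology along a filter: the neighbourhoods of x
are N(eps,lam) = {y. P{||y - x|| < eps} > 1 - lam}, i.e. P{||y - x|| >= eps} < lam.\<close>
definition tendsto_el ::
  "'w measure \<Rightarrow> ('v::ab_group_add \<Rightarrow> 'w \<Rightarrow> real) \<Rightarrow> 'i filter \<Rightarrow> ('i \<Rightarrow> 'v) \<Rightarrow> 'v \<Rightarrow> bool" where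
  "tendsto_el M nrm F g x \<longleftrightarrow>
     (\<forall>\<epsilon>>0. \<forall>lam>0. eventually (\<lambda>i. measure M {\<omega>\<in>space M. \<epsilon> \<le> nrm (g i - x) \<omega>} < lam) F)"

definition el_complete :: "'w measure \<Rightarrow> ('v::ab_group_add \<Rightarrow> 'w \<Rightarrow> real) \<Rightarrow> bool" where
  "el_complete M nrm \<longleftrightarrow>
     (\<forall>X::nat \<Rightarrow> 'v.
        (\<forall>\<epsilon>>0. \<forall>lam>0. \<exists>N. \<forall>m\<ge>N. \<forall>n\<ge>N.
            measure M {\<omega>\<in>space M. \<epsilon> \<le> nrm (X m - X n) \<omega>} < lam)
        \<longrightarrow> (\<exists>x. tendsto_el M nrm sequentially X x))"

definition el_continuous :: "'w measure \<Rightarrow> ('v::ab_group_add \<Rightarrow> 'w \<Rightarrow> real) \<Rightarrow> ('v \<Rightarrow> 'v) \<Rightarrow> bool" where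
  "el_continuous M nrm T \<longleftrightarrow>
     (\<forall>x. \<forall>\<epsilon>>0. \<forall>lam>0. \<exists>\<epsilon>'>0. \<exists>lam'>0. \<forall>y.
        measure M {\<omega>\<in>space M. \<epsilon>' \<le> nrm (y - x) \<omega>} < lam' \<longrightarrow>
        measure M {\<omega>\<in>space M. \<epsilon> \<le> nrm (T y - T x) \<omega>} < lam)"

definition bounded_op ::
  "'w measure \<Rightarrow> (('w \<Rightarrow> 'k::{real_normed_field,second_countable_topology}) \<Rightarrow> 'v::ab_group_add \<Rightarrow> 'v)
     \<Rightarrow> ('v \<Rightarrow> 'w \<Rightarrow> real) \<Rightarrow> ('v \<Rightarrow> 'v) \<Rightarrow> bool" where
  "bounded_op M smul nrm T \<longleftrightarrow>
     (\<forall>x y. T (x + y) = T x + T y) \<and>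
     (\<forall>\<xi>\<in>borel_measurable M. \<forall>x. T (smul \<xi> x) = smul \<xi> (T x)) \<and>
     el_continuous M nrm T"

definition is_ae_glb :: "'w measure \<Rightarrow> ('w \<Rightarrow> ereal) set \<Rightarrow> ('w \<Rightarrow> ereal) \<Rightarrow> bool" where
  "is_ae_glb M A \<eta> \<longleftrightarrow> \<eta> \<in> borel_measurable M \<and> (\<forall>a\<in>A. ae_le M \<eta> a) \<and>
     (\<forall>\<zeta>\<in>borel_measurable M. (\<forall>a\<in>A. ae_le M \<zeta> a) \<longrightarrow> ae_le M \<zeta> \<eta>)"

definition is_ae_lub :: "'w measure \<Rightarrow> ('w \<Rightarrow> ereal) set \<Rightarrow> ('w \<Rightarrow> ereal) \<Rightarrow> bool" where
  "is_ae_lub M A \<eta> \<longleftrightarrow> \<eta> \<in> borel_measurable M \<and> (\<forall>a\<in>A. ae_le M a \<eta>) \<and>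
     (\<forall>\<zeta>\<in>borel_measurable M. (\<forall>a\<in>A. ae_le M a \<zeta>) \<longrightarrow> ae_le M \<eta> \<zeta>)"

definition is_opnorm :: "'w measure \<Rightarrow> ('v \<Rightarrow> 'w \<Rightarrow> real) \<Rightarrow> ('v \<Rightarrow> 'v) \<Rightarrow> ('w \<Rightarrow> ereal) \<Rightarrow> bool" where
  "is_opnorm M nrm T \<eta> \<longleftrightarrow>
     is_ae_glb M {(\<lambda>\<omega>. ereal (\<xi> \<omega>)) | \<xi>. L0p M \<xi> \<and> (\<forall>x. AE \<omega> in M. nrm (T x) \<omega> \<le> \<xi> \<omega> * nrm x \<omega>)} \<eta>"

definition c0_semigroup ::
  "'w measure \<Rightarrow> (('w \<Rightarrow> 'k::{real_normed_field,second_countable_topology}) \<Rightarrow> 'v::ab_group_add \<Rightarrow> 'v)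
     \<Rightarrow> ('v \<Rightarrow> 'w \<Rightarrow> real) \<Rightarrow> (real \<Rightarrow> 'v \<Rightarrow> 'v) \<Rightarrow> bool" where
  "c0_semigroup M smul nrm T \<longleftrightarrow>
     (\<forall>t\<ge>0. bounded_op M smul nrm (T t)) \<and>
     T 0 = (\<lambda>x. x) \<and>
     (\<forall>s\<ge>0. \<forall>t\<ge>0. T s \<circ> T t = T (s + t)) \<and>
     (\<forall>x. tendsto_el M nrm (at_right 0) (\<lambda>t. T t x) x)"

definition as_bounded :: "'w measure \<Rightarrow> ('v \<Rightarrow> 'w \<Rightarrow> real) \<Rightarrow> (real \<Rightarrow> 'v \<Rightarrow> 'v) \<Rightarrow> bool" where
  "as_bounded M nrm T \<longleftrightarrow>
     (\<exists>L>0. \<exists>\<nu>. is_ae_lub M {\<eta>. \<exists>t\<in>{0..L}. is_opnorm M nrm (T t) \<eta>} \<nu> \<and>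
                (AE \<omega> in M. 0 \<le> \<nu> \<omega> \<and> \<nu> \<omega> < \<infinity>))"

definition gen_domain ::
  "'w measure \<Rightarrow> (('w \<Rightarrow> 'k::{real_normed_field,second_countable_topology}) \<Rightarrow> 'v::ab_group_add \<Rightarrow> 'v)
     \<Rightarrow> ('v \<Rightarrow> 'w \<Rightarrow> real) \<Rightarrow> (real \<Rightarrow> 'v \<Rightarrow> 'v) \<Rightarrow> 'v set" where
  "gen_domain M smul nrm T =
     {x. \<exists>y. tendsto_el M nrm (at_right 0)
                 (\<lambda>t. smul (\<lambda>\<omega>. of_real (1 / t)) (T t x - x)) y}"

definition L0_lipschitz_on ::
  "'w measure \<Rightarrow> ('v::ab_group_add \<Rightarrow> 'w \<Rightarrow> real) \<Rightarrow> real set \<Rightarrow> (real \<Rightarrow> 'v) \<Rightarrow> bool" where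
  "L0_lipschitz_on M nrm I f \<longleftrightarrow>
     (\<exists>\<xi>. L0p M \<xi> \<and> (\<forall>t1\<in>I. \<forall>t2\<in>I.
          AE \<omega> in M. nrm (f t1 - f t2) \<omega> \<le> \<xi> \<omega> * \<bar>t1 - t2\<bar>))"

end

theory Submission
  imports Defs
begin

text \<open>If the semigroup is bounded by \<open>C\<close> near 0, telescoping \<open>T h x - x\<close> over small steps and passing to the limit
  gives \<open>\<parallel>T h x - x\<parallel> \<le> C h \<parallel>A x\<parallel>\<close>, which is the Lipschitz property.

  Conversely, \<open>E min(1, \<parallel>x\<parallel>)\<close> metrizes the module, and Baire's theorem shows that the operators \<open>T t\<close>,
  \<open>t \<le> R\<close>, are equicontinuous in probability. Submultiplicativity of the operator norms upgrades this to an
  almost sure bound on every interval \<open>[a, b]\<close> with \<open>a > 0\<close>; only times near 0 remain. A second Baire argument, on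
  the domain of \<open>A\<close>, makes the Lipschitz hypothesis uniform: if the difference quotients of \<open>y\<close>
  are small in probability, then so is the supremum over \<open>s\<close> of \<open>\<parallel>T s (T h y - y)\<parallel> / h\<close>. For
  \<open>y = \<integral>\<^sub>0\<^sup>1 T u z du\<close> and \<open>h \<rightarrow> 0\<close> this controls \<open>\<parallel>T s (T 1 z - z)\<parallel>\<close>, hence \<open>\<parallel>T s z\<parallel>\<close>, uniformly in \<open>s \<le> 1\<close>. So the supremum
  of the orbit is continuous at 0 in probability, first for the dense set of \<open>z\<close> where it is finite and then
  for all \<open>z\<close>, and taking the essential supremum over the random unit ball gives the bound.\<close>

text \<open>In the converse, a bound in probability on each single operator norm, even uniform in
  time, says nothing about the essential supremum over uncountably many times; this gap shapes the
  proof. Submultiplicativity closes it only for times at least \<open>a > 0\<close>: the grid points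
  below \<open>t\<close> that must carry a large norm form a fixed fraction of the grid, and this
  fraction vanishes with \<open>a\<close>. Hence the separate treatment of times near 0, the only
  place where the Lipschitz hypothesis enters. The module structure matters because the operators
  commute with random scalars: vectors can be glued along events, and a vector can be divided by a
  random bound of its own orbit. The quotient has an orbit bounded by 1, on which smallness in
  probability is smallness in mean. Vectors with an a.s. bounded orbit are plentiful: the orbit of
  \<open>T a z\<close> on \<open>[0, 1]\<close> is that of \<open>z\<close> on
  \<open>[a, a + 1]\<close>. Orbits are shown to be right continuous only, and in probability, so
  suprema are limits of maxima over nested dyadic grids, and the decisive estimates are independent
  of the mesh.\<close>

section \<open>Dyadic grids and finite sums\<close>

text \<open>Rounding is upwards because \<open>T_right_continuous\<close> lets grid points approach
  \<open>t\<close> from the right.\<close>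

definition dyadic_above :: "nat \<Rightarrow> real \<Rightarrow> nat" where
  "dyadic_above n t = nat \<lceil>t * 2 ^ n\<rceil>"

lemma dyadic_above:
  assumes "0 \<le> t"
  shows "t \<le> real (dyadic_above n t) / 2 ^ n" "real (dyadic_above n t) / 2 ^ n \<le> t + 1 / 2 ^ n"
proof -
  have "real (dyadic_above n t) = of_int \<lceil>t * 2 ^ n\<rceil>"
    using assms by (simp add: dyadic_above_def)
  then have "t * 2 ^ n \<le> real (dyadic_above n t)" "real (dyadic_above n t) \<le> t * 2 ^ n + 1"
    by linarith+
  then show "t \<le> real (dyadic_above n t) / 2 ^ n" "real (dyadic_above n t) / 2 ^ n \<le> t + 1 / 2 ^ n"
    by (simp_all add: field_simps)
qed

lemma dyadic_above_le: "t \<le> real B \<Longrightarrow> dyadic_above n t \<le> B * 2 ^ n"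
proof -
  assume "t \<le> real B"
  then have "t * 2 ^ n \<le> of_int (int (B * 2 ^ n))" by simp
  then have "\<lceil>t * 2 ^ n\<rceil> \<le> int (B * 2 ^ n)" by (simp only: ceiling_le_iff)
  then show ?thesis unfolding dyadic_above_def by linarith
qed

lemma inverse_power_2_tendsto: "(\<lambda>n. 1 / 2 ^ n :: real) \<longlonglongrightarrow> 0"
  using LIMSEQ_realpow_zero[of "1/2::real"] by (simp add: power_one_over)

lemma dyadic_above_tendsto: "0 \<le> t \<Longrightarrow> (\<lambda>n. real (dyadic_above n t) / 2 ^ n) \<longlonglongrightarrow> t"
proof (rule tendsto_sandwich[OF _ _ tendsto_const])
  assume t: "0 \<le> t"
  show "eventually (\<lambda>n. t \<le> real (dyadic_above n t) / 2 ^ n) sequentially"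
    using dyadic_above(1)[OF t] by simp
  show "eventually (\<lambda>n. real (dyadic_above n t) / 2 ^ n \<le> t + 1 / 2 ^ n) sequentially"
    using dyadic_above(2)[OF t] by simp
  show "(\<lambda>n. t + 1 / 2 ^ n) \<longlonglongrightarrow> t"
    using tendsto_add[OF tendsto_const[of t] inverse_power_2_tendsto] by simp
qed

text \<open>The reflection \<open>j \<mapsto> i - j\<close> is injective on \<open>{1..J}\<close>
  since \<open>J \<le> i\<close>. So the \<open>j\<close> that satisfy \<open>P\<close> themselves
  and those whose mirror image does each number at most the cardinality on the right.\<close>

lemma card_reflection_cover:
  assumes i: "J \<le> i" "i \<le> n" and P: "\<And>j. 1 \<le> j \<Longrightarrow> j \<le> J \<Longrightarrow> P j \<or> P (i - j)"
  shows "J \<le> 2 * card {j. j \<le> n \<and> P j}"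
proof -
  let ?S = "{j. j \<le> n \<and> P j}"
  have "{1..J} \<subseteq> ({1..J} \<inter> ?S) \<union> {j\<in>{1..J}. i - j \<in> ?S}"
  proof
    fix j assume j: "j \<in> {1..J}"
    then have "P j \<or> P (i - j)" by (intro P) auto
    then show "j \<in> ({1..J} \<inter> ?S) \<union> {j\<in>{1..J}. i - j \<in> ?S}" using i j by auto
  qed
  then have "card {1..J} \<le> card (({1..J} \<inter> ?S) \<union> {j\<in>{1..J}. i - j \<in> ?S})"
    by (intro card_mono) auto
  also have "\<dots> \<le> card ({1..J} \<inter> ?S) + card {j\<in>{1..J}. i - j \<in> ?S}" by (rule card_Un_le)
  also have "card ({1..J} \<inter> ?S) \<le> card ?S" by (rule card_mono) auto
  also have "card {j\<in>{1..J}. i - j \<in> ?S} \<le> card ?S"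
  proof (rule card_inj_on_le[where f="\<lambda>j. i - j"])
    show "inj_on (\<lambda>j. i - j) {j\<in>{1..J}. i - j \<in> ?S}"
      using i by (auto simp: inj_on_def)
  qed auto
  finally show ?thesis by simp
qed

lemma sum_lessThan_add:
  fixes f :: "nat \<Rightarrow> 'v::comm_monoid_add"
  shows "(\<Sum>i<a + b. f i) = (\<Sum>i<a. f i) + (\<Sum>i<b. f (i + a))"
  by (induction b) (simp_all add: add.commute add.left_commute)

text \<open>Both sides come from splitting one sum of \<open>n + k\<close> terms in two ways.
  Discrete counterpart of the fact that shifting the window \<open>[0, 1]\<close> by
  \<open>t\<close> changes an integral by the integral of \<open>f (u + 1) - f u\<close> over
  \<open>[0, t]\<close>.\<close>

lemma sum_shift_diff:
  fixes f :: "nat \<Rightarrow> 'v::ab_group_add"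
  shows "(\<Sum>i<n. f (i + k)) - (\<Sum>i<n. f i) = (\<Sum>i<k. f (i + n) - f i)"
  using sum_lessThan_add[of f k n] sum_lessThan_add[of f n k]
  by (simp add: sum_subtractf add.commute algebra_simps)

section \<open>Truncated expectations\<close>

text \<open>The standard F-norm of convergence in probability. It is subadditive but not
  homogeneous, so scaling costs the factor in \<open>Phi_scale\<close>, and averages need a detour
  through means.\<close>

definition Phi :: "'w measure \<Rightarrow> ('w \<Rightarrow> real) \<Rightarrow> real" where
  "Phi M f = (\<integral>\<omega>. min 1 \<bar>f \<omega>\<bar> \<partial>M)"

context prob_space
begin

lemma Phi_integrable: "f \<in> borel_measurable M \<Longrightarrow> integrable M (\<lambda>\<omega>. min 1 \<bar>f \<omega>\<bar> :: real)"
  by (rule integrable_const_bound[where B=1]) auto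

lemma Phi_nonneg: "0 \<le> Phi M f"
  unfolding Phi_def by (rule integral_nonneg_AE) auto

lemma Phi_mono:
  assumes "f \<in> borel_measurable M" "g \<in> borel_measurable M" "AE \<omega> in M. \<bar>f \<omega>\<bar> \<le> \<bar>g \<omega>\<bar>"
  shows "Phi M f \<le> Phi M g"
  unfolding Phi_def using assms(3) by (intro integral_mono_AE Phi_integrable assms) auto

lemma Phi_cong_AE:
  assumes "f \<in> borel_measurable M" "g \<in> borel_measurable M" "AE \<omega> in M. \<bar>f \<omega>\<bar> = \<bar>g \<omega>\<bar>"
  shows "Phi M f = Phi M g"
  using assms(3) by (intro antisym Phi_mono assms(1,2)) auto

lemma Phi_zero: "Phi M (\<lambda>_. 0) = 0"
  by (simp add: Phi_def)

lemma Phi_le_1: "f \<in> borel_measurable M \<Longrightarrow> Phi M f \<le> 1"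
proof -
  assume f: "f \<in> borel_measurable M"
  have "Phi M f \<le> (\<integral>\<omega>. 1 \<partial>M)"
    unfolding Phi_def by (intro integral_mono Phi_integrable f) auto
  then show ?thesis by (simp add: prob_space)
qed

lemma Phi_add:
  assumes [measurable]: "f \<in> borel_measurable M" "g \<in> borel_measurable M" "h \<in> borel_measurable M"
    and "AE \<omega> in M. \<bar>h \<omega>\<bar> \<le> \<bar>f \<omega>\<bar> + \<bar>g \<omega>\<bar>"
  shows "Phi M h \<le> Phi M f + Phi M g"
proof -
  have "Phi M h \<le> (\<integral>\<omega>. min 1 \<bar>f \<omega>\<bar> + min 1 \<bar>g \<omega>\<bar> \<partial>M)"
    unfolding Phi_def using assms(4)
    by (intro integral_mono_AE Bochner_Integration.integrable_add Phi_integrable) auto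
  also have "\<dots> = Phi M f + Phi M g"
    unfolding Phi_def by (intro Bochner_Integration.integral_add Phi_integrable) auto
  finally show ?thesis .
qed

lemma Phi_sum_bound:
  assumes "finite I" and [measurable]: "\<And>i. i \<in> I \<Longrightarrow> f i \<in> borel_measurable M" "h \<in> borel_measurable M"
    and "AE \<omega> in M. \<bar>h \<omega>\<bar> \<le> (\<Sum>i\<in>I. \<bar>f i \<omega>\<bar>)"
  shows "Phi M h \<le> (\<Sum>i\<in>I. Phi M (f i))"
  using assms
proof (induction I arbitrary: h rule: finite_induct)
  case empty
  then have "Phi M h \<le> Phi M (\<lambda>_. 0)" by (intro Phi_mono) auto
  then show ?case by (simp add: Phi_zero)
next
  case (insert i I)
  have [measurable]: "f i \<in> borel_measurable M" "h \<in> borel_measurable M" using insert by auto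
  have m: "(\<lambda>\<omega>. \<Sum>i\<in>I. \<bar>f i \<omega>\<bar>) \<in> borel_measurable M"
    using insert by (intro borel_measurable_sum) auto
  have "Phi M h \<le> Phi M (f i) + Phi M (\<lambda>\<omega>. \<Sum>i\<in>I. \<bar>f i \<omega>\<bar>)"
    using insert.prems(3) insert.hyps by (intro Phi_add m) (auto simp: sum_nonneg)
  also have "Phi M (\<lambda>\<omega>. \<Sum>i\<in>I. \<bar>f i \<omega>\<bar>) \<le> (\<Sum>i\<in>I. Phi M (f i))"
    using insert m by (intro insert.IH) (auto simp: sum_nonneg)
  finally show ?case using insert by simp
qed

text \<open>Together with \<open>Phi_le_prob\<close> this makes \<open>Phi\<close> and tail
  probabilities interchangeable. The restriction \<open>e \<le> 1\<close> reflects the truncation at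
  1.\<close>

lemma Phi_markov:
  assumes [measurable]: "f \<in> borel_measurable M" and e: "0 < e" "e \<le> 1"
  shows "measure M {\<omega>\<in>space M. e \<le> \<bar>f \<omega>\<bar>} \<le> Phi M f / e"
proof -
  have "measure M {\<omega>\<in>space M. e \<le> min 1 \<bar>f \<omega>\<bar>} \<le> (\<integral>\<omega>. min 1 \<bar>f \<omega>\<bar> \<partial>M) / e"
    by (rule integral_Markov_inequality_measure[where A="{}"]) (use e in \<open>auto intro!: Phi_integrable\<close>)
  moreover have "{\<omega>\<in>space M. e \<le> min 1 \<bar>f \<omega>\<bar>} = {\<omega>\<in>space M. e \<le> \<bar>f \<omega>\<bar>}"
    using e by auto
  ultimately show ?thesis by (simp add: Phi_def)
qed

lemma Phi_le_prob:
  assumes [measurable]: "f \<in> borel_measurable M" and e: "0 \<le> e"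
  shows "Phi M f \<le> e + measure M {\<omega>\<in>space M. e \<le> \<bar>f \<omega>\<bar>}"
proof -
  let ?A = "{\<omega>\<in>space M. e \<le> \<bar>f \<omega>\<bar>}"
  have [measurable]: "?A \<in> sets M" by measurable
  have i: "integrable M (indicat_real ?A)"
    by (rule integrable_real_indicator) (auto simp: emeasure_eq_measure)
  have "Phi M f \<le> (\<integral>\<omega>. e + indicat_real ?A \<omega> \<partial>M)"
    unfolding Phi_def using e i
    by (intro integral_mono Phi_integrable Bochner_Integration.integrable_add)
       (auto split: split_indicator)
  also have "\<dots> = e + measure M ?A"
    using i by (subst Bochner_Integration.integral_add) (auto simp: prob_space)
  finally show ?thesis .
qed

lemma Phi_scale:
  assumes [measurable]: "f \<in> borel_measurable M"
  shows "Phi M (\<lambda>\<omega>. c * f \<omega>) \<le> max 1 \<bar>c\<bar> * Phi M f"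
proof -
  have "min 1 \<bar>c * x\<bar> \<le> max 1 \<bar>c\<bar> * min 1 \<bar>x\<bar>" for x :: real
  proof (cases "\<bar>x\<bar> \<le> 1")
    case True
    have "\<bar>c * x\<bar> \<le> max 1 \<bar>c\<bar> * \<bar>x\<bar>" by (simp add: abs_mult mult_right_mono)
    then show ?thesis using True by (simp add: min_def)
  next
    case False
    then have "min 1 \<bar>x\<bar> = 1" by simp
    then show ?thesis by (simp add: min.coboundedI1)
  qed
  then have "Phi M (\<lambda>\<omega>. c * f \<omega>) \<le> (\<integral>\<omega>. max 1 \<bar>c\<bar> * min 1 \<bar>f \<omega>\<bar> \<partial>M)"
    unfolding Phi_def by (intro integral_mono integrable_mult_right Phi_integrable) auto
  then show ?thesis by (simp add: Phi_def)
qed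

text \<open>On \<open>[0, b]\<close> the concave function \<open>min 1\<close> lies above its chord,
  that is \<open>y \<le> b * min 1 y\<close>. For bounded variables, smallness in probability thus
  yields smallness in mean.\<close>

lemma Phi_bounded_le:
  assumes [measurable]: "f \<in> borel_measurable M" "AE \<omega> in M. \<bar>f \<omega>\<bar> \<le> b" "1 \<le> b"
  shows "(\<integral>\<omega>. \<bar>f \<omega>\<bar> \<partial>M) \<le> b * Phi M f"
proof -
  have i: "integrable M (\<lambda>\<omega>. \<bar>f \<omega>\<bar>)"
    by (rule integrable_const_bound[where B=b]) (use assms in auto)
  have "y \<le> b * min 1 y" if "0 \<le> y" "y \<le> b" for y
    using that assms(3) mult_right_mono[of 1 b y] by (auto simp: min_def)
  then have "(\<integral>\<omega>. \<bar>f \<omega>\<bar> \<partial>M) \<le> (\<integral>\<omega>. b * min 1 \<bar>f \<omega>\<bar> \<partial>M)"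
    using assms(2) by (intro integral_mono_AE i integrable_mult_right Phi_integrable) auto
  then show ?thesis by (simp add: Phi_def)
qed

lemma Phi_le_integral:
  assumes [measurable]: "f \<in> borel_measurable M" and "integrable M (\<lambda>\<omega>. \<bar>f \<omega>\<bar>)"
  shows "Phi M f \<le> (\<integral>\<omega>. \<bar>f \<omega>\<bar> \<partial>M)"
  unfolding Phi_def by (intro integral_mono Phi_integrable assms) auto

lemma Phi_tendsto_AE:
  assumes [measurable]: "\<And>n. f n \<in> borel_measurable M" "g \<in> borel_measurable M"
    and "AE \<omega> in M. (\<lambda>n. f n \<omega>) \<longlonglongrightarrow> g \<omega>"
  shows "(\<lambda>n. Phi M (f n)) \<longlonglongrightarrow> Phi M g"
  unfolding Phi_def
proof (rule integral_dominated_convergence[where w="\<lambda>_. 1"])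
  show "AE \<omega> in M. (\<lambda>n. min 1 \<bar>f n \<omega>\<bar>) \<longlonglongrightarrow> min 1 \<bar>g \<omega>\<bar>"
    using assms(3) by eventually_elim (intro tendsto_intros)
qed auto

text \<open>Every real random variable is stochastically bounded: the quotients tend to 0 pointwise
  and the integrands stay below 1. In this way a merely finite random bound meets the covering
  hypothesis of \<open>Baire_uniform_continuity\<close>.\<close>

lemma Phi_divide_tendsto:
  assumes [measurable]: "f \<in> borel_measurable M"
  shows "(\<lambda>n. Phi M (\<lambda>\<omega>. f \<omega> / real n)) \<longlonglongrightarrow> 0"
proof -
  have "(\<lambda>n. Phi M (\<lambda>\<omega>. f \<omega> / real n)) \<longlonglongrightarrow> Phi M (\<lambda>_. 0)"
    by (rule Phi_tendsto_AE) (auto intro!: AE_I2 real_tendsto_divide_at_top filterlim_real_sequentially)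
  then show ?thesis by (simp add: Phi_zero)
qed

lemma Phi_divide_small:
  assumes "f \<in> borel_measurable M" "0 < e"
  obtains n :: nat where "n \<ge> 1" "Phi M (\<lambda>\<omega>. f \<omega> / real n) < e"
proof -
  obtain N where "\<forall>n\<ge>N. Phi M (\<lambda>\<omega>. f \<omega> / real n) < e"
    using order_tendstoD(2)[OF Phi_divide_tendsto[OF assms(1)] assms(2)]
    by (auto simp: eventually_sequentially)
  then show ?thesis using that[of "max 1 N"] by auto
qed

lemma Phi_eq_0D:
  assumes [measurable]: "f \<in> borel_measurable M" and "Phi M f \<le> 0"
  shows "AE \<omega> in M. f \<omega> = 0"
proof -
  have "Phi M f = 0" using assms(2) Phi_nonneg[of f] by auto
  then have "AE \<omega> in M. min 1 \<bar>f \<omega>\<bar> = 0"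
    unfolding Phi_def by (subst (asm) integral_nonneg_eq_0_iff_AE) (auto intro: Phi_integrable)
  then show ?thesis by eventually_elim (auto simp: min_def split: if_splits)
qed

section \<open>Essential suprema and infima, and suprema of stochastically bounded sequences\<close>

text \<open>A countable subfamily exhausts the essential supremum, because for each rational level
  the probabilities of the countable unions of superlevel sets attain their supremum.\<close>

lemma ess_sup_countable:
  fixes A :: "('a \<Rightarrow> ereal) set"
  assumes meas: "\<And>f. f \<in> A \<Longrightarrow> f \<in> borel_measurable M"
  obtains B where "countable B" "B \<subseteq> A" "\<And>f. f \<in> A \<Longrightarrow> AE \<omega> in M. f \<omega> \<le> (SUP g\<in>B. g \<omega>)"
proof -
  define U where "U q C = (\<Union>g\<in>C. {\<omega>\<in>space M. ereal q < g \<omega>})" for q C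
  have Um: "U q C \<in> sets M" if "countable C" "C \<subseteq> A" for q C
  proof -
    have "{\<omega>\<in>space M. ereal q < g \<omega>} \<in> sets M" if "g \<in> C" for g
    proof -
      have [measurable]: "g \<in> borel_measurable M" using meas that \<open>C \<subseteq> A\<close> by auto
      show ?thesis by measurable
    qed
    then show ?thesis unfolding U_def using that by (intro sets.countable_UN'') auto
  qed
  have ex: "\<exists>B. countable B \<and> B \<subseteq> A \<and> (\<forall>C. countable C \<and> C \<subseteq> A \<longrightarrow> measure M (U q C) \<le> measure M (U q B))" for q
  proof -
    let ?S = "(\<lambda>C. measure M (U q C)) ` {C. countable C \<and> C \<subseteq> A}"
    have bdd: "bdd_above ?S" by (auto intro!: bdd_aboveI2[where M=1])
    have ne: "?S \<noteq> {}" by auto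
    define s where "s = Sup ?S"
    have "\<exists>C. countable C \<and> C \<subseteq> A \<and> s - 1 / real (Suc n) < measure M (U q C)" for n
    proof -
      have "s - 1 / real (Suc n) < Sup ?S" by (simp add: s_def)
      then show ?thesis using less_cSup_iff[OF ne bdd] by auto
    qed
    then have "\<forall>n. \<exists>C. countable C \<and> C \<subseteq> A \<and> s - 1 / real (Suc n) < measure M (U q C)" by blast
    then obtain C where C': "\<forall>n. countable (C n) \<and> C n \<subseteq> A \<and> s - 1 / real (Suc n) < measure M (U q (C n))"
      by (rule choice[THEN exE])
    then have C: "\<And>n. countable (C n)" "\<And>n. C n \<subseteq> A"
      "\<And>n. s - 1 / real (Suc n) < measure M (U q (C n))" by simp_all
    let ?B = "\<Union>n. C n"
    have B: "countable ?B" "?B \<subseteq> A" using C by auto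
    have "s - 1 / real (Suc n) \<le> measure M (U q ?B)" for n
    proof -
      have "measure M (U q (C n)) \<le> measure M (U q ?B)"
        using Um[OF B] by (intro finite_measure_mono) (auto simp: U_def)
      then show ?thesis using C(3)[of n] by linarith
    qed
    moreover have "(\<lambda>n. s - 1 / real (Suc n)) \<longlonglongrightarrow> s - 0"
      by (intro tendsto_diff tendsto_const LIMSEQ_Suc[OF lim_1_over_n])
    ultimately have "s \<le> measure M (U q ?B)"
      by (intro LIMSEQ_le_const2) auto
    then have "measure M (U q D) \<le> measure M (U q ?B)" if "countable D" "D \<subseteq> A" for D
          proof -
      have "measure M (U q D) \<le> s" unfolding s_def using that by (intro cSup_upper bdd) auto
      then show ?thesis using \<open>s \<le> measure M (U q ?B)\<close> by linarith
    qed
    then show ?thesis using B by blast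
  qed
  then have "\<forall>q. \<exists>B. countable B \<and> B \<subseteq> A \<and> (\<forall>C. countable C \<and> C \<subseteq> A \<longrightarrow> measure M (U q C) \<le> measure M (U q B))"
    by blast
  then obtain B where B': "\<forall>q. countable (B q) \<and> B q \<subseteq> A \<and>
      (\<forall>C. countable C \<and> C \<subseteq> A \<longrightarrow> measure M (U q C) \<le> measure M (U q (B q)))"
    by (rule choice[THEN exE])
  have B: "\<And>q. countable (B q)" "\<And>q. B q \<subseteq> A"
    using B' by simp_all
  have Bmax: "measure M (U q C) \<le> measure M (U q (B q))" if "countable C" "C \<subseteq> A" for q C
    using B' that by simp
  define D where "D = (\<Union>q\<in>\<rat>. B q)"
  have D: "countable D" "D \<subseteq> A" using B by (auto simp: D_def countable_rat)
  have "AE \<omega> in M. f \<omega> \<le> (SUP g\<in>D. g \<omega>)" if f: "f \<in> A" for f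
  proof -
    have "AE \<omega> in M. ereal q < f \<omega> \<longrightarrow> \<omega> \<in> U q (B q)" for q
    proof -
      \<comment> \<open>Adjoining \<open>f\<close> to \<open>B q\<close> cannot raise the maximal
        probability, so \<open>f\<close> exceeds the level \<open>q\<close> outside
        \<open>U q (B q)\<close> only on a null set.\<close>
      let ?C = "insert f (B q)"
      have C: "countable ?C" "?C \<subseteq> A" using B f by auto
      have sub: "U q (B q) \<subseteq> U q ?C" by (auto simp: U_def)
      have "measure M (U q ?C - U q (B q)) = measure M (U q ?C) - measure M (U q (B q))"
        using Um[OF C] Um[OF B(1,2)] sub by (intro finite_measure_Diff) auto
      also have "\<dots> \<le> 0" using Bmax[OF C, of q] by simp
      finally have "emeasure M (U q ?C - U q (B q)) = 0"
        by (simp add: emeasure_eq_measure measure_le_0_iff)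
      then have "U q ?C - U q (B q) \<in> null_sets M" using Um[OF C] Um[OF B(1,2)] by auto
      from AE_not_in[OF this] show ?thesis
        using AE_space by eventually_elim (auto simp: U_def)
    qed
    then have "AE \<omega> in M. \<forall>q\<in>\<rat>. ereal q < f \<omega> \<longrightarrow> \<omega> \<in> U q (B q)"
      by (subst AE_ball_countable) (auto simp: countable_rat)
    then show ?thesis
    proof eventually_elim
      case (elim \<omega>)
      show ?case
      proof (rule ccontr)
        assume "\<not> f \<omega> \<le> (SUP g\<in>D. g \<omega>)"
        then have "(SUP g\<in>D. g \<omega>) < f \<omega>" by (simp only: not_le)
        from ereal_dense2[OF this] obtain r where r: "(SUP g\<in>D. g \<omega>) < ereal r" "ereal r < f \<omega>" by blast
        from ereal_dense2[OF r(2)] obtain r' where r': "ereal r < ereal r'" "ereal r' < f \<omega>" by blast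
        from Rats_dense_in_real[of r r'] r'(1) obtain q where q: "q \<in> \<rat>" "r < q" "q < r'" by auto
        have "ereal q < ereal r'" using q by simp
        then have "ereal q < f \<omega>" using r'(2) by (rule less_trans)
        then have "\<omega> \<in> U q (B q)" using elim q by auto
        then obtain g where "g \<in> B q" "ereal q < g \<omega>" by (auto simp: U_def)
        then have "ereal q < (SUP g\<in>D. g \<omega>)"
          using q by (auto simp: D_def less_SUP_iff)
        then have "ereal q < ereal r" using r(1) by (rule less_trans)
        then show False using q by simp
      qed
    qed
  qed
  then show ?thesis using that D by blast
qed

lemma ess_lub_exists:
  fixes A :: "('a \<Rightarrow> ereal) set"
  assumes "\<And>f. f \<in> A \<Longrightarrow> f \<in> borel_measurable M"
  shows "\<exists>\<nu>. is_ae_lub M A \<nu>"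
proof -
  obtain B where B: "countable B" "B \<subseteq> A" "\<And>f. f \<in> A \<Longrightarrow> AE \<omega> in M. f \<omega> \<le> (SUP g\<in>B. g \<omega>)"
    using ess_sup_countable[of A] assms by blast
  have m: "(\<lambda>\<omega>. SUP g\<in>B. g \<omega>) \<in> borel_measurable M"
    using B assms by (intro borel_measurable_SUP) auto
  have "AE \<omega> in M. (SUP g\<in>B. g \<omega>) \<le> \<zeta> \<omega>" if "\<forall>a\<in>A. AE \<omega> in M. a \<omega> \<le> \<zeta> \<omega>" for \<zeta>
  proof -
    have "AE \<omega> in M. \<forall>g\<in>B. g \<omega> \<le> \<zeta> \<omega>"
      using B that by (subst AE_ball_countable) auto
    then show ?thesis by eventually_elim (auto intro: SUP_least)
  qed
  then have "is_ae_lub M A (\<lambda>\<omega>. SUP g\<in>B. g \<omega>)"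
    using m B(3) by (auto simp: is_ae_lub_def ae_le_def)
  then show ?thesis by blast
qed

text \<open>Obtained from suprema by negation. The representation as a pointwise infimum over a
  countable family is exported because \<open>opnorm_attained\<close> argues at single
  points.\<close>

lemma ess_glb_exists:
  fixes A :: "('a \<Rightarrow> ereal) set"
  assumes "\<And>f. f \<in> A \<Longrightarrow> f \<in> borel_measurable M"
  obtains B \<eta> where "countable B" "B \<subseteq> A" "is_ae_glb M A \<eta>" "\<And>\<omega>. \<eta> \<omega> = (INF g\<in>B. g \<omega>)"
proof -
  let ?A = "(\<lambda>f \<omega>. - f \<omega>) ` A"
  have "\<And>f. f \<in> ?A \<Longrightarrow> f \<in> borel_measurable M" using assms by auto
  then obtain C where C: "countable C" "C \<subseteq> ?A" "\<And>f. f \<in> ?A \<Longrightarrow> AE \<omega> in M. f \<omega> \<le> (SUP g\<in>C. g \<omega>)"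
    using ess_sup_countable[of ?A] by blast
  obtain B where B: "B \<subseteq> A" "countable B" "C = (\<lambda>f \<omega>. - f \<omega>) ` B"
    using C(1,2) by (metis (no_types, lifting) countable_subset_image)
  have eq: "(SUP g\<in>C. g \<omega>) = - (INF g\<in>B. g \<omega>)" for \<omega>
    unfolding B(3) by (simp add: image_image ereal_INF_uminus_eq[symmetric] ereal_SUP_uminus_eq)
  have m: "(\<lambda>\<omega>. INF g\<in>B. g \<omega>) \<in> borel_measurable M"
    using B assms by (intro borel_measurable_INF) auto
  have low: "AE \<omega> in M. (INF g\<in>B. g \<omega>) \<le> a \<omega>" if "a \<in> A" for a
    using C(3)[of "\<lambda>\<omega>. - a \<omega>"] that by (auto simp: eq)
  have "AE \<omega> in M. \<zeta> \<omega> \<le> (INF g\<in>B. g \<omega>)" if "\<forall>a\<in>A. AE \<omega> in M. \<zeta> \<omega> \<le> a \<omega>" for \<zeta>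
  proof -
    have "AE \<omega> in M. \<forall>g\<in>B. \<zeta> \<omega> \<le> g \<omega>"
      using B that by (subst AE_ball_countable) auto
    then show ?thesis by eventually_elim (auto intro: INF_greatest)
  qed
  then have "is_ae_glb M A (\<lambda>\<omega>. INF g\<in>B. g \<omega>)"
    using m low by (auto simp: is_ae_glb_def ae_le_def)
  then show ?thesis using that B by blast
qed

text \<open>Where the supremum is infinite, the truncation of \<open>g k / c\<close> eventually
  equals 1, so that event has probability at most \<open>e\<close>. The constant \<open>c\<close>
  may depend on \<open>e\<close> but not on \<open>k\<close>.\<close>

lemma Phi_le_imp_AE_finite:
  assumes [measurable]: "\<And>k. g k \<in> borel_measurable M"
    and inc: "AE \<omega> in M. incseq (\<lambda>k. g k \<omega>)" and nn: "AE \<omega> in M. \<forall>k. 0 \<le> (g k \<omega> :: real)"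
    and bd: "\<And>e. 0 < e \<Longrightarrow> \<exists>c>0. \<forall>k::nat. Phi M (\<lambda>\<omega>. g k \<omega> / c) \<le> e"
  shows "AE \<omega> in M. (SUP k. ereal (g k \<omega>)) < \<infinity>"
proof -
  let ?h = "\<lambda>\<omega>. (SUP k. ereal (g k \<omega>)) :: ereal"
  have [measurable]: "?h \<in> borel_measurable M" by measurable
  let ?B = "{\<omega>\<in>space M. ?h \<omega> = \<infinity>}"
  have Bs: "?B \<in> sets M" by measurable
  have "measure M ?B \<le> e" if e: "0 < e" for e
  proof -
    obtain c where c: "c > 0" "\<And>k. Phi M (\<lambda>\<omega>. g k \<omega> / c) \<le> e" using bd[OF e] by blast
    let ?f = "\<lambda>k \<omega>. min 1 \<bar>g k \<omega> / c\<bar> * indicat_real ?B \<omega>"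
    have "(\<lambda>k. \<integral>\<omega>. ?f k \<omega> \<partial>M) \<longlonglongrightarrow> (\<integral>\<omega>. indicat_real ?B \<omega> \<partial>M)"
    proof (rule integral_dominated_convergence[where w="\<lambda>_. 1"])
      show "AE \<omega> in M. (\<lambda>k. ?f k \<omega>) \<longlonglongrightarrow> indicat_real ?B \<omega>"
        using inc nn
      proof eventually_elim
        case (elim \<omega>)
        show ?case
        proof (cases "\<omega> \<in> ?B")
          case True
          then have "?h \<omega> = \<infinity>" by auto
          then have "ereal c < ?h \<omega>" by simp
          then obtain K where K: "c < g K \<omega>" by (auto simp: less_SUP_iff)
          have "\<forall>k\<ge>K. ?f k \<omega> = 1"
          proof (intro allI impI)
            fix k assume "k \<ge> K"
            then have "c < g k \<omega>" using K incseqD[OF elim(1)] by (meson less_le_trans)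
            then show "?f k \<omega> = 1" using c(1) True by (simp add: min_def field_simps)
          qed
          then show ?thesis using True
            by (intro tendsto_eventually) (auto simp: eventually_sequentially)
        qed auto
      qed
    qed (use Bs in \<open>auto simp: indicator_def\<close>)
    moreover have "(\<integral>\<omega>. ?f k \<omega> \<partial>M) \<le> e" for k
    proof -
      have "(\<integral>\<omega>. ?f k \<omega> \<partial>M) \<le> Phi M (\<lambda>\<omega>. g k \<omega> / c)"
        unfolding Phi_def using Bs
        by (intro integral_mono Phi_integrable integrable_const_bound[where B=1]) (auto simp: indicator_def)
      then show ?thesis using c(2)[of k] by linarith
    qed
    ultimately have "(\<integral>\<omega>. indicat_real ?B \<omega> \<partial>M) \<le> e"
      by (intro LIMSEQ_le_const2) auto
    then show ?thesis using Bs by simp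
  qed
  then have "measure M ?B \<le> 0" by (rule field_le_epsilon) simp
  then have "measure M ?B = 0" by (simp add: measure_le_0_iff)
  then have "?B \<in> null_sets M" using Bs by (auto simp: emeasure_eq_measure)
  from AE_not_in[OF this] show ?thesis using AE_space by eventually_elim auto
qed

lemma stochastically_bounded_sup:
  assumes [measurable]: "\<And>k. g k \<in> borel_measurable M"
    and inc: "AE \<omega> in M. incseq (\<lambda>k. g k \<omega>)" and nn: "AE \<omega> in M. \<forall>k. 0 \<le> (g k \<omega> :: real)"
    and bd: "\<And>e. 0 < e \<Longrightarrow> \<exists>c>0. \<forall>k::nat. Phi M (\<lambda>\<omega>. g k \<omega> / c) \<le> e"
  obtains m where "m \<in> borel_measurable M" "\<And>\<omega>. 0 \<le> m \<omega>"
    "AE \<omega> in M. \<forall>k. g k \<omega> \<le> m \<omega>" "AE \<omega> in M. (\<lambda>k. g k \<omega>) \<longlonglongrightarrow> m \<omega>"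
    "\<And>c e. (\<And>k. Phi M (\<lambda>\<omega>. g k \<omega> / c) \<le> e) \<Longrightarrow> Phi M (\<lambda>\<omega>. m \<omega> / c) \<le> e"
proof -
  let ?h = "\<lambda>\<omega>. (SUP k. ereal (g k \<omega>)) :: ereal"
  \<comment> \<open>An infinite supremum is sent to 0 by \<open>real_of_ereal\<close>; this concerns
    only a null set, as \<open>fin\<close> shows next. \<open>max 0\<close> makes nonnegativity hold
    everywhere.\<close>
  define m where "m \<omega> = max 0 (real_of_ereal (?h \<omega>))" for \<omega>
  have mm [measurable]: "m \<in> borel_measurable M" unfolding m_def by measurable
  have fin: "AE \<omega> in M. (SUP k. ereal (g k \<omega>)) < \<infinity>"
    by (rule Phi_le_imp_AE_finite[of g]) (use assms in simp_all)
  have ae: "AE \<omega> in M. (\<forall>k. g k \<omega> \<le> m \<omega>) \<and> (\<lambda>k. g k \<omega>) \<longlonglongrightarrow> m \<omega>"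
    using fin inc nn
  proof eventually_elim
    case (elim \<omega>)
    have g0: "ereal (g 0 \<omega>) \<le> ?h \<omega>" by (rule SUP_upper) auto
    moreover have "0 \<le> ereal (g 0 \<omega>)" using elim(3) by simp
    ultimately have h0: "0 \<le> ?h \<omega>" by (rule order_trans[rotated])
    then obtain r where r: "?h \<omega> = ereal r" using elim(1) by (cases "?h \<omega>") auto
    then have mr: "m \<omega> = r" using h0 by (simp add: m_def)
    have le: "g k \<omega> \<le> r" for k
    proof -
      have "ereal (g k \<omega>) \<le> ?h \<omega>" by (rule SUP_upper) auto
      then show ?thesis using r by simp
    qed
    have "incseq (\<lambda>k. ereal (g k \<omega>))" using elim(2) by (auto simp: incseq_def)
    then have "(\<lambda>k. ereal (g k \<omega>)) \<longlonglongrightarrow> ereal r" using LIMSEQ_SUP[of "\<lambda>k. ereal (g k \<omega>)"] r by simp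
    then show ?case using le mr by (simp add: lim_ereal)
  qed
  have "Phi M (\<lambda>\<omega>. m \<omega> / c) \<le> e" if "\<And>k. Phi M (\<lambda>\<omega>. g k \<omega> / c) \<le> e" for c e
  proof -
    have "(\<lambda>k. Phi M (\<lambda>\<omega>. g k \<omega> / c)) \<longlonglongrightarrow> Phi M (\<lambda>\<omega>. m \<omega> / c)"
    proof (rule Phi_tendsto_AE)
      show "AE \<omega> in M. (\<lambda>k. g k \<omega> / c) \<longlonglongrightarrow> m \<omega> / c"
        using ae by eventually_elim (auto simp: divide_inverse intro: tendsto_mult)
    qed auto
    then show ?thesis using that by (intro LIMSEQ_le_const2) auto
  qed
  then show ?thesis using ae that[of m] mm by (auto simp: m_def AE_conj_iff)
qed

end

section \<open>Baire category in metrizable groups\<close>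

text \<open>The locale \<open>Metric_space\<close> asks for nonnegativity and symmetry on the whole
  type, hence the value 0 off \<open>D\<close>. Symmetry comes from subadditivity applied to
  \<open>0 - x\<close>.\<close>

lemma Metric_space_group_norm:
  fixes N :: "'v::ab_group_add \<Rightarrow> real"
  assumes D0: "0 \<in> D" and Dm: "\<And>x y. x \<in> D \<Longrightarrow> y \<in> D \<Longrightarrow> x - y \<in> D"
    and nn: "\<And>x. x \<in> D \<Longrightarrow> 0 \<le> N x" and z: "\<And>x. x \<in> D \<Longrightarrow> N x = 0 \<longleftrightarrow> x = 0"
    and sub: "\<And>x y. x \<in> D \<Longrightarrow> y \<in> D \<Longrightarrow> N (x - y) \<le> N x + N y"
  shows "Metric_space D (\<lambda>x y. if x \<in> D \<and> y \<in> D then N (x - y) else 0)"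
proof -
  have neg: "- x \<in> D" if "x \<in> D" for x using Dm[OF D0 that] by simp
  have N0: "N 0 = 0" using z[OF D0] by simp
  have neg_le: "N (- x) \<le> N x" if "x \<in> D" for x
    using sub[OF D0 that] N0 by simp
  have sym: "N (- x) = N x" if "x \<in> D" for x
    using neg_le[OF that] neg_le[OF neg[OF that]] by simp
  have tri: "N (x - u) \<le> N (x - y) + N (y - u)" if "x \<in> D" "y \<in> D" "u \<in> D" for x y u
  proof -
    have "N (x - u) \<le> N (x - y) + N (u - y)"
      using sub[of "x - y" "u - y"] Dm that by simp
    then show ?thesis using sym[OF Dm[of u y]] that by simp
  qed
  show ?thesis
  proof
    show "0 \<le> (if x \<in> D \<and> y \<in> D then N (x - y) else 0)" for x y
      using nn Dm by auto
    show "(if x \<in> D \<and> y \<in> D then N (x - y) else 0) = (if y \<in> D \<and> x \<in> D then N (y - x) else 0)" for x y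
      using sym[OF Dm[of y x]] by simp
    show "((if x \<in> D \<and> y \<in> D then N (x - y) else 0) = 0) = (x = y)" if "x \<in> D" "y \<in> D" for x y
      using z[OF Dm[OF that]] that by simp
    show "(if x \<in> D \<and> u \<in> D then N (x - u) else 0)
      \<le> (if x \<in> D \<and> y \<in> D then N (x - y) else 0) + (if y \<in> D \<and> u \<in> D then N (y - u) else 0)"
      if "x \<in> D" "y \<in> D" "u \<in> D" for x y u
      using tri that by simp
  qed
qed

text \<open>The sets where \<open>q n j x \<le> e\<close> for all \<open>j\<close> are closed and
  cover \<open>D\<close>, so one of them contains a ball; subtracting its centre moves the ball to 0
  and doubles \<open>e\<close>. The index \<open>n\<close> is meant for division by
  \<open>n\<close>: as \<open>N\<close> is not homogeneous, the factor survives in the conclusion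
  and is removed by applying the result to \<open>n\<close> times a vector.\<close>

lemma Baire_uniform_continuity:
  fixes N :: "'v::ab_group_add \<Rightarrow> real" and q :: "nat \<Rightarrow> 'j \<Rightarrow> 'v \<Rightarrow> real"
  assumes D0: "0 \<in> D" and Dm: "\<And>x y. x \<in> D \<Longrightarrow> y \<in> D \<Longrightarrow> x - y \<in> D"
    and nn: "\<And>x. x \<in> D \<Longrightarrow> 0 \<le> N x" and z: "\<And>x. x \<in> D \<Longrightarrow> N x = 0 \<longleftrightarrow> x = 0"
    and sub: "\<And>x y. x \<in> D \<Longrightarrow> y \<in> D \<Longrightarrow> N (x - y) \<le> N x + N y"
    and compl: "\<And>X. (\<And>n. X n \<in> D) \<Longrightarrow> (\<And>e. e > 0 \<Longrightarrow> \<exists>K. \<forall>m\<ge>K. \<forall>n\<ge>K. N (X m - X n) < e)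
      \<Longrightarrow> \<exists>x\<in>D. (\<lambda>n. N (X n - x)) \<longlonglongrightarrow> 0"
    and qsub: "\<And>n j x y. x \<in> D \<Longrightarrow> y \<in> D \<Longrightarrow> q n j (x - y) \<le> q n j x + q n j y"
    and qcont: "\<And>n j e. e > 0 \<Longrightarrow> \<exists>d>0. \<forall>x\<in>D. N x < d \<longrightarrow> q n j x \<le> e"
    and cover: "\<And>x. x \<in> D \<Longrightarrow> \<exists>n\<ge>1. \<forall>j. q n j x \<le> e"
  obtains n d where "n \<ge> 1" "d > 0" "\<And>x j. x \<in> D \<Longrightarrow> N x < d \<Longrightarrow> q n j x \<le> 2 * e"
proof -
  define d where "d x y = (if x \<in> D \<and> y \<in> D then N (x - y) else 0)" for x y
  interpret Metric_space D d
    unfolding d_def by (rule Metric_space_group_norm) (fact D0 Dm nn z sub)+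
  have neg: "- x \<in> D" if "x \<in> D" for x using Dm[OF D0 that] by simp
  have plus: "x + y \<in> D" if "x \<in> D" "y \<in> D" for x y using Dm[OF that(1) neg[OF that(2)]] by simp
  have lim: "limitin mtopology X x sequentially \<longleftrightarrow> x \<in> D \<and> (\<lambda>n. d (X n) x) \<longlonglongrightarrow> 0" if "\<And>n. X n \<in> D" for X x
    unfolding limitin_metric_dist_null using that by simp
  have mc: "mcomplete"
    unfolding mcomplete_def
  proof (intro allI impI)
    fix X assume X: "MCauchy X"
    then have XD: "X n \<in> D" for n by (auto simp: MCauchy_def)
    have "\<exists>K. \<forall>m\<ge>K. \<forall>n\<ge>K. N (X m - X n) < e" if "e > 0" for e
      using X that XD unfolding MCauchy_def d_def by auto
    from compl[OF XD this] obtain x where "x \<in> D" "(\<lambda>n. N (X n - x)) \<longlonglongrightarrow> 0" by blast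
    then show "\<exists>x. limitin mtopology X x sequentially"
      using XD by (subst lim) (auto simp: d_def)
  qed
  define V where "V n = {x \<in> D. \<forall>j. q n j x \<le> e}" for n
  have closed: "closedin mtopology (V n)" for n
    unfolding metric_closedin_iff_sequentially_closed
  proof (intro conjI allI impI)
    show "V n \<subseteq> D" by (auto simp: V_def)
    fix X x assume "range X \<subseteq> V n \<and> limitin mtopology X x sequentially"
    then have XV: "\<And>k. X k \<in> V n" and l: "limitin mtopology X x sequentially" by auto
    then have XD: "\<And>k. X k \<in> D" by (auto simp: V_def)
    have xD: "x \<in> D" and l0: "(\<lambda>k. d (X k) x) \<longlonglongrightarrow> 0" using l lim[OF XD] by auto
    have "q n j x \<le> e" for j
    proof (rule field_le_epsilon)
      fix r :: real assume r: "0 < r"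
      obtain s where s: "s > 0" "\<And>y. y \<in> D \<Longrightarrow> N y < s \<Longrightarrow> q n j y \<le> r" using qcont[OF r, of n j] by blast
      have "\<exists>k. d (X k) x < s"
        using order_tendstoD(2)[OF l0 s(1)] by (auto simp: eventually_sequentially)
      then obtain k where "N (X k - x) < s" using XD xD by (auto simp: d_def)
      then have "q n j (X k - x) \<le> r" using s(2) Dm XD xD by auto
      moreover have "q n j (X k - (X k - x)) \<le> q n j (X k) + q n j (X k - x)"
        by (rule qsub) (use XD xD Dm in auto)
      moreover have "q n j (X k) \<le> e" using XV by (auto simp: V_def)
      ultimately show "q n j x \<le> e + r" by simp
    qed
    then show "x \<in> V n" using xD by (simp add: V_def)
  qed
  have "\<exists>n\<ge>1. mtopology interior_of (V n) \<noteq> {}"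
  proof (rule ccontr)
    assume "\<not> ?thesis"
    then have "\<And>T. T \<in> V ` {1..} \<Longrightarrow> closedin mtopology T \<and> mtopology interior_of T = {}"
      using closed by auto
    then have "mtopology interior_of \<Union>(V ` {1..}) = {}"
      by (intro metric_Baire_category_alt[OF mc]) auto
    moreover have "\<Union>(V ` {1..}) = D"
      using cover by (fastforce simp: V_def)
    ultimately have "D = {}"
      by (metis interior_of_topspace topspace_mtopology)
    then show False using D0 by auto
  qed
  then obtain n x0 where n: "n \<ge> 1" and x0: "x0 \<in> mtopology interior_of (V n)" by auto
  then have "openin mtopology (mtopology interior_of (V n))" by simp
  with x0 obtain r where r: "r > 0" "mball x0 r \<subseteq> mtopology interior_of (V n)"
    unfolding openin_mtopology by blast
  then have ball: "mball x0 r \<subseteq> V n" using interior_of_subset by fastforce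
  have x0V: "x0 \<in> V n" using x0 interior_of_subset by fastforce
  then have x0D: "x0 \<in> D" by (auto simp: V_def)
  show ?thesis
  proof (rule that[OF n r(1)])
    fix x j assume x: "x \<in> D" "N x < r"
    have "N (- x) = N x"
      using sub[OF D0 x(1)] sub[OF D0 neg[OF x(1)]] z[OF D0] by simp
    then have "x0 + x \<in> mball x0 r"
      using x x0D plus by (auto simp: d_def)
    then have "q n j (x0 + x) \<le> e" using ball by (auto simp: V_def)
    moreover have "q n j x0 \<le> e" using x0V by (auto simp: V_def)
    moreover have "q n j ((x0 + x) - x0) \<le> q n j (x0 + x) + q n j x0"
      using qsub x0D x plus by blast
    ultimately show "q n j x \<le> 2 * e" by simp
  qed
qed

section \<open>Random normed modules\<close>

locale random_normed_module = prob_space M for M :: "'w measure" +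
  fixes smul :: "('w \<Rightarrow> 'k::{real_normed_field,second_countable_topology}) \<Rightarrow> 'v::ab_group_add \<Rightarrow> 'v"
    and nrm :: "'v \<Rightarrow> 'w \<Rightarrow> real"
  assumes rn: "rn_module M smul nrm"
begin

definition N :: "'v \<Rightarrow> real" where "N x = Phi M (nrm x)"

text \<open>The multipliers in the proof are real valued; embedding them by \<open>of_real\<close>
  treats real and complex modules alike.\<close>

definition rsc :: "('w \<Rightarrow> real) \<Rightarrow> 'v \<Rightarrow> 'v" where
  "rsc f x = smul (\<lambda>\<omega>. of_real (f \<omega>)) x"

abbreviation csc :: "real \<Rightarrow> 'v \<Rightarrow> 'v" where "csc c \<equiv> rsc (\<lambda>_. c)"

lemma nrm_L0p: "L0p M (nrm x)"
proof -
  have "\<forall>x. L0p M (nrm x)" using rn unfolding rn_module_def by (elim conjE)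
  then show ?thesis ..
qed

lemma nrm_measurable [measurable]: "nrm x \<in> borel_measurable M"
  and nrm_nonneg: "AE \<omega> in M. 0 \<le> nrm x \<omega>"
  using nrm_L0p[of x] unfolding L0p_def by blast+

lemma nrm_add: "AE \<omega> in M. nrm (x + y) \<omega> \<le> nrm x \<omega> + nrm y \<omega>"
proof -
  have "\<forall>x y. AE \<omega> in M. nrm (x + y) \<omega> \<le> nrm x \<omega> + nrm y \<omega>"
    using rn unfolding rn_module_def by (elim conjE)
  then show ?thesis by simp
qed

lemma nrm_eq_0D: "AE \<omega> in M. nrm x \<omega> = 0 \<Longrightarrow> x = 0"
proof -
  have "\<forall>x. (AE \<omega> in M. nrm x \<omega> = 0) \<longrightarrow> x = 0"
    using rn unfolding rn_module_def by (elim conjE)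
  then show "AE \<omega> in M. nrm x \<omega> = 0 \<Longrightarrow> x = 0" by simp
qed

lemma of_real_measurable:
  "f \<in> borel_measurable M \<Longrightarrow> (\<lambda>\<omega>. of_real (f \<omega>) :: 'k) \<in> borel_measurable M"
  by measurable

lemma nrm_smul:
  assumes "\<xi> \<in> borel_measurable M"
  shows "AE \<omega> in M. nrm (smul \<xi> x) \<omega> = norm (\<xi> \<omega>) * nrm x \<omega>"
proof -
  have "\<forall>\<xi>\<in>borel_measurable M. \<forall>x. AE \<omega> in M. nrm (smul \<xi> x) \<omega> = norm (\<xi> \<omega>) * nrm x \<omega>"
    using rn unfolding rn_module_def by (elim conjE)
  then show ?thesis using assms by simp
qed

lemma nrm_rsc:
  assumes "f \<in> borel_measurable M"
  shows "AE \<omega> in M. nrm (rsc f x) \<omega> = \<bar>f \<omega>\<bar> * nrm x \<omega>"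
  using nrm_smul[OF of_real_measurable[OF assms], of x] by (simp add: rsc_def)

lemma rsc_add_right:
  assumes "f \<in> borel_measurable M"
  shows "rsc f (x + y) = rsc f x + rsc f y"
proof -
  have "\<forall>\<xi>\<in>borel_measurable M. \<forall>x y. smul \<xi> (x + y) = smul \<xi> x + smul \<xi> y"
    using rn unfolding rn_module_def by (elim conjE)
  then show ?thesis using of_real_measurable[OF assms] by (simp add: rsc_def)
qed

lemma rsc_add_left:
  assumes "f \<in> borel_measurable M" "g \<in> borel_measurable M"
  shows "rsc (\<lambda>\<omega>. f \<omega> + g \<omega>) x = rsc f x + rsc g x"
proof -
  have "\<forall>\<xi>\<in>borel_measurable M. \<forall>\<eta>\<in>borel_measurable M. \<forall>x.
      smul (\<lambda>\<omega>. \<xi> \<omega> + \<eta> \<omega>) x = smul \<xi> x + smul \<eta> x"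
    using rn unfolding rn_module_def by (elim conjE)
  from this[rule_format, OF of_real_measurable[OF assms(1)] of_real_measurable[OF assms(2)]]
  show ?thesis by (simp add: rsc_def)
qed

lemma rsc_mult:
  assumes "f \<in> borel_measurable M" "g \<in> borel_measurable M"
  shows "rsc (\<lambda>\<omega>. f \<omega> * g \<omega>) x = rsc f (rsc g x)"
proof -
  have "\<forall>\<xi>\<in>borel_measurable M. \<forall>\<eta>\<in>borel_measurable M. \<forall>x.
      smul (\<lambda>\<omega>. \<xi> \<omega> * \<eta> \<omega>) x = smul \<xi> (smul \<eta> x)"
    using rn unfolding rn_module_def by (elim conjE)
  from this[rule_format, OF of_real_measurable[OF assms(1)] of_real_measurable[OF assms(2)]]
  show ?thesis by (simp add: rsc_def)
qed

lemma rsc_one [simp]: "csc 1 x = x"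
proof -
  have "\<forall>x. smul (\<lambda>\<omega>. 1) x = x" using rn unfolding rn_module_def by (elim conjE)
  then show ?thesis by (simp add: rsc_def)
qed

lemma rsc_zero_left [simp]: "csc 0 x = 0"
  using rsc_add_left[of "\<lambda>_. 0" "\<lambda>_. 0" x] by simp

lemma rsc_zero_right [simp]: "f \<in> borel_measurable M \<Longrightarrow> rsc f 0 = 0"
  using rsc_add_right[of f 0 0] by simp

lemma rsc_minus_right: "f \<in> borel_measurable M \<Longrightarrow> rsc f (- x) = - rsc f x"
  using rsc_add_right[of f x "- x"] by (simp add: eq_neg_iff_add_eq_0 add.commute)

lemma rsc_diff_right: "f \<in> borel_measurable M \<Longrightarrow> rsc f (x - y) = rsc f x - rsc f y"
  using rsc_add_right[of f x "- y"] by (simp add: rsc_minus_right)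

lemma rsc_minus_left: "f \<in> borel_measurable M \<Longrightarrow> rsc (\<lambda>\<omega>. - f \<omega>) x = - rsc f x"
  using rsc_add_left[of f "\<lambda>\<omega>. - f \<omega>" x] by (simp add: eq_neg_iff_add_eq_0 add.commute)

lemma rsc_sum_right:
  "f \<in> borel_measurable M \<Longrightarrow> rsc f (\<Sum>i\<in>I. v i) = (\<Sum>i\<in>I. rsc f (v i))"
  by (induction I rule: infinite_finite_induct) (auto simp: rsc_add_right)

lemma csc_csc: "csc a (csc b x) = csc (a * b) x"
  using rsc_mult[of "\<lambda>_. a" "\<lambda>_. b" x] by simp

lemma csc_of_nat: "csc (real n) x = (\<Sum>i<n. x)"
  by (induction n) (simp_all add: rsc_add_left[of "\<lambda>_. _" "\<lambda>_. _", simplified] add.commute)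

lemma nrm_minus: "AE \<omega> in M. nrm (- x) \<omega> = nrm x \<omega>"
  using nrm_rsc[of "\<lambda>_. - 1" x] rsc_minus_left[of "\<lambda>_. 1" x] by simp

lemma nrm_zero: "AE \<omega> in M. nrm 0 \<omega> = 0"
  using nrm_rsc[of "\<lambda>_. 0" 0] by simp

lemma nrm_diff: "AE \<omega> in M. nrm (x - y) \<omega> \<le> nrm x \<omega> + nrm y \<omega>"
  using nrm_add[of x "- y"] nrm_minus[of y] by eventually_elim simp

lemma nrm_sum:
  assumes "finite I"
  shows "AE \<omega> in M. nrm (\<Sum>i\<in>I. v i) \<omega> \<le> (\<Sum>i\<in>I. nrm (v i) \<omega>)"
  using assms
proof (induction I rule: finite_induct)
  case empty
  then show ?case using nrm_zero by eventually_elim simp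
next
  case (insert i I)
  from insert.IH nrm_add[of "v i" "\<Sum>i\<in>I. v i"] show ?case
    by eventually_elim (use insert in auto)
qed

section \<open>The F-norm of the module and the (epsilon, lambda)-topology\<close>

lemma N_nonneg: "0 \<le> N x" by (simp add: N_def Phi_nonneg)

lemma N_le_1: "N x \<le> 1" by (simp add: N_def Phi_le_1)

lemma N_zero [simp]: "N 0 = 0"
  using Phi_cong_AE[of "nrm 0" "\<lambda>_. 0"] nrm_zero by (simp add: N_def Phi_zero)

lemma N_add: "N (x + y) \<le> N x + N y"
  unfolding N_def
proof (rule Phi_add)
  show "AE \<omega> in M. \<bar>nrm (x + y) \<omega>\<bar> \<le> \<bar>nrm x \<omega>\<bar> + \<bar>nrm y \<omega>\<bar>"
    using nrm_add[of x y] nrm_nonneg[of "x + y"] by eventually_elim auto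
qed auto

lemma N_minus: "N (- x) = N x"
  unfolding N_def
proof (rule Phi_cong_AE)
  show "AE \<omega> in M. \<bar>nrm (- x) \<omega>\<bar> = \<bar>nrm x \<omega>\<bar>"
    using nrm_minus[of x] by eventually_elim simp
qed auto

lemma N_diff: "N (x - y) \<le> N x + N y"
  using N_add[of x "- y"] by (simp add: N_minus)

lemma N_commute: "N (x - y) = N (y - x)"
  using N_minus[of "x - y"] by simp

lemma N_triangle: "N (x - z) \<le> N (x - y) + N (y - z)"
  using N_add[of "x - y" "y - z"] by simp

lemma N_eq_0_iff: "N x = 0 \<longleftrightarrow> x = 0"
  using Phi_eq_0D[of "nrm x"] nrm_eq_0D[of x] by (auto simp: N_def[symmetric])

lemma N_sum: "finite I \<Longrightarrow> N (\<Sum>i\<in>I. v i) \<le> (\<Sum>i\<in>I. N (v i))"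
  by (induction I rule: finite_induct) (auto intro: order_trans[OF N_add])

lemma N_rsc: "f \<in> borel_measurable M \<Longrightarrow> N (rsc f x) = Phi M (\<lambda>\<omega>. f \<omega> * nrm x \<omega>)"
  unfolding N_def by (rule Phi_cong_AE) (use nrm_rsc[of f x] in \<open>auto simp: abs_mult\<close>)

lemma N_csc: "N (csc c x) \<le> max 1 \<bar>c\<bar> * N x"
  using Phi_scale[of "nrm x" c] by (simp add: N_rsc) (simp add: N_def)

lemma N_mono: "AE \<omega> in M. nrm x \<omega> \<le> nrm y \<omega> \<Longrightarrow> N x \<le> N y"
  unfolding N_def
proof (rule Phi_mono)
  assume "AE \<omega> in M. nrm x \<omega> \<le> nrm y \<omega>"
  then show "AE \<omega> in M. \<bar>nrm x \<omega>\<bar> \<le> \<bar>nrm y \<omega>\<bar>"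
    using nrm_nonneg[of x] by eventually_elim auto
qed auto

lemma N_csc_of_nat: "N (csc (real n) x) \<le> real n * N x"
  using N_sum[of "{..<n}" "\<lambda>_. x"] by (simp add: csc_of_nat)

text \<open>Tails and truncated means bound each other: \<open>Phi_le_prob\<close> splits
  \<open>e\<close> into level \<open>e/2\<close> and probability \<open>e/2\<close>, and Markov's
  inequality at level \<open>min e 1\<close> gives the converse.\<close>

lemma tendsto_el_iff: "tendsto_el M nrm F g x \<longleftrightarrow> ((\<lambda>i. N (g i - x)) \<longlongrightarrow> 0) F"
proof
  assume l: "tendsto_el M nrm F g x"
  show "((\<lambda>i. N (g i - x)) \<longlongrightarrow> 0) F"
  proof (rule tendstoI)
    fix e :: real assume e: "0 < e"
    have "eventually (\<lambda>i. measure M {\<omega>\<in>space M. e/2 \<le> nrm (g i - x) \<omega>} < e/2) F"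
      using l[unfolded tendsto_el_def, rule_format, of "e/2" "e/2"] e by simp
    then show "eventually (\<lambda>i. dist (N (g i - x)) 0 < e) F"
    proof eventually_elim
      case (elim i)
      have "measure M {\<omega>\<in>space M. e/2 \<le> \<bar>nrm (g i - x) \<omega>\<bar>} = measure M {\<omega>\<in>space M. e/2 \<le> nrm (g i - x) \<omega>}"
        by (rule finite_measure_eq_AE) (use nrm_nonneg[of "g i - x"] in auto)
      then show ?case
        using Phi_le_prob[of "nrm (g i - x)" "e/2"] e elim N_nonneg[of "g i - x"] by (simp add: N_def)
    qed
  qed
next
  assume l: "((\<lambda>i. N (g i - x)) \<longlongrightarrow> 0) F"
  show "tendsto_el M nrm F g x"
    unfolding tendsto_el_def
  proof (intro allI impI)
    fix e d :: real assume e: "0 < e" and d: "0 < d"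
    let ?e = "min e 1"
    have "eventually (\<lambda>i. N (g i - x) < ?e * d) F"
      using order_tendstoD(2)[OF l, of "?e * d"] e d by simp
    then show "eventually (\<lambda>i. measure M {\<omega>\<in>space M. e \<le> nrm (g i - x) \<omega>} < d) F"
    proof eventually_elim
      case (elim i)
      have "measure M {\<omega>\<in>space M. e \<le> nrm (g i - x) \<omega>} \<le> measure M {\<omega>\<in>space M. ?e \<le> \<bar>nrm (g i - x) \<omega>\<bar>}"
        by (rule finite_measure_mono) auto
      also have "\<dots> \<le> N (g i - x) / ?e" unfolding N_def by (rule Phi_markov) (use e in auto)
      also have "\<dots> < d" using elim e by (simp add: field_simps)
      finally show ?case .
    qed
  qed
qed

lemma prob_nrm_le: "0 < e \<Longrightarrow> measure M {\<omega>\<in>space M. e \<le> nrm x \<omega>} \<le> N x / min e 1"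
proof -
  assume e: "0 < e"
  have "measure M {\<omega>\<in>space M. e \<le> nrm x \<omega>} \<le> measure M {\<omega>\<in>space M. min e 1 \<le> \<bar>nrm x \<omega>\<bar>}"
    by (rule finite_measure_mono) auto
  also have "\<dots> \<le> N x / min e 1" unfolding N_def by (rule Phi_markov) (use e in auto)
  finally show ?thesis .
qed

lemma N_le_prob: "0 \<le> e \<Longrightarrow> N x \<le> e + measure M {\<omega>\<in>space M. e \<le> nrm x \<omega>}"
proof -
  assume e: "0 \<le> e"
  have "measure M {\<omega>\<in>space M. e \<le> \<bar>nrm x \<omega>\<bar>} = measure M {\<omega>\<in>space M. e \<le> nrm x \<omega>}"
    by (rule finite_measure_eq_AE) (use nrm_nonneg[of x] in auto)
  then show ?thesis using Phi_le_prob[of "nrm x" e] e by (simp add: N_def)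
qed

lemma el_complete_N:
  assumes c: "el_complete M nrm" and X: "\<And>e. e > 0 \<Longrightarrow> \<exists>K. \<forall>m\<ge>K. \<forall>n\<ge>K. N (X m - X n) < e"
  shows "\<exists>x. (\<lambda>n::nat. N (X n - x)) \<longlonglongrightarrow> 0"
proof -
  have "\<exists>K. \<forall>m\<ge>K. \<forall>n\<ge>K. measure M {\<omega>\<in>space M. e \<le> nrm (X m - X n) \<omega>} < d" if "0 < e" "0 < d" for e d
  proof -
    have "min e 1 * d > 0" using that by simp
    from X[OF this] obtain K where K: "\<And>m n. m \<ge> K \<Longrightarrow> n \<ge> K \<Longrightarrow> N (X m - X n) < min e 1 * d" by blast
    have "measure M {\<omega>\<in>space M. e \<le> nrm (X m - X n) \<omega>} < d" if "m \<ge> K" "n \<ge> K" for m n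
    proof -
      have "N (X m - X n) / min e 1 < d" using K[OF that] \<open>0 < e\<close> by (simp add: field_simps)
      then show ?thesis using prob_nrm_le[OF \<open>0 < e\<close>, of "X m - X n"] by linarith
    qed
    then show ?thesis by blast
  qed
  then obtain x where "tendsto_el M nrm sequentially X x"
    using c unfolding el_complete_def by blast
  then show ?thesis by (auto simp: tendsto_el_iff)
qed

lemma el_continuous_N:
  assumes c: "el_continuous M nrm S" and e: "0 < e"
  shows "\<exists>d>0. \<forall>y. N (y - x) < d \<longrightarrow> N (S y - S x) < e"
proof -
  obtain e' d' where ed: "e' > 0" "d' > 0"
    "\<And>y. measure M {\<omega>\<in>space M. e' \<le> nrm (y - x) \<omega>} < d' \<Longrightarrow> measure M {\<omega>\<in>space M. e/2 \<le> nrm (S y - S x) \<omega>} < e/2"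
    using c[unfolded el_continuous_def, rule_format, of "e/2" "e/2" x] e by auto
  have "N (S y - S x) < e" if "N (y - x) < min e' 1 * d'" for y
  proof -
    have "N (y - x) / min e' 1 < d'" using that ed by (simp add: field_simps)
    then have "measure M {\<omega>\<in>space M. e' \<le> nrm (y - x) \<omega>} < d'"
      using prob_nrm_le[OF ed(1), of "y - x"] by linarith
    from ed(3)[OF this] show ?thesis using N_le_prob[of "e/2" "S y - S x"] e by simp
  qed
  then show ?thesis using ed by (intro exI[of _ "min e' 1 * d'"]) auto
qed

lemma N_limit_le:
  assumes "(\<lambda>n. N (X n - x)) \<longlonglongrightarrow> 0" "eventually (\<lambda>n. N (X n) \<le> b) sequentially"
  shows "N x \<le> b"
proof -
  have "eventually (\<lambda>n. N x \<le> b + N (X n - x)) sequentially"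
    using assms(2)
  proof eventually_elim
    case (elim n)
    then show ?case using N_diff[of "X n" "X n - x"] by simp
  qed
  moreover have "(\<lambda>n. b + N (X n - x)) \<longlonglongrightarrow> b + 0" by (intro tendsto_intros assms)
  ultimately show ?thesis by (intro tendsto_lowerbound[of _ _ sequentially]) auto
qed

text \<open>The positive part of \<open>nrm x - \<xi>\<close> is a.s. at most
  \<open>nrm (X n - x)\<close>, so its truncated mean is 0. This replaces the passage to an a.s.
  convergent subsequence.\<close>

lemma nrm_limit_le:
  assumes l: "(\<lambda>n. N (X n - x)) \<longlonglongrightarrow> 0" and [measurable]: "\<xi> \<in> borel_measurable M"
    and le: "\<And>n. AE \<omega> in M. nrm (X n) \<omega> \<le> \<xi> \<omega>"
  shows "AE \<omega> in M. nrm x \<omega> \<le> \<xi> \<omega>"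
proof -
  have "Phi M (\<lambda>\<omega>. max 0 (nrm x \<omega> - \<xi> \<omega>)) \<le> N (X n - x)" for n
    unfolding N_def
  proof (rule Phi_mono)
    show "AE \<omega> in M. \<bar>max 0 (nrm x \<omega> - \<xi> \<omega>)\<bar> \<le> \<bar>nrm (X n - x) \<omega>\<bar>"
      using le[of n] nrm_diff[of "X n" "X n - x"] by eventually_elim auto
  qed auto
  then have "Phi M (\<lambda>\<omega>. max 0 (nrm x \<omega> - \<xi> \<omega>)) \<le> 0"
    by (intro LIMSEQ_le_const[OF l]) auto
  then have "AE \<omega> in M. max 0 (nrm x \<omega> - \<xi> \<omega>) = 0" by (intro Phi_eq_0D) auto
  then show ?thesis by eventually_elim auto
qed

lemma csc_tendsto:
  assumes c: "c \<longlonglongrightarrow> a" and l: "(\<lambda>n. N (X n - x)) \<longlonglongrightarrow> 0"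
  shows "(\<lambda>n. N (csc (c n) (X n) - csc a x)) \<longlonglongrightarrow> 0"
proof (rule tendsto_sandwich[OF _ _ tendsto_const])
  show "eventually (\<lambda>n. 0 \<le> N (csc (c n) (X n) - csc a x)) sequentially" by (simp add: N_nonneg)
  have "N (csc (c n) (X n) - csc a x) \<le> max 1 \<bar>c n\<bar> * N (X n - x) + Phi M (\<lambda>\<omega>. (c n - a) * nrm x \<omega>)" for n
  proof -
    have "csc (c n) (X n) - csc a x = csc (c n) (X n - x) + csc (c n - a) x"
      using rsc_add_left[of "\<lambda>_. c n" "\<lambda>_. - a" x] by (simp add: rsc_diff_right rsc_minus_left)
    then show ?thesis using N_add[of "csc (c n) (X n - x)" "csc (c n - a) x"] N_csc[of "c n" "X n - x"]
      by (simp add: N_rsc[of "\<lambda>_. c n - a"])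
  qed
  then show "eventually (\<lambda>n. N (csc (c n) (X n) - csc a x)
    \<le> max 1 \<bar>c n\<bar> * N (X n - x) + Phi M (\<lambda>\<omega>. (c n - a) * nrm x \<omega>)) sequentially" by simp
  have "(\<lambda>n. Phi M (\<lambda>\<omega>. (c n - a) * nrm x \<omega>)) \<longlonglongrightarrow> Phi M (\<lambda>\<omega>. (a - a) * nrm x \<omega>)"
  proof (rule Phi_tendsto_AE)
    have "(\<lambda>n. (c n - a) * nrm x \<omega>) \<longlonglongrightarrow> (a - a) * nrm x \<omega>" for \<omega>
      by (intro tendsto_intros c)
    then show "AE \<omega> in M. (\<lambda>n. (c n - a) * nrm x \<omega>) \<longlonglongrightarrow> (a - a) * nrm x \<omega>" by simp
  qed auto
  then have "(\<lambda>n. max 1 \<bar>c n\<bar> * N (X n - x) + Phi M (\<lambda>\<omega>. (c n - a) * nrm x \<omega>))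
     \<longlonglongrightarrow> max 1 \<bar>a\<bar> * 0 + 0"
    by (intro tendsto_intros c l) (simp add: Phi_zero)
  then show "(\<lambda>n. max 1 \<bar>c n\<bar> * N (X n - x) + Phi M (\<lambda>\<omega>. (c n - a) * nrm x \<omega>)) \<longlonglongrightarrow> 0" by simp
qed

text \<open>The triangle inequality alone could lose a factor \<open>k\<close>, since
  \<open>N\<close> is not homogeneous. The a.s. bound \<open>b\<close> allows a detour through
  means, which respect averages; passing from \<open>N\<close> to means costs the factor
  \<open>b\<close>.\<close>

lemma N_average_le:
  assumes k: "k \<ge> 1" and b: "1 \<le> b" "\<And>i. i < k \<Longrightarrow> AE \<omega> in M. nrm (v i) \<omega> \<le> b"
    and e: "\<And>i. i < k \<Longrightarrow> N (v i) \<le> e"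
  shows "N (csc (1 / real k) (\<Sum>i<k. v i)) \<le> b * e"
proof -
  have int: "integrable M (\<lambda>\<omega>. \<bar>nrm (v i) \<omega>\<bar>)" if "i < k" for i
    by (rule integrable_const_bound[where B=b]) (use b(2)[OF that] nrm_nonneg[of "v i"] in auto)
  have "N (csc (1 / real k) (\<Sum>i<k. v i)) \<le> Phi M (\<lambda>\<omega>. 1 / real k * (\<Sum>i<k. \<bar>nrm (v i) \<omega>\<bar>))"
    unfolding N_rsc[OF borel_measurable_const]
  proof (rule Phi_mono)
    show "AE \<omega> in M. \<bar>1 / real k * nrm (\<Sum>i<k. v i) \<omega>\<bar> \<le> \<bar>1 / real k * (\<Sum>i<k. \<bar>nrm (v i) \<omega>\<bar>)\<bar>"
      using nrm_sum[OF finite_lessThan[of k], of v] nrm_nonneg[of "\<Sum>i<k. v i"]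
    proof eventually_elim
      case (elim \<omega>)
      have "(\<Sum>i<k. nrm (v i) \<omega>) \<le> (\<Sum>i<k. \<bar>nrm (v i) \<omega>\<bar>)" by (rule sum_mono) simp
      then have "nrm (\<Sum>i<k. v i) \<omega> \<le> (\<Sum>i<k. \<bar>nrm (v i) \<omega>\<bar>)" using elim by linarith
      then show ?case using elim(2) by (simp add: abs_mult sum_nonneg divide_right_mono)
    qed
  qed auto
  also have "\<dots> \<le> (\<integral>\<omega>. \<bar>1 / real k * (\<Sum>i<k. \<bar>nrm (v i) \<omega>\<bar>)\<bar> \<partial>M)"
  proof (intro Phi_le_integral integrable_abs integrable_mult_right)
    show "integrable M (\<lambda>\<omega>. \<Sum>i<k. \<bar>nrm (v i) \<omega>\<bar>)"
      by (rule Bochner_Integration.integrable_sum) (rule int, simp)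
  qed measurable
  also have "\<dots> = (\<integral>\<omega>. 1 / real k * (\<Sum>i<k. \<bar>nrm (v i) \<omega>\<bar>) \<partial>M)"
    by (simp add: abs_mult sum_nonneg)
  also have "\<dots> = 1 / real k * (\<Sum>i<k. \<integral>\<omega>. \<bar>nrm (v i) \<omega>\<bar> \<partial>M)"
    by (subst integral_mult_right_zero, subst Bochner_Integration.integral_sum) (rule int, simp, rule refl)
  also have "\<dots> \<le> 1 / real k * (\<Sum>i<k. b * e)"
  proof (intro mult_left_mono sum_mono)
    fix i assume i: "i \<in> {..<k}"
    have "(\<integral>\<omega>. \<bar>nrm (v i) \<omega>\<bar> \<partial>M) \<le> b * Phi M (nrm (v i))"
      using b(1) b(2)[of i] nrm_nonneg[of "v i"] i by (intro Phi_bounded_le) auto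
    also have "\<dots> \<le> b * e" using e[of i] b i by (intro mult_left_mono) (auto simp: N_def)
    finally show "(\<integral>\<omega>. \<bar>nrm (v i) \<omega>\<bar> \<partial>M) \<le> b * e" .
  qed auto
  also have "\<dots> = b * e" using k by simp
  finally show ?thesis .
qed

text \<open>For \<open>p x = nrm (S x)\<close> with an operator \<open>S\<close> this is the random
  operator norm, the essential supremum of \<open>p\<close> over the random unit ball. The last two
  clauses carry bounds in probability over from the ball with the same constants, and express
  minimality.\<close>

definition sharp_bound :: "('v \<Rightarrow> 'w \<Rightarrow> real) \<Rightarrow> ('w \<Rightarrow> real) \<Rightarrow> bool" where
  "sharp_bound p m \<longleftrightarrow> m \<in> borel_measurable M \<and> (\<forall>\<omega>. 0 \<le> m \<omega>) \<and>
    (\<forall>x. AE \<omega> in M. p x \<omega> \<le> m \<omega> * nrm x \<omega>) \<and>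
    (\<forall>c e. (\<forall>x. (AE \<omega> in M. nrm x \<omega> \<le> 1) \<longrightarrow> Phi M (\<lambda>\<omega>. p x \<omega> / c) \<le> e) \<longrightarrow> Phi M (\<lambda>\<omega>. m \<omega> / c) \<le> e) \<and>
    (\<forall>\<zeta>. (\<forall>x. (AE \<omega> in M. nrm x \<omega> \<le> 1) \<longrightarrow> (AE \<omega> in M. p x \<omega> \<le> \<zeta> \<omega>)) \<longrightarrow> (AE \<omega> in M. m \<omega> \<le> \<zeta> \<omega>))"

lemma sharp_boundD:
  assumes "sharp_bound p m"
  shows "m \<in> borel_measurable M" "0 \<le> m \<omega>" "AE \<omega> in M. p x \<omega> \<le> m \<omega> * nrm x \<omega>"
    "(\<And>x. AE \<omega> in M. nrm x \<omega> \<le> 1 \<Longrightarrow> Phi M (\<lambda>\<omega>. p x \<omega> / c) \<le> e) \<Longrightarrow> Phi M (\<lambda>\<omega>. m \<omega> / c) \<le> e"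
    "(\<And>x. AE \<omega> in M. nrm x \<omega> \<le> 1 \<Longrightarrow> AE \<omega> in M. p x \<omega> \<le> \<zeta> \<omega>) \<Longrightarrow> AE \<omega> in M. m \<omega> \<le> \<zeta> \<omega>"
  using assms by (simp_all add: sharp_bound_def)

text \<open>The essential supremum of \<open>p\<close> over the random unit ball is approached by an increasing
  sequence, because two points of the ball can be glued along the event where \<open>p\<close> is larger
  at the first one. Hence bounds in probability pass from \<open>p\<close> to its sharp bound.\<close>

lemma sharp_bound_exists:
  assumes pm [measurable]: "\<And>x. p x \<in> borel_measurable M" and pn: "\<And>x. AE \<omega> in M. 0 \<le> p x \<omega>"
    and hom: "\<And>f x. f \<in> borel_measurable M \<Longrightarrow> AE \<omega> in M. p (rsc f x) \<omega> = \<bar>f \<omega>\<bar> * p x \<omega>"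
    and bd: "\<And>e. 0 < e \<Longrightarrow> \<exists>c>0. \<forall>x. (AE \<omega> in M. nrm x \<omega> \<le> 1) \<longrightarrow> Phi M (\<lambda>\<omega>. p x \<omega> / c) \<le> e"
  shows "\<exists>m. sharp_bound p m"
proof -
  define U where "U = {x. AE \<omega> in M. nrm x \<omega> \<le> 1}"
  have glue: "\<exists>w\<in>U. AE \<omega> in M. p w \<omega> = max (p x \<omega>) (p y \<omega>)" if "x \<in> U" "y \<in> U" for x y
  proof -
    let ?f = "\<lambda>\<omega>. indicat_real {\<omega>\<in>space M. p y \<omega> \<le> p x \<omega>} \<omega>"
    let ?g = "\<lambda>\<omega>. 1 - ?f \<omega>"
    have fg [measurable]: "?f \<in> borel_measurable M" "?g \<in> borel_measurable M" by measurable
    \<comment> \<open>\<open>w\<close> agrees with \<open>x\<close> where \<open>p x\<close> is at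
      least \<open>p y\<close> and with \<open>y\<close> elsewhere. Homogeneity under indicators
      makes \<open>p\<close> local, so \<open>p w\<close> is the pointwise maximum.\<close>
    define w where "w = rsc ?f x + rsc ?g y"
    have "AE \<omega> in M. nrm w \<omega> \<le> 1"
      using nrm_add[of "rsc ?f x" "rsc ?g y"] nrm_rsc[of ?f, OF fg(1), of x] nrm_rsc[of ?g, OF fg(2), of y] that[unfolded U_def, simplified]
      unfolding w_def by eventually_elim (auto split: split_indicator_asm)
    moreover have "AE \<omega> in M. p w \<omega> = max (p x \<omega>) (p y \<omega>)"
    proof -
      have ff: "(\<lambda>\<omega>. ?f \<omega> * ?f \<omega>) = ?f" "(\<lambda>\<omega>. ?g \<omega> * ?g \<omega>) = ?g"
        "(\<lambda>\<omega>. ?f \<omega> * ?g \<omega>) = (\<lambda>_. 0)" "(\<lambda>\<omega>. ?g \<omega> * ?f \<omega>) = (\<lambda>_. 0)"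
        by (auto split: split_indicator)
      have 1: "rsc ?f w = rsc ?f x"
        unfolding w_def using rsc_mult[of ?f ?f x] rsc_mult[of ?f ?g y]
        by (simp add: rsc_add_right ff)
      have 2: "rsc ?g w = rsc ?g y"
        unfolding w_def using rsc_mult[of ?g ?f x] rsc_mult[of ?g ?g y]
        by (simp add: rsc_add_right ff)
      have "AE \<omega> in M. ?f \<omega> * p w \<omega> = ?f \<omega> * p x \<omega>"
        using hom[of ?f w] hom[of ?f x] unfolding 1 by auto
      moreover have "AE \<omega> in M. ?g \<omega> * p w \<omega> = ?g \<omega> * p y \<omega>"
        using hom[of ?g w] hom[of ?g y] unfolding 2 by auto
      ultimately show ?thesis using AE_space
        by eventually_elim (auto split: split_indicator_asm)
    qed
    ultimately show ?thesis by (auto simp: U_def)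
  qed
  have U0: "0 \<in> U" using nrm_zero by (auto simp: U_def)
  let ?A = "(\<lambda>x \<omega>. ereal (p x \<omega>)) ` U"
  have Am: "f \<in> borel_measurable M" if "f \<in> ?A" for f using that by auto
  obtain B where B: "countable B" "B \<subseteq> ?A" "\<And>f. f \<in> ?A \<Longrightarrow> AE \<omega> in M. f \<omega> \<le> (SUP g\<in>B. g \<omega>)"
    using ess_sup_countable[of ?A, OF Am] by blast
  have "countable B \<and> B \<subseteq> ?A" using B by simp
  then obtain C where C: "countable C" "C \<subseteq> U" "B = (\<lambda>x \<omega>. ereal (p x \<omega>)) ` C"
    unfolding countable_subset_image by blast
  define X where "X = from_nat_into (insert 0 C)"
  have X: "range X = insert 0 C" unfolding X_def using C(1) by (intro range_from_nat_into) auto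
  have XU: "X n \<in> U" for n
  proof -
    have "X n \<in> insert 0 C" unfolding X[symmetric] by (rule rangeI)
    then show ?thesis using C(2) U0 by auto
  qed
  define G where "G x y = (SOME w. w \<in> U \<and> (AE \<omega> in M. p w \<omega> = max (p x \<omega>) (p y \<omega>)))" for x y
  have G: "G x y \<in> U \<and> (AE \<omega> in M. p (G x y) \<omega> = max (p x \<omega>) (p y \<omega>))" if "x \<in> U" "y \<in> U" for x y
    unfolding G_def using glue[OF that] unfolding Bex_def by (rule someI_ex)
  \<comment> \<open>Running maxima over the countable family \<open>X\<close>: each step glues in
    one more point, so \<open>p (W n)\<close> increases and dominates
    \<open>p (X n)\<close>.\<close>
  define W where "W = rec_nat (X 0) (\<lambda>n w. G w (X (Suc n)))"
  have WU: "W n \<in> U" for n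
    by (induction n) (use XU G in \<open>auto simp: W_def\<close>)
  have W_Suc: "AE \<omega> in M. p (W (Suc n)) \<omega> = max (p (W n) \<omega>) (p (X (Suc n)) \<omega>)" for n
    using G[OF WU[of n] XU[of "Suc n"]] by (simp add: W_def)
  have W_all: "AE \<omega> in M. \<forall>n. p (W (Suc n)) \<omega> = max (p (W n) \<omega>) (p (X (Suc n)) \<omega>)"
    using W_Suc by (simp add: AE_all_countable)
  have inc: "AE \<omega> in M. incseq (\<lambda>n. p (W n) \<omega>)"
    using W_all by eventually_elim (auto intro!: incseq_SucI)
  have XW: "AE \<omega> in M. \<forall>n. p (X n) \<omega> \<le> p (W n) \<omega>"
    using W_all
  proof eventually_elim
    case (elim \<omega>)
    have "p (X n) \<omega> \<le> p (W n) \<omega>" for n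
      using elim by (cases n) (auto simp: W_def)
    then show ?case by blast
  qed
  have Wn: "AE \<omega> in M. \<forall>n. 0 \<le> p (W n) \<omega>" using pn by (simp add: AE_all_countable)
  have "\<exists>c>0. \<forall>n. Phi M (\<lambda>\<omega>. p (W n) \<omega> / c) \<le> e" if "0 < e" for e
    using bd[OF that] WU by (auto simp: U_def)
  then obtain m where m: "m \<in> borel_measurable M" "\<And>\<omega>. 0 \<le> m \<omega>"
    "AE \<omega> in M. \<forall>n. p (W n) \<omega> \<le> m \<omega>" "AE \<omega> in M. (\<lambda>n. p (W n) \<omega>) \<longlonglongrightarrow> m \<omega>"
    "\<And>c e. (\<And>n. Phi M (\<lambda>\<omega>. p (W n) \<omega> / c) \<le> e) \<Longrightarrow> Phi M (\<lambda>\<omega>. m \<omega> / c) \<le> e"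
    using stochastically_bounded_sup[of "\<lambda>n. p (W n)", OF pm inc Wn] by blast
  note [measurable] = m(1)
  have pU: "AE \<omega> in M. p x \<omega> \<le> m \<omega>" if "x \<in> U" for x
  proof -
    have "AE \<omega> in M. ereal (p x \<omega>) \<le> (SUP g\<in>B. g \<omega>)" using B(3) that by blast
    then show ?thesis using XW m(3)
    proof eventually_elim
      case (elim \<omega>)
      have "(SUP g\<in>B. g \<omega>) \<le> ereal (m \<omega>)"
      proof (rule SUP_least)
        fix g assume "g \<in> B"
        then obtain c where c: "c \<in> C" "g = (\<lambda>\<omega>. ereal (p c \<omega>))" using C(3) by auto
        then have "c \<in> range X" unfolding X by simp
        then obtain n where "g = (\<lambda>\<omega>. ereal (p (X n) \<omega>))" using c by auto
        then show "g \<omega> \<le> ereal (m \<omega>)" using elim(2,3) by (auto intro: order_trans)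
      qed
      with elim(1) have "ereal (p x \<omega>) \<le> ereal (m \<omega>)" by (rule order_trans)
      then show ?case by simp
    qed
  qed
  have bound: "AE \<omega> in M. p x \<omega> \<le> m \<omega> * nrm x \<omega>" for x
  proof -
    \<comment> \<open>Normalising stays in the unit ball because division by 0 gives 0. Where
      \<open>nrm x\<close> vanishes, the indicator \<open>?g\<close> shows that \<open>p x\<close>
      vanishes too.\<close>
    let ?f = "\<lambda>\<omega>. 1 / nrm x \<omega>"
    let ?g = "\<lambda>\<omega>. indicat_real {\<omega>\<in>space M. nrm x \<omega> = 0} \<omega>"
    have [measurable]: "?g \<in> borel_measurable M" by measurable
    have fm: "?f \<in> borel_measurable M" by measurable
    have "AE \<omega> in M. nrm (rsc ?f x) \<omega> \<le> 1"
      using nrm_rsc[of ?f x] nrm_nonneg[of x] by (auto simp: field_simps elim: AE_mp)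
    then have "AE \<omega> in M. p (rsc ?f x) \<omega> \<le> m \<omega>" by (intro pU) (simp add: U_def)
    moreover have "AE \<omega> in M. nrm (rsc ?g x) \<omega> = 0"
      using nrm_rsc[of ?g x] by (auto split: split_indicator elim!: AE_mp)
    then have "rsc ?g x = rsc (\<lambda>_. 0) 0" using nrm_eq_0D by simp
    then have "AE \<omega> in M. ?g \<omega> * p x \<omega> = 0"
      using hom[of ?g x] hom[of "\<lambda>_. 0" 0] by auto
    ultimately show ?thesis
      using hom[of ?f x, OF fm] nrm_nonneg[of x] AE_space
      by eventually_elim (auto simp: field_simps split: split_indicator_asm)
  qed
  have "sharp_bound p m"
    unfolding sharp_bound_def
  proof (intro conjI allI impI m(1,2) bound)
    show "Phi M (\<lambda>\<omega>. m \<omega> / c) \<le> e" if "\<forall>x. (AE \<omega> in M. nrm x \<omega> \<le> 1) \<longrightarrow> Phi M (\<lambda>\<omega>. p x \<omega> / c) \<le> e" for c e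
      using m(5) that WU by (auto simp: U_def)
    show "AE \<omega> in M. m \<omega> \<le> \<zeta> \<omega>" if "\<forall>x. (AE \<omega> in M. nrm x \<omega> \<le> 1) \<longrightarrow> (AE \<omega> in M. p x \<omega> \<le> \<zeta> \<omega>)" for \<zeta>
    proof -
      have "AE \<omega> in M. \<forall>n. p (W n) \<omega> \<le> \<zeta> \<omega>"
        using that WU by (simp add: AE_all_countable U_def)
      then show ?thesis using m(4) by eventually_elim (auto intro: LIMSEQ_le_const2)
    qed
  qed
  then show ?thesis by (rule exI[of "sharp_bound p"])
qed

lemma nrm_limit_dominated:
  assumes l: "(\<lambda>n. N (X n - x)) \<longlonglongrightarrow> 0" and le: "\<And>n. AE \<omega> in M. nrm v \<omega> \<le> nrm (X n) \<omega>"
  shows "AE \<omega> in M. nrm v \<omega> \<le> nrm x \<omega>"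
proof -
  have "Phi M (\<lambda>\<omega>. max 0 (nrm v \<omega> - nrm x \<omega>)) \<le> N (X n - x)" for n
    unfolding N_def
  proof (rule Phi_mono)
    show "AE \<omega> in M. \<bar>max 0 (nrm v \<omega> - nrm x \<omega>)\<bar> \<le> \<bar>nrm (X n - x) \<omega>\<bar>"
      using le[of n] nrm_add[of "X n - x" x] by eventually_elim auto
  qed auto
  then have "Phi M (\<lambda>\<omega>. max 0 (nrm v \<omega> - nrm x \<omega>)) \<le> 0"
    by (intro LIMSEQ_le_const[OF l]) auto
  then have "AE \<omega> in M. max 0 (nrm v \<omega> - nrm x \<omega>) = 0" by (intro Phi_eq_0D) auto
  then show ?thesis by eventually_elim auto
qed

lemma N_csc_inverse_tendsto: "(\<lambda>n. N (csc (1 / real n) x)) \<longlonglongrightarrow> 0"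
  using Phi_divide_tendsto[of "nrm x"] by (simp add: N_rsc)

lemma N_csc_inverse_le: "N (csc (1 / real n) x) \<le> N x"
proof (cases n)
  case (Suc k)
  have "max 1 \<bar>1 / real n\<bar> = 1" using Suc by simp
  then show ?thesis using N_csc[of "1 / real n" x] by simp
qed (simp add: N_nonneg)

text \<open>Where \<open>K\<close> is at most \<open>n\<close> in absolute value, the product is at
  most \<open>n * nrm z\<close>; elsewhere \<open>K / n\<close> exceeds 1 and absorbs the truncated
  product. First \<open>n\<close> makes the latter part small, then \<open>d\<close> the
  former.\<close>

lemma Phi_random_scale_small:
  assumes [measurable]: "K \<in> borel_measurable M" and e: "0 < e"
  shows "\<exists>d>0. \<forall>z. N z < d \<longrightarrow> Phi M (\<lambda>\<omega>. K \<omega> * nrm z \<omega>) \<le> e"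
proof -
  obtain n where n: "n \<ge> 1" "Phi M (\<lambda>\<omega>. K \<omega> / real n) < e / 2"
    using Phi_divide_small[of K "e/2"] e by auto
  have "Phi M (\<lambda>\<omega>. K \<omega> * nrm z \<omega>) \<le> e" if z: "N z < e / (2 * real n)" for z
  proof -
    have "Phi M (\<lambda>\<omega>. K \<omega> * nrm z \<omega>) = Phi M (\<lambda>\<omega>. min 1 \<bar>K \<omega> * nrm z \<omega>\<bar>)"
      by (simp add: Phi_def)
    also have "\<dots> \<le> Phi M (\<lambda>\<omega>. K \<omega> / real n) + Phi M (\<lambda>\<omega>. real n * nrm z \<omega>)"
    proof (rule Phi_add)
      have "\<bar>min 1 \<bar>K \<omega> * nrm z \<omega>\<bar>\<bar> \<le> \<bar>K \<omega> / real n\<bar> + \<bar>real n * nrm z \<omega>\<bar>" for \<omega>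
      proof (cases "\<bar>K \<omega>\<bar> \<le> real n")
        case True
        then have "\<bar>K \<omega> * nrm z \<omega>\<bar> \<le> \<bar>real n * nrm z \<omega>\<bar>" by (simp add: abs_mult mult_right_mono)
        moreover have "\<bar>min 1 \<bar>K \<omega> * nrm z \<omega>\<bar>\<bar> \<le> \<bar>K \<omega> * nrm z \<omega>\<bar>" by simp
        moreover have "0 \<le> \<bar>K \<omega> / real n\<bar>" by simp
        ultimately show ?thesis by linarith
      next
        case False
        then have "1 \<le> \<bar>K \<omega> / real n\<bar>" using n(1) by (simp add: field_simps)
        moreover have "\<bar>min 1 \<bar>K \<omega> * nrm z \<omega>\<bar>\<bar> \<le> 1" by simp
        ultimately show ?thesis by linarith
      qed
      then show "AE \<omega> in M. \<bar>min 1 \<bar>K \<omega> * nrm z \<omega>\<bar>\<bar> \<le> \<bar>K \<omega> / real n\<bar> + \<bar>real n * nrm z \<omega>\<bar>" by simp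
    qed auto
    also have "Phi M (\<lambda>\<omega>. real n * nrm z \<omega>) \<le> real n * N z"
      using Phi_scale[of "nrm z" "real n"] n(1) by (simp add: N_def max_def split: if_splits)
    also have "\<dots> \<le> e / 2" using z n(1) by (simp add: field_simps)
    finally show ?thesis using n(2) by simp
  qed
  then show ?thesis using e n(1) by (intro exI[of _ "e / (2 * real n)"]) auto
qed

lemma N_csc_ball:
  assumes "AE \<omega> in M. nrm x \<omega> \<le> 1" "0 \<le> c"
  shows "N (csc c x) \<le> c"
proof -
  have "N (csc c x) \<le> Phi M (\<lambda>_. c)"
    unfolding N_rsc[OF borel_measurable_const]
  proof (rule Phi_mono)
    show "AE \<omega> in M. \<bar>c * nrm x \<omega>\<bar> \<le> \<bar>c\<bar>"
      using assms(1) nrm_nonneg[of x] by eventually_elim (use assms(2) in \<open>simp add: abs_mult mult_left_le\<close>)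
  qed auto
  also have "\<dots> \<le> c" using assms(2) by (simp add: Phi_def prob_space)
  finally show ?thesis .
qed

text \<open>A coarse Riemann sum is rewritten on a refined grid, so that the difference of two
  levels becomes a single sum of small terms.\<close>

lemma sum_div_const:
  fixes f :: "nat \<Rightarrow> 'v"
  assumes "k > 0"
  shows "(\<Sum>i<n * k. f (i div k)) = csc (real k) (\<Sum>m<n. f m)"
proof -
  have "(\<Sum>i<n * k. f (i div k)) = (\<Sum>m<n. \<Sum>i\<in>{m * k..<m * k + k}. f (i div k))"
    by (rule sum.nat_group[symmetric])
  also have "\<dots> = (\<Sum>m<n. csc (real k) (f m))"
  proof (rule sum.cong[OF refl])
    fix m
    have "(\<Sum>i\<in>{m * k..<m * k + k}. f (i div k)) = (\<Sum>i\<in>{m * k..<m * k + k}. f m)"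
    proof (rule sum.cong[OF refl])
      fix i assume i: "i \<in> {m * k..<m * k + k}"
      have "i div k = m" using i assms by (intro div_nat_eqI) (auto simp: mult.commute)
      then show "f (i div k) = f m" by simp
    qed
    also have "\<dots> = (\<Sum>i<k. f m)"
      using sum.shift_bounds_nat_ivl[of "\<lambda>_. f m" 0 "m * k" k] by (simp add: add.commute atLeast0LessThan)
    finally show "(\<Sum>i\<in>{m * k..<m * k + k}. f (i div k)) = csc (real k) (f m)" by (simp add: csc_of_nat)
  qed
  also have "\<dots> = csc (real k) (\<Sum>m<n. f m)" by (simp add: rsc_sum_right)
  finally show ?thesis .
qed

end

section \<open>Semigroups\<close>

locale rn_semigroup = random_normed_module M smul nrm
  for M :: "'w measure"
    and smul :: "('w \<Rightarrow> 'k::{real_normed_field,second_countable_topology}) \<Rightarrow> 'v::ab_group_add \<Rightarrow> 'v"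
    and nrm :: "'v \<Rightarrow> 'w \<Rightarrow> real" +
  fixes T :: "real \<Rightarrow> 'v \<Rightarrow> 'v"
  assumes complete: "el_complete M nrm"
    and semigroup: "c0_semigroup M smul nrm T"
begin

lemma T_bounded_op: "0 \<le> t \<Longrightarrow> bounded_op M smul nrm (T t)"
proof -
  have "\<forall>t\<ge>0. bounded_op M smul nrm (T t)" using semigroup unfolding c0_semigroup_def by (elim conjE)
  then show "0 \<le> t \<Longrightarrow> bounded_op M smul nrm (T t)" by simp
qed

lemma T_add: "0 \<le> t \<Longrightarrow> T t (x + y) = T t x + T t y"
proof -
  assume "0 \<le> t"
  then have "\<forall>x y. T t (x + y) = T t x + T t y"
    using T_bounded_op[of t] unfolding bounded_op_def by simp
  then show ?thesis by simp
qed

lemma T_rsc: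
  assumes "0 \<le> t" "f \<in> borel_measurable M"
  shows "T t (rsc f x) = rsc f (T t x)"
proof -
  have "\<forall>\<xi>\<in>borel_measurable M. \<forall>x. T t (smul \<xi> x) = smul \<xi> (T t x)"
    using T_bounded_op[OF assms(1)] unfolding bounded_op_def by (elim conjE)
  then show ?thesis using of_real_measurable[OF assms(2)] by (simp add: rsc_def)
qed

lemma T_0 [simp]: "T 0 x = x"
proof -
  have "T 0 = (\<lambda>x. x)" using semigroup unfolding c0_semigroup_def by (elim conjE)
  then show ?thesis by simp
qed

lemma T_T: "0 \<le> s \<Longrightarrow> 0 \<le> t \<Longrightarrow> T s (T t x) = T (s + t) x"
proof -
  assume st: "0 \<le> s" "0 \<le> t"
  have "\<forall>s\<ge>0. \<forall>t\<ge>0. T s \<circ> T t = T (s + t)" using semigroup unfolding c0_semigroup_def by (elim conjE)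
  then have "T s \<circ> T t = T (s + t)" using st by simp
  from fun_cong[OF this, of x] show ?thesis by simp
qed

lemma T_zero [simp]: "0 \<le> t \<Longrightarrow> T t 0 = 0"
  using T_add[of t 0 0] by simp

lemma T_minus: "0 \<le> t \<Longrightarrow> T t (- x) = - T t x"
  using T_add[of t x "- x"] by (simp add: eq_neg_iff_add_eq_0 add.commute)

lemma T_diff: "0 \<le> t \<Longrightarrow> T t (x - y) = T t x - T t y"
  using T_add[of t x "- y"] by (simp add: T_minus)

lemma T_sum: "0 \<le> t \<Longrightarrow> T t (\<Sum>i\<in>I. v i) = (\<Sum>i\<in>I. T t (v i))"
  by (induction I rule: infinite_finite_induct) (auto simp: T_add)

section \<open>Continuity of orbits and equicontinuity of the operators\<close>

lemma T_continuous_0: "0 \<le> t \<Longrightarrow> 0 < e \<Longrightarrow> \<exists>d>0. \<forall>z. N z < d \<longrightarrow> N (T t z) < e"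
proof -
  assume a: "0 \<le> t" "0 < e"
  have "el_continuous M nrm (T t)" using T_bounded_op[OF a(1)] unfolding bounded_op_def by (elim conjE)
  from el_continuous_N[OF this a(2), of 0] a show ?thesis by simp
qed

lemma T_tendsto:
  assumes "0 \<le> t" and l: "(\<lambda>n. N (X n - x)) \<longlonglongrightarrow> 0"
  shows "(\<lambda>n. N (T t (X n) - T t x)) \<longlonglongrightarrow> 0"
proof (rule LIMSEQ_I)
  fix e :: real assume "0 < e"
  then obtain d where d: "d > 0" "\<And>z. N z < d \<Longrightarrow> N (T t z) < e" using T_continuous_0 assms by blast
  obtain n0 where "\<forall>n\<ge>n0. N (X n - x) < d"
    using order_tendstoD(2)[OF l d(1)] by (auto simp: eventually_sequentially)
  then show "\<exists>n0. \<forall>n\<ge>n0. norm (N (T t (X n) - T t x) - 0) < e"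
    using d(2) assms by (intro exI[of _ n0]) (auto simp: T_diff[symmetric] N_nonneg)
qed

lemma T_at_0: "0 < e \<Longrightarrow> \<exists>h>0. \<forall>t. 0 \<le> t \<and> t < h \<longrightarrow> N (T t x - x) < e"
proof -
  assume e: "0 < e"
  have "\<forall>x. tendsto_el M nrm (at_right 0) (\<lambda>t. T t x) x"
    using semigroup unfolding c0_semigroup_def by (elim conjE)
  then have "((\<lambda>t. N (T t x - x)) \<longlongrightarrow> 0) (at_right 0)" by (simp add: tendsto_el_iff)
  from order_tendstoD(2)[OF this e] obtain h where "h > 0" "\<forall>t>0. t < h \<longrightarrow> N (T t x - x) < e"
    by (auto simp: eventually_at_right_field)
  then show ?thesis using e by (intro exI[of _ h]) (auto simp: le_less)
qed

text \<open>The difference is the fixed continuous operator \<open>T t\<close> applied to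
  \<open>T (u n - t) x - x\<close>. From the left, the outer operator would vary with
  \<open>n\<close>.\<close>

lemma T_right_continuous:
  assumes t: "0 \<le> t" and u: "\<And>n. t \<le> u n" "u \<longlonglongrightarrow> t"
  shows "(\<lambda>n. N (T (u n) x - T t x)) \<longlonglongrightarrow> 0"
proof -
  have "(\<lambda>n. N (T (u n - t) x - x)) \<longlonglongrightarrow> 0"
  proof (rule LIMSEQ_I)
    fix e :: real assume "0 < e"
    then obtain h where h: "h > 0" "\<And>t. 0 \<le> t \<Longrightarrow> t < h \<Longrightarrow> N (T t x - x) < e" using T_at_0 by blast
    obtain n0 where "\<forall>n\<ge>n0. u n < t + h"
      using order_tendstoD(2)[OF u(2), of "t + h"] h(1) by (auto simp: eventually_sequentially)
    then show "\<exists>n0. \<forall>n\<ge>n0. norm (N (T (u n - t) x - x) - 0) < e"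
      using h(2) u(1) by (intro exI[of _ n0]) (auto simp: N_nonneg)
  qed
  from T_tendsto[OF t this] show ?thesis
    using t u(1) by (simp add: T_T)
qed

text \<open>Arguing by contradiction supplies times \<open>t k\<close> tending to 0. Along them
  every orbit converges, which makes the family \<open>T (t k)\<close> pointwise bounded; on a whole
  time interval this is not yet known.\<close>

lemma T_equicontinuous_near_0:
  assumes e: "0 < e"
  shows "\<exists>h>0. \<exists>d>0. \<forall>t. 0 \<le> t \<and> t < h \<longrightarrow> (\<forall>z. N z < d \<longrightarrow> N (T t z) \<le> e)"
proof (rule ccontr)
  assume neg: "\<not> ?thesis"
  have "\<exists>t z. 0 \<le> t \<and> t < 1 / real (Suc k) \<and> N z < 1 / real (Suc k) \<and> e < N (T t z)" for k
  proof -
    have "1 / real (Suc k) > 0" by simp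
    then show ?thesis using neg by (metis linorder_not_le)
  qed
  then obtain t z where tz: "\<And>k. 0 \<le> t k" "\<And>k. t k < 1 / real (Suc k)"
    "\<And>k. N (z k) < 1 / real (Suc k)" "\<And>k. e < N (T (t k) (z k))" by metis
  have t0: "t \<longlonglongrightarrow> 0"
    by (rule tendsto_sandwich[OF _ _ tendsto_const LIMSEQ_Suc[OF lim_1_over_n]])
       (use tz(1,2) in \<open>auto simp: less_imp_le\<close>)
  define q where "q n k x = N (csc (1 / real n) (T (t k) x))" for n k :: nat and x
  obtain n d where n: "n \<ge> 1" and d: "d > 0" "\<And>x k. N x < d \<Longrightarrow> q n k x \<le> 2 * (e / 4)"
  proof (rule Baire_uniform_continuity[where D=UNIV and N=N and q=q and e="e/4"])
    show "\<exists>x\<in>UNIV. (\<lambda>n. N (X n - x)) \<longlonglongrightarrow> 0"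
      if "\<And>e. e > 0 \<Longrightarrow> \<exists>K. \<forall>m\<ge>K. \<forall>n\<ge>K. N (X m - X n) < e" for X :: "nat \<Rightarrow> 'v"
      using el_complete_N[OF complete that] by blast
    show "q n k (x - y) \<le> q n k x + q n k y" for n k x y
      using N_diff by (simp add: q_def T_diff tz(1) rsc_diff_right)
    show "\<exists>d>0. \<forall>x\<in>UNIV. N x < d \<longrightarrow> q n k x \<le> r" if r: "0 < r" for n k r
    proof -
      obtain d where d: "d > 0" "\<And>x. N x < d \<Longrightarrow> N (T (t k) x) < r" using T_continuous_0[OF tz(1)[of k] r] by blast
      have "q n k x \<le> r" if "N x < d" for x
        using N_csc_inverse_le[of n "T (t k) x"] d(2)[OF that] by (simp add: q_def)
      then show ?thesis using d(1) by blast
    qed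
    show "\<exists>n\<ge>1. \<forall>k. q n k x \<le> e / 4" for x
    proof -
      \<comment> \<open>For late \<open>k\<close> the orbit is within \<open>e/8\<close> of
        \<open>x\<close>; the finitely many early values, and \<open>x\<close> itself, are made
        small by a common divisor \<open>n\<close>.\<close>
      have "(\<lambda>k. N (T (t k) x - x)) \<longlonglongrightarrow> 0"
        using T_right_continuous[OF order_refl tz(1) t0, of x] by simp
      from order_tendstoD(2)[OF this, of "e/8"] e obtain k0
        where k0: "\<And>k. k \<ge> k0 \<Longrightarrow> N (T (t k) x - x) < e/8" by (auto simp: eventually_sequentially)
      have "eventually (\<lambda>n. N (csc (1 / real n) y) < e / 8) sequentially" for y
        using order_tendstoD(2)[OF N_csc_inverse_tendsto, of "e/8" y] e by simp
      then have "eventually (\<lambda>n. n \<ge> 1 \<and> N (csc (1 / real n) x) < e / 8 \<and>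
          (\<forall>k\<in>{..<k0}. N (csc (1 / real n) (T (t k) x)) < e / 8)) sequentially"
        by (intro eventually_conj eventually_ge_at_top eventually_ball_finite) auto
      then obtain n where n: "n \<ge> 1" "N (csc (1 / real n) x) < e / 8"
          "\<And>k. k < k0 \<Longrightarrow> N (csc (1 / real n) (T (t k) x)) < e / 8"
        by (auto simp: eventually_sequentially)
      have "q n k x \<le> e / 4" for k
      proof (cases "k < k0")
        case True
        then show ?thesis using n(3)[OF True] e by (simp add: q_def)
      next
        case False
        have "q n k x \<le> N (csc (1 / real n) (T (t k) x - x)) + N (csc (1 / real n) x)"
          using N_add[of "csc (1 / real n) (T (t k) x - x)" "csc (1 / real n) x"]
          by (simp add: q_def rsc_diff_right)
        then show ?thesis using N_csc_inverse_le[of n "T (t k) x - x"] k0[of k] n(2) False by simp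
      qed
      then show ?thesis using n(1) by blast
    qed
  qed (use N_nonneg N_eq_0_iff N_diff in auto)
  \<comment> \<open>\<open>k\<close> is so large that even \<open>n\<close> times \<open>z k\<close>
    lies in the ball of radius \<open>d\<close>. The factor \<open>n\<close> cancels the division in
    \<open>q\<close>, leaving \<open>N (T (t k) (z k)) \<le> e / 2\<close>.\<close>
  obtain k where k: "1 / real (Suc k) < d / real n"
    using reals_Archimedean[of "d / real n"] n d(1) by (auto simp: inverse_eq_divide)
  have "N (csc (real n) (z k)) < d"
  proof -
    have "N (csc (real n) (z k)) \<le> real n * N (z k)" by (rule N_csc_of_nat)
    also have "\<dots> < real n * (d / real n)" using tz(3)[of k] k n by (intro mult_strict_left_mono) auto
    finally show ?thesis using n by simp
  qed
  from d(2)[OF this, of k] have "N (T (t k) (z k)) \<le> e / 2"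
    using n by (simp add: q_def T_rsc tz(1) csc_csc)
  then show False using tz(4)[of k] e by simp
qed

text \<open>Write \<open>t = j * h + s\<close> with \<open>0 \<le> s < h\<close>. Only finitely many
  operators \<open>T (j * h)\<close> occur, so their individual moduli of continuity have a positive
  minimum.\<close>

lemma T_equicontinuous:
  assumes e: "0 < e"
  shows "\<exists>d>0. \<forall>t. 0 \<le> t \<and> t \<le> R \<longrightarrow> (\<forall>z. N z < d \<longrightarrow> N (T t z) \<le> e)"
proof -
  obtain h d where h: "h > 0" and d: "d > 0"
    "\<And>t z. 0 \<le> t \<Longrightarrow> t < h \<Longrightarrow> N z < d \<Longrightarrow> N (T t z) \<le> e"
    using T_equicontinuous_near_0[OF e] by blast
  define K where "K = nat \<lfloor>R / h\<rfloor>"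
  have "\<exists>d'>0. \<forall>z. N z < d' \<longrightarrow> N (T (real j * h) z) < d" for j
    using T_continuous_0[of "real j * h" d] h d(1) by simp
  then obtain d' where d': "\<And>j. d' j > 0" "\<And>j z. N z < d' j \<Longrightarrow> N (T (real j * h) z) < d" by metis
  define r where "r = Min (d' ` {..K})"
  have r: "r > 0" "\<And>j. j \<le> K \<Longrightarrow> r \<le> d' j" using d'(1) by (auto simp: r_def)
  have "N (T t z) \<le> e" if t: "0 \<le> t" "t \<le> R" and z: "N z < r" for t z
  proof -
    define j where "j = nat \<lfloor>t / h\<rfloor>"
    have j: "real j \<le> t / h" "t / h < real j + 1" using t h by (auto simp: j_def)
    have jK: "j \<le> K" unfolding j_def K_def using t h by (intro nat_mono floor_mono) (auto simp: divide_right_mono)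
    have b: "real j * h \<le> t" "t - real j * h < h" using j h by (auto simp: field_simps)
    have "T t z = T (t - real j * h) (T (real j * h) z)" using b h by (simp add: T_T)
    moreover have "N (T (real j * h) z) < d" using d'(2) r(2)[OF jK] z by (meson less_le_trans)
    ultimately show ?thesis using d(2)[of "t - real j * h" "T (real j * h) z"] b by simp
  qed
  then show ?thesis using r(1) by blast
qed

lemma bound_iterate:
  assumes L: "L > 0" and C: "C \<in> borel_measurable M" "\<And>\<omega>. 1 \<le> C \<omega>"
    and b: "\<And>t x. 0 \<le> t \<Longrightarrow> t \<le> L \<Longrightarrow> AE \<omega> in M. nrm (T t x) \<omega> \<le> C \<omega> * nrm x \<omega>"
  shows "0 \<le> t \<Longrightarrow> t \<le> real n * L \<Longrightarrow> AE \<omega> in M. nrm (T t x) \<omega> \<le> C \<omega> ^ n * nrm x \<omega>"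
proof (induction n arbitrary: t)
  case 0
  then show ?case by simp
next
  case (Suc n)
  define s where "s = min t (real n * L)"
  have s: "0 \<le> s" "s \<le> real n * L" "0 \<le> t - s" "t - s \<le> L"
    using Suc.prems L by (auto simp: s_def algebra_simps min_def)
  have "T t x = T (t - s) (T s x)" using s by (simp add: T_T)
  then have "AE \<omega> in M. nrm (T t x) \<omega> \<le> C \<omega> * nrm (T s x) \<omega>"
    using b[OF s(3,4), of "T s x"] by simp
  then show ?case using Suc.IH[OF s(1,2)]
  proof eventually_elim
    case (elim \<omega>)
    have "C \<omega> * nrm (T s x) \<omega> \<le> C \<omega> * (C \<omega> ^ n * nrm x \<omega>)"
      using elim(2) C(2)[of \<omega>] by (intro mult_left_mono) auto
    then show ?case using elim(1) by (simp add: mult.assoc)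
  qed
qed

section \<open>Difference quotients and the Lipschitz estimate\<close>

abbreviation quot :: "real \<Rightarrow> 'v \<Rightarrow> 'v" where "quot t x \<equiv> csc (1 / t) (T t x - x)"

lemma gen_domain_iff:
  "x \<in> gen_domain M smul nrm T \<longleftrightarrow> (\<exists>y. ((\<lambda>t. N (quot t x - y)) \<longlongrightarrow> 0) (at_right 0))"
  by (simp add: gen_domain_def tendsto_el_iff rsc_def)

lemma T_diff_telescope:
  assumes "0 \<le> h"
  shows "T (real n * h) x - x = (\<Sum>k<n. T (real k * h) (T h x - x))"
proof (induction n)
  case (Suc n)
  have "T (real n * h) (T h x - x) = T (real (Suc n) * h) x - T (real n * h) x"
    using assms by (simp add: T_diff T_T algebra_simps)
  then have "(\<Sum>k<Suc n. T (real k * h) (T h x - x)) = (T (real n * h) x - x) + (T (real (Suc n) * h) x - T (real n * h) x)"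
    using Suc by (simp only: sum.lessThan_Suc)
  then show ?case by simp
qed simp

text \<open>Splitting \<open>[0, h]\<close> into \<open>n\<close> equal steps bounds \<open>\<parallel>T h x - x\<parallel>\<close> by \<open>C h\<close> times the norm of the difference
  quotient at \<open>h / n\<close>, so no vector-valued integral is needed.\<close>

lemma lipschitz_of_bounded:
  assumes L: "L > 0" and Cm: "C \<in> borel_measurable M" and C1: "\<And>\<omega>. 1 \<le> C \<omega>"
    and b: "\<And>t x. 0 \<le> t \<Longrightarrow> t \<le> L \<Longrightarrow> AE \<omega> in M. nrm (T t x) \<omega> \<le> C \<omega> * nrm x \<omega>"
    and x: "x \<in> gen_domain M smul nrm T"
  shows "L0_lipschitz_on M nrm {0..r} (\<lambda>t. T t x)"
proof -
  obtain n where n: "r \<le> real n * L"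
    using reals_Archimedean3[OF L, rule_format, of r] by (auto intro: less_imp_le)
  define D where "D \<omega> = C \<omega> ^ n" for \<omega>
  have Dm [measurable]: "D \<in> borel_measurable M" unfolding D_def using Cm by measurable
  have D1: "1 \<le> D \<omega>" for \<omega> unfolding D_def using C1 by (rule one_le_power)
  have bD: "AE \<omega> in M. nrm (T t z) \<omega> \<le> D \<omega> * nrm z \<omega>" if "0 \<le> t" "t \<le> r" for t z
    unfolding D_def using bound_iterate[OF L Cm C1 b] that n by fastforce
  obtain y where y: "((\<lambda>t. N (quot t x - y)) \<longlongrightarrow> 0) (at_right 0)" using x gen_domain_iff by blast
  have inc: "AE \<omega> in M. nrm (T h x - x) \<omega> \<le> D \<omega> * h * nrm y \<omega>" if h: "0 < h" "h \<le> r" for h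
  proof -
    \<comment> \<open>Dividing by \<open>D * h\<close> moves the random factor to the left, so that
      only the norms of convergent quotients remain on the right, as
      \<open>nrm_limit_dominated\<close> requires.\<close>
    let ?f = "\<lambda>\<omega>. 1 / (D \<omega> * h)"
    have fm: "?f \<in> borel_measurable M" by measurable
    define v where "v = rsc ?f (T h x - x)"
    have lim: "filterlim (\<lambda>n. h / real (Suc n)) (at_right 0) sequentially"
    proof (rule tendsto_imp_filterlim_at_right)
      show "(\<lambda>n. h / real (Suc n)) \<longlonglongrightarrow> 0"
        using tendsto_mult[OF tendsto_const[of h] LIMSEQ_Suc[OF lim_1_over_n]] by simp
    qed (use h in auto)
    have l: "(\<lambda>n. N (quot (h / real (Suc n)) x - y)) \<longlonglongrightarrow> 0"
      using filterlim_compose[OF y lim] .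
    have "AE \<omega> in M. nrm v \<omega> \<le> nrm (quot (h / real (Suc m)) x) \<omega>" for m
    proof -
      let ?n = "Suc m" and ?s = "h / real (Suc m)"
      have s: "0 < ?s" "real ?n * ?s = h" using h by auto
      have "AE \<omega> in M. \<forall>k\<in>{..<?n}. nrm (T (real k * ?s) (T ?s x - x)) \<omega> \<le> D \<omega> * nrm (T ?s x - x) \<omega>"
      proof (subst AE_ball_countable, simp, intro ballI)
        fix k assume "k \<in> {..<?n}"
        then have "real k * ?s \<le> real ?n * ?s" using s(1) by (intro mult_right_mono) auto
        then show "AE \<omega> in M. nrm (T (real k * ?s) (T ?s x - x)) \<omega> \<le> D \<omega> * nrm (T ?s x - x) \<omega>"
          using s h by (intro bD) auto
      qed
      then show ?thesis
        using nrm_sum[OF finite_lessThan[of ?n], of "\<lambda>k. T (real k * ?s) (T ?s x - x)"]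
          nrm_rsc[OF fm, of "T h x - x"] nrm_rsc[OF borel_measurable_const, of "1 / ?s" "T ?s x - x"]
      proof eventually_elim
        case (elim \<omega>)
        have "T h x - x = (\<Sum>k<?n. T (real k * ?s) (T ?s x - x))"
          using T_diff_telescope[of ?s ?n x] s by simp
        then have "nrm (T h x - x) \<omega> \<le> (\<Sum>k<?n. nrm (T (real k * ?s) (T ?s x - x)) \<omega>)"
          using elim(2) by simp
        also have "\<dots> \<le> (\<Sum>k<?n. D \<omega> * nrm (T ?s x - x) \<omega>)"
          using elim(1) by (intro sum_mono) auto
        finally have *: "nrm (T h x - x) \<omega> \<le> real ?n * (D \<omega> * nrm (T ?s x - x) \<omega>)" by simp
        have "nrm v \<omega> = nrm (T h x - x) \<omega> / (D \<omega> * h)"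
          using elim(3) D1[of \<omega>] h by (simp add: v_def)
        also have "\<dots> \<le> real ?n * (D \<omega> * nrm (T ?s x - x) \<omega>) / (D \<omega> * h)"
          using * D1[of \<omega>] h by (intro divide_right_mono) auto
        also have "\<dots> = real ?n / h * nrm (T ?s x - x) \<omega>" using D1[of \<omega>] h by (simp add: field_simps)
        also have "\<dots> = nrm (quot ?s x) \<omega>" using elim(4) h by simp
        finally show ?case .
      qed
    qed
    then have "AE \<omega> in M. nrm v \<omega> \<le> nrm y \<omega>" by (rule nrm_limit_dominated[OF l])
    then show ?thesis using nrm_rsc[OF fm, of "T h x - x"]
    proof eventually_elim
      case (elim \<omega>)
      then have "nrm (T h x - x) \<omega> / (D \<omega> * h) \<le> nrm y \<omega>"
        using D1[of \<omega>] h by (simp add: v_def)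
      then show ?case using D1[of \<omega>] h by (simp add: field_simps)
    qed
  qed
  \<comment> \<open>One factor \<open>D\<close> comes from the telescoped increment starting at 0,
    the other from transporting it to time \<open>t\<close>.\<close>
  define \<xi> where "\<xi> \<omega> = D \<omega> * D \<omega> * nrm y \<omega>" for \<omega>
  have "L0p M \<xi>" unfolding L0p_def \<xi>_def
  proof
    show "AE \<omega> in M. 0 \<le> D \<omega> * D \<omega> * nrm y \<omega>" using nrm_nonneg[of y] by eventually_elim simp
  qed measurable
  moreover have ord: "AE \<omega> in M. nrm (T s x - T t x) \<omega> \<le> \<xi> \<omega> * \<bar>s - t\<bar>" if "0 \<le> t" "t < s" "s \<le> r" for s t
  proof -
    have "T s x - T t x = T t (T (s - t) x - x)" using that by (simp add: T_diff T_T)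
    then have "AE \<omega> in M. nrm (T s x - T t x) \<omega> \<le> D \<omega> * nrm (T (s - t) x - x) \<omega>"
      using bD[of t] that by simp
    moreover have "AE \<omega> in M. nrm (T (s - t) x - x) \<omega> \<le> D \<omega> * (s - t) * nrm y \<omega>"
      using inc[of "s - t"] that by simp
    ultimately show ?thesis
    proof eventually_elim
      case (elim \<omega>)
      have "D \<omega> * nrm (T (s - t) x - x) \<omega> \<le> D \<omega> * (D \<omega> * (s - t) * nrm y \<omega>)"
        using elim D1[of \<omega>] by (intro mult_left_mono) auto
      then show ?case using elim(1) that by (simp add: \<xi>_def mult_ac)
    qed
  qed
  moreover have "AE \<omega> in M. nrm (T s x - T t x) \<omega> \<le> \<xi> \<omega> * \<bar>s - t\<bar>" if st: "s \<in> {0..r}" "t \<in> {0..r}" for s t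
  proof (cases s t rule: linorder_cases)
    case equal
    show ?thesis using nrm_zero by eventually_elim (simp add: equal)
  next
    case greater
    then show ?thesis using ord[of t s] st by simp
  next
    case less
    have "AE \<omega> in M. nrm (T t x - T s x) \<omega> \<le> \<xi> \<omega> * \<bar>t - s\<bar>" using ord[of s t] st less by simp
    then show ?thesis using nrm_minus[of "T t x - T s x"]
      by eventually_elim (simp add: abs_minus_commute)
  qed
  ultimately show ?thesis unfolding L0_lipschitz_on_def by blast
qed

section \<open>Random operator norms and almost sure boundedness\<close>

definition op_bounds :: "('v \<Rightarrow> 'v) \<Rightarrow> ('w \<Rightarrow> ereal) set" where
  "op_bounds S = {(\<lambda>\<omega>. ereal (\<xi> \<omega>)) | \<xi>. L0p M \<xi> \<and> (\<forall>x. AE \<omega> in M. nrm (S x) \<omega> \<le> \<xi> \<omega> * nrm x \<omega>)}"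

lemma is_opnorm_iff: "is_opnorm M nrm S \<eta> \<longleftrightarrow> is_ae_glb M (op_bounds S) \<eta>"
  by (simp add: is_opnorm_def op_bounds_def)

lemma op_bounds_measurable: "f \<in> op_bounds S \<Longrightarrow> f \<in> borel_measurable M"
  by (auto simp: op_bounds_def L0p_def)

text \<open>Countably many admissible bounds realise the infimum and hold simultaneously outside a
  null set, so the infimum is again a bound. The guard covers a map without admissible bounds, where
  the infimum of the empty set is infinite.\<close>

lemma opnorm_attained:
  obtains \<eta> where "is_opnorm M nrm S \<eta>"
    "\<And>x. AE \<omega> in M. \<eta> \<omega> < \<infinity> \<longrightarrow> nrm (S x) \<omega> \<le> real_of_ereal (\<eta> \<omega>) * nrm x \<omega>"
proof -
  obtain B \<eta> where B: "countable B" "B \<subseteq> op_bounds S" and \<eta>: "is_ae_glb M (op_bounds S) \<eta>"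
    and eq: "\<And>\<omega>. \<eta> \<omega> = (INF g\<in>B. g \<omega>)"
  proof (rule ess_glb_exists[of "op_bounds S", OF op_bounds_measurable])
    fix B \<eta> assume "countable B" "B \<subseteq> op_bounds S" "is_ae_glb M (op_bounds S) \<eta>" "\<And>\<omega>. \<eta> \<omega> = (INF g\<in>B. g \<omega>)"
    then show ?thesis by (rule that)
  qed
  have "AE \<omega> in M. \<eta> \<omega> < \<infinity> \<longrightarrow> nrm (S x) \<omega> \<le> real_of_ereal (\<eta> \<omega>) * nrm x \<omega>" for x
  proof -
    have "AE \<omega> in M. \<exists>r. g \<omega> = ereal r \<and> 0 \<le> r \<and> nrm (S x) \<omega> \<le> r * nrm x \<omega>" if "g \<in> B" for g
    proof -
      obtain \<xi> where \<xi>: "g = (\<lambda>\<omega>. ereal (\<xi> \<omega>))" "L0p M \<xi>" "AE \<omega> in M. nrm (S x) \<omega> \<le> \<xi> \<omega> * nrm x \<omega>"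
        using B(2) \<open>g \<in> B\<close> by (auto simp: op_bounds_def)
      from \<xi>(2) have "AE \<omega> in M. 0 \<le> \<xi> \<omega>" by (simp add: L0p_def)
      then show ?thesis using \<xi>(3) by eventually_elim (simp add: \<xi>(1))
    qed
    then have "AE \<omega> in M. \<forall>g\<in>B. \<exists>r. g \<omega> = ereal r \<and> 0 \<le> r \<and> nrm (S x) \<omega> \<le> r * nrm x \<omega>"
      using B(1) by (simp add: AE_ball_countable)
    then show ?thesis using nrm_nonneg[of x]
    proof eventually_elim
      case (elim \<omega>)
      show ?case
      proof
        assume fin: "\<eta> \<omega> < \<infinity>"
        then obtain g where "g \<in> B" by (cases "B = {}") (auto simp: eq top_ereal_def)
        then obtain r where r: "nrm (S x) \<omega> \<le> r * nrm x \<omega>" using elim(1) by blast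
        have "0 \<le> (INF g\<in>B. g \<omega>)" using elim(1) by (intro INF_greatest) fastforce
        then obtain c where c: "\<eta> \<omega> = ereal c" using fin by (cases "\<eta> \<omega>") (auto simp: eq)
        show "nrm (S x) \<omega> \<le> real_of_ereal (\<eta> \<omega>) * nrm x \<omega>"
        proof (cases "nrm x \<omega> = 0")
          case True
          then show ?thesis using r by simp
        next
          case False
          then have pos: "nrm x \<omega> > 0" using elim(2) by simp
          have "ereal (nrm (S x) \<omega> / nrm x \<omega>) \<le> (INF g\<in>B. g \<omega>)"
          proof (rule INF_greatest)
            fix g assume "g \<in> B"
            then obtain r where "g \<omega> = ereal r" "nrm (S x) \<omega> \<le> r * nrm x \<omega>" using elim(1) by blast
            then show "ereal (nrm (S x) \<omega> / nrm x \<omega>) \<le> g \<omega>" using pos by (simp add: field_simps)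
          qed
          then have "nrm (S x) \<omega> / nrm x \<omega> \<le> c" using c by (simp add: eq)
          then show ?thesis using pos c by (simp add: field_simps)
        qed
      qed
    qed
  qed
  then show ?thesis using that[of \<eta>] \<eta> by (simp add: is_opnorm_iff)
qed

lemma as_bounded_imp_bound:
  assumes "as_bounded M nrm T"
  obtains L C where "L > 0" "C \<in> borel_measurable M" "\<And>\<omega>. 1 \<le> C \<omega>"
    "\<And>t x. 0 \<le> t \<Longrightarrow> t \<le> L \<Longrightarrow> AE \<omega> in M. nrm (T t x) \<omega> \<le> C \<omega> * nrm x \<omega>"
proof -
  obtain L \<nu> where L: "L > 0" and lub: "is_ae_lub M {\<eta>. \<exists>t\<in>{0..L}. is_opnorm M nrm (T t) \<eta>} \<nu>"
    and fin: "AE \<omega> in M. 0 \<le> \<nu> \<omega> \<and> \<nu> \<omega> < \<infinity>"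
    using assms unfolding as_bounded_def by blast
  have [measurable]: "\<nu> \<in> borel_measurable M" using lub by (simp add: is_ae_lub_def)
  define C where "C \<omega> = max 1 (real_of_ereal (\<nu> \<omega>))" for \<omega>
  have Cm: "C \<in> borel_measurable M" unfolding C_def by measurable
  have "AE \<omega> in M. nrm (T t x) \<omega> \<le> C \<omega> * nrm x \<omega>" if t: "0 \<le> t" "t \<le> L" for t x
  proof -
    obtain \<eta> where \<eta>: "is_opnorm M nrm (T t) \<eta>"
      "\<And>x. AE \<omega> in M. \<eta> \<omega> < \<infinity> \<longrightarrow> nrm (T t x) \<omega> \<le> real_of_ereal (\<eta> \<omega>) * nrm x \<omega>"
      using opnorm_attained[of "T t"] by blast
    have "\<eta> \<in> {\<eta>. \<exists>t\<in>{0..L}. is_opnorm M nrm (T t) \<eta>}" using \<eta>(1) t by auto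
    then have "ae_le M \<eta> \<nu>" using lub unfolding is_ae_lub_def by blast
    then have "AE \<omega> in M. \<eta> \<omega> \<le> \<nu> \<omega>" unfolding ae_le_def .
    then show ?thesis using \<eta>(2)[of x] fin nrm_nonneg[of x]
    proof eventually_elim
      case (elim \<omega>)
      have "\<eta> \<omega> < \<infinity>" using elim(1,3) by (auto intro: le_less_trans)
      then have 1: "nrm (T t x) \<omega> \<le> real_of_ereal (\<eta> \<omega>) * nrm x \<omega>" using elim(2) by simp
      have "real_of_ereal (\<eta> \<omega>) \<le> C \<omega>"
        using elim(1,3) by (cases "\<eta> \<omega>"; cases "\<nu> \<omega>") (auto simp: C_def)
      then have "real_of_ereal (\<eta> \<omega>) * nrm x \<omega> \<le> C \<omega> * nrm x \<omega>" using elim(4) by (rule mult_right_mono)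
      then show ?case using 1 by simp
    qed
  qed
  then show ?thesis using that[OF L Cm] by (simp add: C_def)
qed

text \<open>The variable \<open>\<xi>\<close> is admissible for every \<open>T t\<close>, hence lies
  above all operator norms and above their supremum. Nonnegativity is read off at time 0, where
  \<open>opnorm_attained\<close> provides an operator norm.\<close>

lemma bound_imp_as_bounded:
  assumes L: "L > 0" and \<xi>: "L0p M \<xi>"
    and b: "\<And>t x. 0 \<le> t \<Longrightarrow> t \<le> L \<Longrightarrow> AE \<omega> in M. nrm (T t x) \<omega> \<le> \<xi> \<omega> * nrm x \<omega>"
  shows "as_bounded M nrm T"
proof -
  let ?A = "{\<eta>. \<exists>t\<in>{0..L}. is_opnorm M nrm (T t) \<eta>}"
  have Am: "\<eta> \<in> borel_measurable M" if "\<eta> \<in> ?A" for \<eta> using that by (auto simp: is_opnorm_def is_ae_glb_def)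
  obtain \<nu> where \<nu>: "is_ae_lub M ?A \<nu>" using ess_lub_exists[of ?A, OF Am] by blast
  have \<xi>m: "(\<lambda>\<omega>. ereal (\<xi> \<omega>)) \<in> borel_measurable M" using \<xi> by (auto simp: L0p_def)
  have "ae_le M \<eta> (\<lambda>\<omega>. ereal (\<xi> \<omega>))" if "\<eta> \<in> ?A" for \<eta>
  proof -
    obtain t where t: "0 \<le> t" "t \<le> L" "is_ae_glb M (op_bounds (T t)) \<eta>" using \<open>\<eta> \<in> ?A\<close> by (auto simp: is_opnorm_iff)
    have "(\<lambda>\<omega>. ereal (\<xi> \<omega>)) \<in> op_bounds (T t)" unfolding op_bounds_def using \<xi> b[OF t(1,2)] by blast
    then show ?thesis using t(3) unfolding is_ae_glb_def by blast
  qed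
  then have "ae_le M \<nu> (\<lambda>\<omega>. ereal (\<xi> \<omega>))" using \<nu> \<xi>m unfolding is_ae_lub_def by blast
  then have fin: "AE \<omega> in M. \<nu> \<omega> < \<infinity>" unfolding ae_le_def
    by eventually_elim (auto intro: le_less_trans)
  obtain \<eta> where \<eta>: "is_opnorm M nrm (T 0) \<eta>" using opnorm_attained[of "T 0"] by blast
  have "ae_le M (\<lambda>_. 0) g" if "g \<in> op_bounds (T 0)" for g
    using that by (auto simp: op_bounds_def L0p_def ae_le_def)
  then have "ae_le M (\<lambda>_. 0) \<eta>" using \<eta> unfolding is_opnorm_iff is_ae_glb_def by auto
  moreover have "\<eta> \<in> ?A" using \<eta> L by (auto intro!: bexI[of _ 0])
  then have "ae_le M \<eta> \<nu>" using \<nu> unfolding is_ae_lub_def by blast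
  ultimately have "AE \<omega> in M. 0 \<le> \<nu> \<omega>" unfolding ae_le_def by eventually_elim auto
  with fin have "AE \<omega> in M. 0 \<le> \<nu> \<omega> \<and> \<nu> \<omega> < \<infinity>" by eventually_elim auto
  then show ?thesis unfolding as_bounded_def using L \<nu> by blast
qed

section \<open>Bounds away from time zero\<close>

text \<open>A vector of the random unit ball divided by a large deterministic \<open>c\<close> has
  \<open>N\<close> at most \<open>1 / c\<close>, so equicontinuity applies. The bound is uniform in
  \<open>t\<close> but concerns one \<open>t\<close> at a time.\<close>

lemma T_stochastically_bounded:
  assumes e: "0 < e"
  shows "\<exists>c>0. \<forall>t x. 0 \<le> t \<longrightarrow> t \<le> R \<longrightarrow> (AE \<omega> in M. nrm x \<omega> \<le> 1) \<longrightarrow> Phi M (\<lambda>\<omega>. nrm (T t x) \<omega> / c) \<le> e"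
proof -
  obtain d where d: "d > 0" "\<And>t z. 0 \<le> t \<Longrightarrow> t \<le> R \<Longrightarrow> N z < d \<Longrightarrow> N (T t z) \<le> e"
    using T_equicontinuous[OF e, of R] by blast
  obtain n where n: "1 / real (Suc n) < d"
    using reals_Archimedean[OF d(1)] by (auto simp: inverse_eq_divide)
  have "Phi M (\<lambda>\<omega>. nrm (T t x) \<omega> / real (Suc n)) \<le> e"
    if "0 \<le> t" "t \<le> R" "AE \<omega> in M. nrm x \<omega> \<le> 1" for t x
  proof -
    have "N (csc (1 / real (Suc n)) x) < d" using N_csc_ball[OF that(3), of "1 / real (Suc n)"] n by simp
    then have "N (T t (csc (1 / real (Suc n)) x)) \<le> e" using d(2) that by blast
    then show ?thesis using that(1) by (simp add: T_rsc N_rsc)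
  qed
  then show ?thesis by (intro exI[of _ "real (Suc n)"]) auto
qed

text \<open>\<open>m t\<close> is the sharp bound of the maps \<open>nrm (T t x)\<close>. Its
  transfer of bounds in probability gives the clause on \<open>Phi\<close>, its minimality the
  submultiplicativity.\<close>

lemma operator_norms:
  obtains m where "\<And>t. 0 \<le> t \<Longrightarrow> m t \<in> borel_measurable M" "\<And>t \<omega>. 0 \<le> t \<Longrightarrow> 0 \<le> m t \<omega>"
    "\<And>t x. 0 \<le> t \<Longrightarrow> AE \<omega> in M. nrm (T t x) \<omega> \<le> m t \<omega> * nrm x \<omega>"
    "\<And>R e. 0 < e \<Longrightarrow> \<exists>c>0. \<forall>t. 0 \<le> t \<longrightarrow> t \<le> R \<longrightarrow> Phi M (\<lambda>\<omega>. m t \<omega> / c) \<le> e"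
    "\<And>s t. 0 \<le> s \<Longrightarrow> 0 \<le> t \<Longrightarrow> AE \<omega> in M. m (s + t) \<omega> \<le> m s \<omega> * m t \<omega>"
proof -
  have "\<exists>m. sharp_bound (\<lambda>x. nrm (T t x)) m" if t: "0 \<le> t" for t
  proof (rule sharp_bound_exists)
    show "AE \<omega> in M. nrm (T t (rsc f x)) \<omega> = \<bar>f \<omega>\<bar> * nrm (T t x) \<omega>" if "f \<in> borel_measurable M" for f x
      using nrm_rsc[OF that] t that by (simp add: T_rsc)
    show "\<exists>c>0. \<forall>x. (AE \<omega> in M. nrm x \<omega> \<le> 1) \<longrightarrow> Phi M (\<lambda>\<omega>. nrm (T t x) \<omega> / c) \<le> e" if "0 < e" for e
      using T_stochastically_bounded[OF that, of t] t by blast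
  qed (rule nrm_measurable nrm_nonneg)+
  then have "\<forall>t. \<exists>m. 0 \<le> t \<longrightarrow> sharp_bound (\<lambda>x. nrm (T t x)) m" by blast
  from choice[OF this] obtain m where "\<forall>t. 0 \<le> t \<longrightarrow> sharp_bound (\<lambda>x. nrm (T t x)) (m t)" ..
  then have m: "\<And>t. 0 \<le> t \<Longrightarrow> sharp_bound (\<lambda>x. nrm (T t x)) (m t)" by simp
  note mm = sharp_boundD(1)[OF m] and m0 = sharp_boundD(2)[OF m] and mb = sharp_boundD(3)[OF m]
  have mc: "\<exists>c>0. \<forall>t. 0 \<le> t \<longrightarrow> t \<le> R \<longrightarrow> Phi M (\<lambda>\<omega>. m t \<omega> / c) \<le> e" if e: "0 < e" for R e
  proof -
    obtain c where c: "c > 0" "\<And>t x. 0 \<le> t \<Longrightarrow> t \<le> R \<Longrightarrow> AE \<omega> in M. nrm x \<omega> \<le> 1 \<Longrightarrow> Phi M (\<lambda>\<omega>. nrm (T t x) \<omega> / c) \<le> e"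
      using T_stochastically_bounded[OF e, of R] by blast
    have "Phi M (\<lambda>\<omega>. m t \<omega> / c) \<le> e" if t: "0 \<le> t" "t \<le> R" for t
      by (rule sharp_boundD(4)[OF m[OF t(1)] c(2)[OF t]])
    then show ?thesis using c(1) by blast
  qed
  have ms: "AE \<omega> in M. m (s + t) \<omega> \<le> m s \<omega> * m t \<omega>" if st: "0 \<le> s" "0 \<le> t" for s t
  proof -
    have "AE \<omega> in M. nrm (T (s + t) x) \<omega> \<le> m s \<omega> * m t \<omega>" if "AE \<omega> in M. nrm x \<omega> \<le> 1" for x
      using mb[OF st(1), of "T t x"] mb[OF st(2), of x] that
    proof eventually_elim
      case (elim \<omega>)
      have "m t \<omega> * nrm x \<omega> \<le> m t \<omega>" using elim(3) m0[OF st(2)] by (simp add: mult_left_le)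
      then have "nrm (T t x) \<omega> \<le> m t \<omega>" using elim(2) by linarith
      then have "m s \<omega> * nrm (T t x) \<omega> \<le> m s \<omega> * m t \<omega>" using m0[OF st(1)] by (rule mult_left_mono)
      then show ?case using elim(1) st by (simp add: T_T)
    qed
    then show ?thesis using st by (intro sharp_boundD(5)[OF m]) auto
  qed
  show ?thesis by (rule that[OF mm m0 mb mc ms])
qed

text \<open>Submultiplicativity makes a large value \<open>m t \<ge> c\<^sup>2\<close> force \<open>m s \<ge> c\<close> or \<open>m (t - s) \<ge> c\<close> for every \<open>s\<close>, hence
  \<open>m \<ge> c\<close> on at least half of the grid points below \<open>t\<close>. As each single \<open>m s\<close> is rarely large, Markov's
  inequality controls the supremum over \<open>t\<close>, uniformly in the grid.\<close>

lemma bounded_away_from_0: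
  assumes a: "0 < a"
  obtains K where "K \<in> borel_measurable M" "\<And>\<omega>. 1 \<le> K \<omega>"
    "\<And>t x. a \<le> t \<Longrightarrow> t \<le> real B \<Longrightarrow> AE \<omega> in M. nrm (T t x) \<omega> \<le> K \<omega> * nrm x \<omega>"
proof -
  obtain m where mm: "\<And>t. 0 \<le> t \<Longrightarrow> m t \<in> borel_measurable M" and m0: "\<And>t \<omega>. 0 \<le> t \<Longrightarrow> 0 \<le> m t \<omega>"
    and mb: "\<And>t x. 0 \<le> t \<Longrightarrow> AE \<omega> in M. nrm (T t x) \<omega> \<le> m t \<omega> * nrm x \<omega>"
    and mc: "\<And>R e. 0 < e \<Longrightarrow> \<exists>c>0. \<forall>t. 0 \<le> t \<longrightarrow> t \<le> R \<longrightarrow> Phi M (\<lambda>\<omega>. m t \<omega> / c) \<le> e"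
    and ms: "\<And>s t. 0 \<le> s \<Longrightarrow> 0 \<le> t \<Longrightarrow> AE \<omega> in M. m (s + t) \<omega> \<le> m s \<omega> * m t \<omega>"
    by (rule operator_norms) (rule that)
  obtain l where l: "1 / 2 ^ l < a"
    using order_tendstoD(2)[OF inverse_power_2_tendsto a] by (auto simp: eventually_sequentially)
  \<comment> \<open>\<open>Suc\<close> keeps the grid nonempty and the constants positive when
    \<open>B = 0\<close>.\<close>
  define B' where "B' = Suc B"
  \<comment> \<open>The grid of mesh \<open>1 / 2 ^ (q + l)\<close> between
    \<open>1 / 2 ^ l < a\<close> and \<open>B'\<close>. Every index is at least
    \<open>2 ^ q\<close>, a share of all \<open>B' * 2 ^ (q + l)\<close> steps that does not depend
    on \<open>q\<close>; this is the gain from \<open>a > 0\<close>.\<close>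
  define S where "S q = (\<lambda>i. real i / 2 ^ (q + l)) ` {2 ^ q .. B' * 2 ^ (q + l)}" for q :: nat
  have B1: "2 ^ q \<le> B' * 2 ^ (q + l)" for q
    by (simp add: B'_def power_add algebra_simps trans_le_add1)
  have S: "finite (S q)" "S q \<noteq> {}" "\<And>t. t \<in> S q \<Longrightarrow> 0 \<le> t" for q
    using B1[of q] by (auto simp: S_def)
  have S_mono: "S q \<subseteq> S (Suc q)" for q
  proof
    fix t assume "t \<in> S q"
    then obtain i where i: "t = real i / 2 ^ (q + l)" "2 ^ q \<le> i" "i \<le> B' * 2 ^ (q + l)" by (auto simp: S_def)
    then have "t = real (2 * i) / 2 ^ (Suc q + l)" "2 ^ Suc q \<le> 2 * i" "2 * i \<le> B' * 2 ^ (Suc q + l)" by auto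
    then show "t \<in> S (Suc q)" unfolding S_def by (intro image_eqI[of _ _ "2 * i"]) auto
  qed
  define g where "g q \<omega> = Max ((\<lambda>t. m t \<omega>) ` S q)" for q \<omega>
  have gm [measurable]: "g q \<in> borel_measurable M" for q
    unfolding g_def using S mm by (intro borel_measurable_Max) auto
  have inc: "incseq (\<lambda>q. g q \<omega>)" for \<omega>
    unfolding g_def using S by (intro incseq_SucI Max_mono image_mono S_mono) auto
  have g0: "0 \<le> g q \<omega>" for q \<omega>
  proof -
    obtain t where "t \<in> S q" using S(2)[of q] by auto
    then have "m t \<omega> \<le> g q \<omega>" unfolding g_def using S(1) by (intro Max_ge) auto
    then show ?thesis using m0[OF S(3)[OF \<open>t \<in> S q\<close>]] by (rule order_trans[rotated])
  qed
  \<comment> \<open>On this event at least half of \<open>2 ^ q\<close> many of the events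
    \<open>E j\<close>, \<open>j \<le> n\<close>, occur. Taking expectations bounds
    \<open>2 ^ q\<close> times its probability by \<open>2 * (n + 1) * e\<close>, and
    \<open>n + 1 \<le> 2 * n\<close> leaves a constant free of \<open>q\<close>.\<close>
  have large: "measure M {\<omega>\<in>space M. c\<^sup>2 \<le> g q \<omega>} \<le> 4 * real B' * 2 ^ l * e"
    if c: "c > 0" and ce: "\<And>t. 0 \<le> t \<Longrightarrow> t \<le> real B' \<Longrightarrow> Phi M (\<lambda>\<omega>. m t \<omega> / c) \<le> e" for c e q
  proof -
    define Q where "Q = q + l"
    define n where "n = B' * 2 ^ Q"
    define E where "E j = {\<omega>\<in>space M. c \<le> m (real j / 2 ^ Q) \<omega>}" for j :: nat
    have mj [measurable]: "m (real j / 2 ^ Q) \<in> borel_measurable M" for j :: nat by (rule mm) simp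
    have Em [measurable]: "E j \<in> sets M" for j unfolding E_def by measurable
    have e0: "0 \<le> e" using ce[of 0] Phi_nonneg[of "\<lambda>\<omega>. m 0 \<omega> / c"] by simp
    have PE: "measure M (E j) \<le> e" if "j \<le> n" for j
    proof -
      have "real j / 2 ^ Q \<le> real B'"
        using of_nat_mono[OF that[unfolded n_def], where ?'a=real] by (simp add: field_simps)
      then have "Phi M (\<lambda>\<omega>. m (real j / 2 ^ Q) \<omega> / c) \<le> e" by (intro ce) auto
      moreover have "E j = {\<omega>\<in>space M. 1 \<le> \<bar>m (real j / 2 ^ Q) \<omega> / c\<bar>}"
        unfolding E_def using c m0[of "real j / 2 ^ Q"] by (auto simp: field_simps)
      ultimately show ?thesis
        using Phi_markov[of "\<lambda>\<omega>. m (real j / 2 ^ Q) \<omega> / c" 1] by simp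
    qed
    let ?F = "{\<omega>\<in>space M. c\<^sup>2 \<le> g q \<omega>}"
    have Fm [measurable]: "?F \<in> sets M" by measurable
    have "AE \<omega> in M. \<forall>j k. m (real j / 2 ^ Q + real k / 2 ^ Q) \<omega> \<le> m (real j / 2 ^ Q) \<omega> * m (real k / 2 ^ Q) \<omega>"
      using ms by (simp add: AE_all_countable)
    then have "AE \<omega> in M. real (2 ^ q) * indicat_real ?F \<omega> \<le> 2 * (\<Sum>j\<le>n. indicat_real (E j) \<omega>)"
      using AE_space
    proof eventually_elim
      case (elim \<omega>)
      show ?case
      proof (cases "\<omega> \<in> ?F")
        case True
        have "g q \<omega> \<in> (\<lambda>t. m t \<omega>) ` S q" unfolding g_def using S by (intro Max_in) auto
        then obtain i where i: "g q \<omega> = m (real i / 2 ^ Q) \<omega>" "2 ^ q \<le> i" "i \<le> n"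
          by (auto simp: S_def Q_def n_def)
        have P: "\<omega> \<in> E j \<or> \<omega> \<in> E (i - j)" if "1 \<le> j" "j \<le> 2 ^ q" for j
        proof (rule ccontr)
          assume "\<not> ?thesis"
          then have lt: "m (real j / 2 ^ Q) \<omega> < c" "m (real (i - j) / 2 ^ Q) \<omega> < c"
            using elim(2) by (auto simp: E_def)
          have "real j / 2 ^ Q + real (i - j) / 2 ^ Q = real i / 2 ^ Q"
            using that i by (simp add: add_divide_distrib[symmetric] of_nat_diff)
          then have "m (real i / 2 ^ Q) \<omega> \<le> m (real j / 2 ^ Q) \<omega> * m (real (i - j) / 2 ^ Q) \<omega>"
            using elim(1) by metis
          also have "\<dots> < c * c" using lt m0 by (intro mult_strict_mono') auto
          finally show False using True i(1) by (simp add: power2_eq_square)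
        qed
        have "2 ^ q \<le> 2 * card {j. j \<le> n \<and> \<omega> \<in> E j}"
          using card_reflection_cover[of "2 ^ q" i n "\<lambda>j. \<omega> \<in> E j", OF i(2,3) P] by simp
        then have "real (2 ^ q) \<le> 2 * real (card {j. j \<le> n \<and> \<omega> \<in> E j})" by linarith
        also have "real (card {j. j \<le> n \<and> \<omega> \<in> E j}) = (\<Sum>j\<le>n. indicat_real (E j) \<omega>)"
          by (simp add: indicator_def sum.If_cases Int_def conj_commute)
        finally show ?thesis using True by simp
      qed (simp add: sum_nonneg)
    qed
    then have "(\<integral>\<omega>. real (2 ^ q) * indicat_real ?F \<omega> \<partial>M) \<le> (\<integral>\<omega>. 2 * (\<Sum>j\<le>n. indicat_real (E j) \<omega>) \<partial>M)"
      by (intro integral_mono_AE) (auto intro!: Bochner_Integration.integrable_sum simp: emeasure_eq_measure)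
    then have "real (2 ^ q) * measure M ?F \<le> 2 * (\<Sum>j\<le>n. measure M (E j))"
      by (simp add: emeasure_eq_measure Bochner_Integration.integral_sum)
    also have "\<dots> \<le> 2 * (\<Sum>j\<le>n. e)" using PE by (intro mult_left_mono sum_mono) auto
    also have "\<dots> = 2 * (real n + 1) * e" by simp
    also have "\<dots> \<le> 2 * (2 * real n) * e"
    proof (intro mult_right_mono mult_left_mono)
      have "0 < n" by (simp add: n_def B'_def)
      then show "real n + 1 \<le> 2 * real n" by simp
    qed (use e0 in auto)
    also have "\<dots> = real (2 ^ q) * (4 * real B' * 2 ^ l * e)" by (simp add: n_def Q_def power_add)
    finally show ?thesis by (simp only: mult_le_cancel_left_pos zero_less_power of_nat_0_less_iff zero_less_numeral)
  qed
  have bd: "\<exists>c>0. \<forall>q. Phi M (\<lambda>\<omega>. g q \<omega> / c) \<le> e" if e: "0 < e" for e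
  proof -
    \<comment> \<open>With this \<open>e'\<close> the bound \<open>large\<close> becomes
      \<open>e / 2\<close>; the divisor \<open>2 / e * c\<^sup>2\<close> below turns the event in
      \<open>large\<close> into the tail at level \<open>e / 2\<close>.\<close>
    define e' where "e' = e / (8 * real B' * 2 ^ l)"
    have B'0: "real B' > 0" by (simp add: B'_def)
    have e': "e' > 0" "4 * real B' * 2 ^ l * e' = e / 2" using e B'0 by (auto simp: e'_def)
    obtain c where c: "c > 0" "\<And>t. 0 \<le> t \<Longrightarrow> t \<le> real B' \<Longrightarrow> Phi M (\<lambda>\<omega>. m t \<omega> / c) \<le> e'"
      using mc[OF e'(1), of "real B'"] by blast
    have "Phi M (\<lambda>\<omega>. g q \<omega> / (2 / e * c\<^sup>2)) \<le> e" for q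
    proof -
      have "{\<omega>\<in>space M. e / 2 \<le> \<bar>g q \<omega> / (2 / e * c\<^sup>2)\<bar>} = {\<omega>\<in>space M. c\<^sup>2 \<le> g q \<omega>}"
        using g0 c(1) e by (auto simp: field_simps)
      then show ?thesis
        using Phi_le_prob[of "\<lambda>\<omega>. g q \<omega> / (2 / e * c\<^sup>2)" "e/2"] large[OF c, of q] e' e by simp
    qed
    then show ?thesis using c(1) e by (intro exI[of _ "2 / e * c\<^sup>2"]) auto
  qed
  obtain K where Km [measurable]: "K \<in> borel_measurable M" and K: "AE \<omega> in M. \<forall>q. g q \<omega> \<le> K \<omega>"
  proof (rule stochastically_bounded_sup[of g])
    show "AE \<omega> in M. incseq (\<lambda>q. g q \<omega>)" using inc by simp
    show "AE \<omega> in M. \<forall>q. 0 \<le> g q \<omega>" using g0 by simp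
  qed (use bd gm in auto)
  have dy: "AE \<omega> in M. nrm (T t x) \<omega> \<le> max 1 (K \<omega>) * nrm x \<omega>" if "t \<in> S q" for t q x
    using K mb[OF S(3)[OF that], of x] nrm_nonneg[of x]
  proof eventually_elim
    case (elim \<omega>)
    have "m t \<omega> \<le> g q \<omega>" unfolding g_def using S(1) that by (intro Max_ge) auto
    also have "\<dots> \<le> max 1 (K \<omega>)" using elim(1) by (simp add: le_max_iff_disj)
    finally have "m t \<omega> * nrm x \<omega> \<le> max 1 (K \<omega>) * nrm x \<omega>" using elim(3) by (rule mult_right_mono)
    then show ?case using elim(2) by linarith
  qed
  have "AE \<omega> in M. nrm (T t x) \<omega> \<le> max 1 (K \<omega>) * nrm x \<omega>" if t: "a \<le> t" "t \<le> real B" for t x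
  proof -
    define u where "u q = real (dyadic_above (q + l) t) / 2 ^ (q + l)" for q
    have t0: "0 \<le> t" using a t by simp
    have uS: "u q \<in> S q" for q
    proof -
      have "dyadic_above (q + l) t \<le> B' * 2 ^ (q + l)"
        using t by (intro dyadic_above_le) (simp add: B'_def)
      moreover have "1 / 2 ^ l \<le> real (dyadic_above (q + l) t) / 2 ^ (q + l)"
        using dyadic_above(1)[OF t0, of "q + l"] l t by linarith
      then have "2 ^ q \<le> real (dyadic_above (q + l) t)" by (simp add: power_add field_simps)
      then have "2 ^ q \<le> dyadic_above (q + l) t" by (metis of_nat_le_iff of_nat_numeral of_nat_power)
      ultimately show ?thesis by (auto simp: u_def S_def)
    qed
    have ut: "u \<longlonglongrightarrow> t" unfolding u_def
      using LIMSEQ_ignore_initial_segment[OF dyadic_above_tendsto[OF t0], of l] .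
    have "(\<lambda>q. N (T (u q) x - T t x)) \<longlonglongrightarrow> 0"
      by (rule T_right_continuous[OF t0 _ ut]) (simp add: u_def dyadic_above(1)[OF t0])
    then show ?thesis by (rule nrm_limit_le) (use dy uS in auto)
  qed
  then show ?thesis by (intro that[of "\<lambda>\<omega>. max 1 (K \<omega>)"]) auto
qed

section \<open>Integrals of orbits\<close>

lemma quot_tendsto:
  assumes "0 \<le> t" "(\<lambda>n. N (X n - x)) \<longlonglongrightarrow> 0"
  shows "(\<lambda>n. N (quot t (X n) - quot t x)) \<longlonglongrightarrow> 0"
proof (rule csc_tendsto[OF tendsto_const], rule tendsto_sandwich[OF _ _ tendsto_const])
  show "eventually (\<lambda>n. 0 \<le> N (T t (X n) - X n - (T t x - x))) sequentially" by (simp add: N_nonneg)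
  have "N (T t (X n) - X n - (T t x - x)) \<le> N (T t (X n) - T t x) + N (X n - x)" for n
    using N_diff[of "T t (X n) - T t x" "X n - x"] by (simp add: algebra_simps)
  then show "eventually (\<lambda>n. N (T t (X n) - X n - (T t x - x)) \<le> N (T t (X n) - T t x) + N (X n - x)) sequentially"
    by simp
  show "(\<lambda>n. N (T t (X n) - T t x) + N (X n - x)) \<longlonglongrightarrow> 0"
    using tendsto_add[OF T_tendsto[OF assms] assms(2)] by simp
qed

lemma quot_tendsto_time:
  assumes t: "0 < t" and u: "\<And>n. t \<le> u n" "u \<longlonglongrightarrow> t"
  shows "(\<lambda>n. N (quot (u n) x - quot t x)) \<longlonglongrightarrow> 0"
proof (rule csc_tendsto)
  show "(\<lambda>n. 1 / u n) \<longlonglongrightarrow> 1 / t" using t u by (intro tendsto_intros) auto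
  show "(\<lambda>n. N (T (u n) x - x - (T t x - x))) \<longlonglongrightarrow> 0"
    using T_right_continuous[of t u x] t u by simp
qed

text \<open>The vector \<open>y\<close> is the integral of \<open>T u z\<close> over \<open>0 \<le> u \<le> 1\<close>, obtained as a limit of dyadic Riemann sums.
  The bound \<open>\<parallel>T u z\<parallel> \<le> 1\<close> makes convergence in probability and in mean equivalent, so that averages
  stay small.\<close>

lemma orbit_integral:
  assumes z1: "\<And>u. 0 \<le> u \<Longrightarrow> u \<le> 2 \<Longrightarrow> AE \<omega> in M. nrm (T u z) \<omega> \<le> 1"
    and zb: "\<And>u. 0 \<le> u \<Longrightarrow> u \<le> 2 \<Longrightarrow> N (T u z) \<le> \<beta>"
  obtains y where "N y \<le> \<beta>" "\<And>t. 0 < t \<Longrightarrow> t \<le> 1 \<Longrightarrow> N (quot t y) \<le> 4 * \<beta>"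
    "((\<lambda>t. N (quot t y - (T 1 z - z))) \<longlongrightarrow> 0) (at_right 0)"
proof -
  define w where "w = T 1 z - z"
  define Y where "Y n = csc (1 / real (2 ^ n)) (\<Sum>i<2 ^ n. T (real i / 2 ^ n) z)" for n :: nat
  have refine: "N (Y (n + d) - Y n) \<le> 2 * e"
    if small: "\<And>s u. 0 \<le> s \<Longrightarrow> s \<le> 1 \<Longrightarrow> 0 \<le> u \<Longrightarrow> u < 1 / 2 ^ n \<Longrightarrow> N (T s (T u z - z)) \<le> e" for n d e
  proof -
    \<comment> \<open>Fine minus coarse sample: if \<open>s\<close> is the coarse grid point below
      and \<open>u < 1 / 2 ^ n\<close> the remainder, then
      \<open>v i = T s (T u z - z)\<close>.\<close>
    define v where "v i = T (real i / 2 ^ (n + d)) z - T (real (i div 2 ^ d) / 2 ^ n) z" for i :: nat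
    have v: "N (v i) \<le> e" "AE \<omega> in M. nrm (v i) \<omega> \<le> 2" if i: "i < 2 ^ (n + d)" for i
    proof -
      let ?j = "i div 2 ^ d" and ?r = "i mod 2 ^ d"
      define u where "u = real ?r / 2 ^ (n + d)"
      have j: "?j < 2 ^ n" using i by (simp add: less_mult_imp_div_less power_add)
      have "real (?j * 2 ^ d + ?r) = real i" by (simp only: div_mult_mod_eq)
      then have ri: "real i = real ?j * 2 ^ d + real ?r"
        by (simp only: of_nat_add of_nat_mult of_nat_power of_nat_numeral)
      have eq: "real i / 2 ^ (n + d) = real ?j / 2 ^ n + u"
        unfolding ri by (simp add: u_def power_add add_divide_distrib)
      have "real ?r < real (2 ^ d)" unfolding of_nat_less_iff by simp
      then have u: "0 \<le> u" "u < 1 / 2 ^ n"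
        by (auto simp: u_def power_add field_simps)
      have "real ?j < real (2 ^ n)" unfolding of_nat_less_iff by (rule j)
      then have s: "real ?j / 2 ^ n \<le> 1" by (simp add: divide_le_eq)
      have "real i < real (2 ^ (n + d))" unfolding of_nat_less_iff by (rule i)
      then have i1: "real i / 2 ^ (n + d) \<le> 1" by (simp add: divide_le_eq)
      have "v i = T (real ?j / 2 ^ n) (T u z - z)"
        using u by (simp add: v_def eq T_diff T_T)
      then show "N (v i) \<le> e" using small s u by simp
      have "AE \<omega> in M. nrm (T (real i / 2 ^ (n + d)) z) \<omega> \<le> 1" "AE \<omega> in M. nrm (T (real ?j / 2 ^ n) z) \<omega> \<le> 1"
        by (rule z1, simp, use i1 in linarith) (rule z1, simp, use s in linarith)
      then show "AE \<omega> in M. nrm (v i) \<omega> \<le> 2"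
        using nrm_diff[of "T (real i / 2 ^ (n + d)) z" "T (real ?j / 2 ^ n) z"]
        unfolding v_def by eventually_elim linarith
    qed
    have "(\<Sum>i<2 ^ n * 2 ^ d. T (real (i div 2 ^ d) / 2 ^ n) z) = csc (real (2 ^ d)) (\<Sum>m<2 ^ n. T (real m / 2 ^ n) z)"
      by (rule sum_div_const) simp
    then have "Y n = csc (1 / real (2 ^ (n + d))) (\<Sum>i<2 ^ (n + d). T (real (i div 2 ^ d) / 2 ^ n) z)"
      by (simp add: Y_def power_add csc_csc)
    then have "Y (n + d) - Y n = csc (1 / real (2 ^ (n + d))) (\<Sum>i<2 ^ (n + d). v i)"
      by (simp add: Y_def v_def sum_subtractf rsc_diff_right)
    moreover have "N (csc (1 / real (2 ^ (n + d))) (\<Sum>i<2 ^ (n + d). v i)) \<le> 2 * e"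
      by (rule N_average_le) (use v in auto)
    ultimately show ?thesis by simp
  qed
  have modulus: "\<exists>n0. \<forall>n\<ge>n0. \<forall>d. N (Y (n + d) - Y n) \<le> e" if e: "0 < e" for e
  proof -
    obtain r where r: "r > 0" "\<And>s x. 0 \<le> s \<Longrightarrow> s \<le> 1 \<Longrightarrow> N x < r \<Longrightarrow> N (T s x) \<le> e / 2"
      using T_equicontinuous[of "e/2" 1] e by auto
    obtain h where h: "h > 0" "\<And>u. 0 \<le> u \<Longrightarrow> u < h \<Longrightarrow> N (T u z - z) < r"
      using T_at_0[OF r(1), of z] by blast
    obtain n0 where n0: "\<And>n. n \<ge> n0 \<Longrightarrow> 1 / 2 ^ n < h"
      using order_tendstoD(2)[OF inverse_power_2_tendsto h(1)] by (auto simp: eventually_sequentially)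
    have "N (Y (n + d) - Y n) \<le> 2 * (e / 2)" if "n \<ge> n0" for n d
      using n0[OF that] r h by (intro refine) auto
    then show ?thesis by auto
  qed
  have cauchy: "\<exists>K. \<forall>m\<ge>K. \<forall>n\<ge>K. N (Y m - Y n) < e" if e: "0 < e" for e
  proof -
    obtain n0 where n0: "\<And>n d. n \<ge> n0 \<Longrightarrow> N (Y (n + d) - Y n) \<le> e / 2" using modulus[of "e/2"] e by auto
    have "N (Y m - Y n) < e" if "m \<ge> n0" "n \<ge> n0" for m n
    proof (cases "n \<le> m")
      case True
      then show ?thesis using n0[OF that(2), of "m - n"] e by simp
    next
      case False
      then show ?thesis using n0[OF that(1), of "n - m"] e N_commute[of "Y m" "Y n"] by simp
    qed
    then show ?thesis by blast
  qed
  obtain y where y: "(\<lambda>n. N (Y n - y)) \<longlonglongrightarrow> 0" using el_complete_N[OF complete cauchy] by blast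
  have Yb: "N (Y n) \<le> 1 * \<beta>" for n
    unfolding Y_def
  proof (rule N_average_le)
    fix i :: nat assume "i < 2 ^ n"
    then have "real i < real (2 ^ n)" by (simp only: of_nat_less_iff)
    then have "real i / 2 ^ n \<le> 1" by (simp add: divide_le_eq)
    then have "0 \<le> real i / 2 ^ n" "real i / 2 ^ n \<le> 2" by (simp, linarith)
    then show "AE \<omega> in M. nrm (T (real i / 2 ^ n) z) \<omega> \<le> 1" "N (T (real i / 2 ^ n) z) \<le> \<beta>"
      by (rule z1 zb; assumption)+
  qed auto
  have yb: "N y \<le> \<beta>" using N_limit_le[OF y, of \<beta>] Yb by simp
  have Tw: "(AE \<omega> in M. nrm (T u w) \<omega> \<le> 2)" "N (T u w) \<le> 2 * \<beta>" if u: "0 \<le> u" "u \<le> 1" for u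
  proof -
    have eq: "T u w = T (u + 1) z - T u z" using u by (simp add: w_def T_diff T_T)
    show "AE \<omega> in M. nrm (T u w) \<omega> \<le> 2"
    proof -
      have "AE \<omega> in M. nrm (T (u + 1) z) \<omega> \<le> 1" "AE \<omega> in M. nrm (T u z) \<omega> \<le> 1" using z1 u by simp_all
      then show ?thesis
        unfolding eq using nrm_diff[of "T (u + 1) z" "T u z"] by eventually_elim linarith
    qed
    show "N (T u w) \<le> 2 * \<beta>"
      unfolding eq using N_diff[of "T (u + 1) z" "T u z"] zb[of "u + 1"] zb[of u] u by simp
  qed
  \<comment> \<open>Discrete form of the fact that the difference quotient at \<open>t\<close> of
    the integral is the mean of \<open>T u w\<close> over \<open>[0, t]\<close>; on the grid it is
    exact.\<close>
  have quotY: "quot (real k / 2 ^ n) (Y n) = csc (1 / real k) (\<Sum>i<k. T (real i / 2 ^ n) w)" if "k \<ge> 1" for k n :: nat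
  proof -
    have "T (real k / 2 ^ n) (\<Sum>i<2 ^ n. T (real i / 2 ^ n) z) = (\<Sum>i<2 ^ n. T (real (i + k) / 2 ^ n) z)"
      by (simp add: T_sum T_T add_divide_distrib add.commute)
    moreover have "(\<Sum>i<2 ^ n. T (real (i + k) / 2 ^ n) z) - (\<Sum>i<2 ^ n. T (real i / 2 ^ n) z)
        = (\<Sum>i<k. T (real (i + 2 ^ n) / 2 ^ n) z - T (real i / 2 ^ n) z)"
      by (rule sum_shift_diff)
    moreover have "T (real (i + 2 ^ n) / 2 ^ n) z - T (real i / 2 ^ n) z = T (real i / 2 ^ n) w" for i
      by (simp add: w_def T_diff T_T add_divide_distrib)
    ultimately have "T (real k / 2 ^ n) (Y n) - Y n = csc (1 / real (2 ^ n)) (\<Sum>i<k. T (real i / 2 ^ n) w)"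
      by (simp add: Y_def T_rsc rsc_diff_right[symmetric])
    then show ?thesis using that by (simp add: csc_csc)
  qed
  \<comment> \<open>Both constants come from \<open>N_average_le\<close>:
    \<open>2 * (2 * \<beta>)\<close> because \<open>nrm (T u w)\<close> is at most 2, and
    \<open>4 * e\<close> because \<open>nrm (T u w - w)\<close> is at most 4.\<close>
  have dyadic: "N (quot (real k / 2 ^ l) y) \<le> 4 * \<beta>"
      "(\<And>u. 0 \<le> u \<Longrightarrow> u < real k / 2 ^ l \<Longrightarrow> N (T u w - w) \<le> e) \<Longrightarrow> N (quot (real k / 2 ^ l) y - w) \<le> 4 * e"
    if k: "k \<ge> 1" "k \<le> 2 ^ l" for k l e
  proof -
    let ?t = "real k / 2 ^ l"
    have "real k \<le> real (2 ^ l)" unfolding of_nat_le_iff by (rule k)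
    then have t1: "?t \<le> 1" by (simp add: divide_le_eq)
    have grid: "real i / 2 ^ (l + d) < ?t" if "i < k * 2 ^ d" for i d :: nat
    proof -
      have "real i < real (k * 2 ^ d)" using that by (simp only: of_nat_less_iff)
      then show ?thesis by (simp add: power_add field_simps)
    qed
    have eq: "quot ?t (Y (l + d)) = csc (1 / real (k * 2 ^ d)) (\<Sum>i<k * 2 ^ d. T (real i / 2 ^ (l + d)) w)" for d
    proof -
      have "?t = real (k * 2 ^ d) / 2 ^ (l + d)" by (simp add: power_add)
      then show ?thesis using quotY[of "k * 2 ^ d" "l + d"] k by simp
    qed
    have l0: "(\<lambda>d. N (Y (l + d) - y)) \<longlonglongrightarrow> 0"
      using LIMSEQ_ignore_initial_segment[OF y, of l] by (simp add: add.commute)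
    have lim: "(\<lambda>d. N (quot ?t (Y (l + d)) - quot ?t y)) \<longlonglongrightarrow> 0"
      by (rule quot_tendsto[OF _ l0]) simp
    have "N (quot ?t (Y (l + d))) \<le> 2 * (2 * \<beta>)" for d
      unfolding eq
    proof (rule N_average_le)
      fix i assume "i < k * 2 ^ d"
      then have "real i / 2 ^ (l + d) \<le> 1" using grid t1 by (meson less_imp_le order_trans)
      then show "AE \<omega> in M. nrm (T (real i / 2 ^ (l + d)) w) \<omega> \<le> 2" "N (T (real i / 2 ^ (l + d)) w) \<le> 2 * \<beta>"
        using Tw by simp_all
    qed (use k in auto)
    then show "N (quot ?t y) \<le> 4 * \<beta>" by (intro N_limit_le[OF lim]) simp
    assume e: "\<And>u. 0 \<le> u \<Longrightarrow> u < ?t \<Longrightarrow> N (T u w - w) \<le> e"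
    have "N (quot ?t (Y (l + d)) - w) \<le> 4 * e" for d
    proof -
      have "csc (1 / real (k * 2 ^ d)) (\<Sum>i<k * 2 ^ d. w) = w"
        using k by (simp add: csc_of_nat[symmetric] csc_csc)
      then have "quot ?t (Y (l + d)) - w = csc (1 / real (k * 2 ^ d)) (\<Sum>i<k * 2 ^ d. T (real i / 2 ^ (l + d)) w - w)"
        unfolding eq by (simp add: sum_subtractf rsc_diff_right)
      also have "N \<dots> \<le> 4 * e"
      proof (rule N_average_le)
        fix i assume i: "i < k * 2 ^ d"
        then have "real i / 2 ^ (l + d) \<le> 1" using grid t1 by (meson less_imp_le order_trans)
        then have "AE \<omega> in M. nrm (T (real i / 2 ^ (l + d)) w) \<omega> \<le> 2" "AE \<omega> in M. nrm w \<omega> \<le> 2"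
          using Tw(1)[of "real i / 2 ^ (l + d)"] Tw(1)[of 0] by simp_all
        then show "AE \<omega> in M. nrm (T (real i / 2 ^ (l + d)) w - w) \<omega> \<le> 4"
          using nrm_diff[of "T (real i / 2 ^ (l + d)) w" w] by eventually_elim linarith
        show "N (T (real i / 2 ^ (l + d)) w - w) \<le> e" using e grid[OF i] by simp
      qed (use k in auto)
      finally show ?thesis .
    qed
    moreover have "(\<lambda>d. N ((quot ?t (Y (l + d)) - w) - (quot ?t y - w))) \<longlonglongrightarrow> 0"
      using lim by simp
    ultimately show "N (quot ?t y - w) \<le> 4 * e" by - (rule N_limit_le, assumption, rule always_eventually, rule allI)
  qed
  \<comment> \<open>Arbitrary times are reached by dyadic times from above, which again lie in
    \<open>(0, 1]\<close>.\<close>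
  have approx: "dyadic_above n t \<ge> 1" "dyadic_above n t \<le> 2 ^ n" if "0 < t" "t \<le> 1" for n t
  proof -
    have "0 < real (dyadic_above n t) / 2 ^ n" using dyadic_above(1)[of t n] that by linarith
    then show "dyadic_above n t \<ge> 1" by (simp add: zero_less_divide_iff)
    show "dyadic_above n t \<le> 2 ^ n" using dyadic_above_le[of t 1 n] that by simp
  qed
  have lim: "(\<lambda>n. N (quot (real (dyadic_above n t) / 2 ^ n) y - quot t y)) \<longlonglongrightarrow> 0" if "0 < t" for t
    using that by (intro quot_tendsto_time dyadic_above dyadic_above_tendsto) auto
  show ?thesis
  proof (rule that[OF yb])
    show "N (quot t y) \<le> 4 * \<beta>" if t: "0 < t" "t \<le> 1" for t
      using dyadic(1) approx[OF t] by (intro N_limit_le[OF lim[OF t(1)]]) simp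
    show "((\<lambda>t. N (quot t y - (T 1 z - z))) \<longlongrightarrow> 0) (at_right 0)"
    proof (rule tendstoI)
      fix e :: real assume e: "0 < e"
      obtain h where h: "h > 0" "\<And>u. 0 \<le> u \<Longrightarrow> u < h \<Longrightarrow> N (T u w - w) < e / 8"
        using T_at_0[of "e/8" w] e by auto
      have "N (quot t y - w) < e" if t: "0 < t" "t < min h 1" for t
      proof -
        have "eventually (\<lambda>n. real (dyadic_above n t) / 2 ^ n < h) sequentially"
          using order_tendstoD(2)[OF dyadic_above_tendsto, of t h] t by simp
        then have "eventually (\<lambda>n. N (quot (real (dyadic_above n t) / 2 ^ n) y - w) \<le> 4 * (e / 8)) sequentially"
        proof eventually_elim
          case (elim n)
          have "N (T u w - w) \<le> e / 8" if "0 \<le> u" "u < real (dyadic_above n t) / 2 ^ n" for u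
            using h(2)[of u] that elim by simp
          then show ?case using approx[of t n] t by (intro dyadic(2)) auto
        qed
        moreover have "(\<lambda>n. N ((quot (real (dyadic_above n t) / 2 ^ n) y - w) - (quot t y - w))) \<longlonglongrightarrow> 0"
          using lim[OF t(1)] by simp
        ultimately have "N (quot t y - w) \<le> 4 * (e / 8)" by (intro N_limit_le)
        then show ?thesis using e by simp
      qed
      then show "eventually (\<lambda>t. dist (N (quot t y - (T 1 z - z))) 0 < e) (at_right 0)"
        unfolding eventually_at_right_field using h(1)
        by (intro exI[of _ "min h 1"]) (auto simp: w_def N_nonneg)
    qed
  qed
qed

section \<open>Suprema of orbits\<close>

text \<open>A finite maximum replaces the supremum over \<open>[0, 1]\<close>: it is measurable and,
  the grids being nested, increases with \<open>k\<close>. Bounds uniform in \<open>k\<close> then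
  reach all times through \<open>orbit_le_of_grid_max_le\<close>.\<close>

definition grid_max :: "nat \<Rightarrow> 'v \<Rightarrow> 'w \<Rightarrow> real" where
  "grid_max k z \<omega> = Max ((\<lambda>i. nrm (T (real i / 2 ^ k) z) \<omega>) ` {..2 ^ k})"

lemma grid_max_measurable [measurable]: "grid_max k z \<in> borel_measurable M"
  unfolding grid_max_def by (intro borel_measurable_Max) auto

lemma grid_max_ge: "i \<le> 2 ^ k \<Longrightarrow> nrm (T (real i / 2 ^ k) z) \<omega> \<le> grid_max k z \<omega>"
  unfolding grid_max_def by (intro Max_ge) auto

lemma grid_max_le:
  assumes "\<And>i. i \<le> 2 ^ k \<Longrightarrow> nrm (T (real i / 2 ^ k) z) \<omega> \<le> b"
  shows "grid_max k z \<omega> \<le> b"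
  unfolding grid_max_def using assms by (subst Max_le_iff) auto

lemma grid_max_le_AE:
  assumes "\<And>u. 0 \<le> u \<Longrightarrow> u \<le> 1 \<Longrightarrow> AE \<omega> in M. nrm (T u z) \<omega> \<le> b u \<omega>"
    and "\<And>u \<omega>. 0 \<le> u \<Longrightarrow> u \<le> 1 \<Longrightarrow> c \<omega> \<ge> b u \<omega>"
  shows "AE \<omega> in M. grid_max k z \<omega> \<le> c \<omega>"
proof -
  have u1: "real i / 2 ^ k \<le> 1" if "i \<le> 2 ^ k" for i :: nat
  proof -
    have "real i \<le> real (2 ^ k)" unfolding of_nat_le_iff by (rule that)
    then show ?thesis by (simp add: divide_le_eq)
  qed
  have "AE \<omega> in M. \<forall>i\<in>{..2 ^ k}. nrm (T (real i / 2 ^ k) z) \<omega> \<le> b (real i / 2 ^ k) \<omega>"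
    by (subst AE_ball_countable) (auto intro!: assms(1) u1 simp del: divide_le_eq_1_pos)
  then show ?thesis
  proof eventually_elim
    case (elim \<omega>)
    show ?case
    proof (rule grid_max_le)
      fix i :: nat assume i: "i \<le> 2 ^ k"
      then have "nrm (T (real i / 2 ^ k) z) \<omega> \<le> b (real i / 2 ^ k) \<omega>" using elim by simp
      also have "\<dots> \<le> c \<omega>" by (rule assms(2)) (use u1[OF i] in simp_all)
      finally show "nrm (T (real i / 2 ^ k) z) \<omega> \<le> c \<omega>" .
    qed
  qed
qed

lemma grid_max_nonneg: "AE \<omega> in M. 0 \<le> grid_max k z \<omega>"
  using nrm_nonneg[of "T (real 0 / 2 ^ k) z"]
proof eventually_elim
  case (elim \<omega>)
  then show ?case using grid_max_ge[of 0 k z \<omega>] by linarith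
qed

lemma grid_max_incseq: "incseq (\<lambda>k. grid_max k z \<omega>)"
proof (rule incseq_SucI, rule grid_max_le)
  fix k i :: nat assume "i \<le> 2 ^ k"
  then have "nrm (T (real (2 * i) / 2 ^ Suc k) z) \<omega> \<le> grid_max (Suc k) z \<omega>" by (intro grid_max_ge) simp
  then show "nrm (T (real i / 2 ^ k) z) \<omega> \<le> grid_max (Suc k) z \<omega>" by simp
qed

lemma grid_max_add: "AE \<omega> in M. grid_max k (x + y) \<omega> \<le> grid_max k x \<omega> + grid_max k y \<omega>"
proof -
  have "AE \<omega> in M. \<forall>i. nrm (T (real i / 2 ^ k) (x + y)) \<omega> \<le> nrm (T (real i / 2 ^ k) x) \<omega> + nrm (T (real i / 2 ^ k) y) \<omega>"
    by (simp add: AE_all_countable T_add nrm_add)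
  then show ?thesis
  proof eventually_elim
    case (elim \<omega>)
    show ?case
    proof (rule grid_max_le)
      fix i :: nat assume i: "i \<le> 2 ^ k"
      show "nrm (T (real i / 2 ^ k) (x + y)) \<omega> \<le> grid_max k x \<omega> + grid_max k y \<omega>"
        using elim[rule_format, of i] grid_max_ge[OF i, of x \<omega>] grid_max_ge[OF i, of y \<omega>] by linarith
    qed
  qed
qed

lemma grid_max_rsc:
  assumes f: "f \<in> borel_measurable M"
  shows "AE \<omega> in M. grid_max k (rsc f x) \<omega> = \<bar>f \<omega>\<bar> * grid_max k x \<omega>"
proof -
  have "AE \<omega> in M. \<forall>i. nrm (T (real i / 2 ^ k) (rsc f x)) \<omega> = \<bar>f \<omega>\<bar> * nrm (T (real i / 2 ^ k) x) \<omega>"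
    using f by (simp add: AE_all_countable T_rsc nrm_rsc)
  then show ?thesis
  proof eventually_elim
    case (elim \<omega>)
    have "(\<lambda>i. nrm (T (real i / 2 ^ k) (rsc f x)) \<omega>) ` {..2 ^ k}
        = (\<lambda>r. \<bar>f \<omega>\<bar> * r) ` ((\<lambda>i. nrm (T (real i / 2 ^ k) x) \<omega>) ` {..2 ^ k})"
      using elim by (simp add: image_image)
    moreover have "mono (\<lambda>r. \<bar>f \<omega>\<bar> * r)" by (auto intro!: monoI mult_left_mono)
    ultimately show ?case unfolding grid_max_def by (simp add: mono_Max_commute)
  qed
qed

lemma grid_max_minus: "AE \<omega> in M. grid_max k (- x) \<omega> = grid_max k x \<omega>"
  using grid_max_rsc[of "\<lambda>_. - 1" k x] rsc_minus_left[of "\<lambda>_. 1" x] by simp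

lemma Phi_grid_max_add: "Phi M (\<lambda>\<omega>. grid_max k (x + y) \<omega> / c) \<le> Phi M (\<lambda>\<omega>. grid_max k x \<omega> / c) + Phi M (\<lambda>\<omega>. grid_max k y \<omega> / c)"
proof (rule Phi_add)
  show "AE \<omega> in M. \<bar>grid_max k (x + y) \<omega> / c\<bar> \<le> \<bar>grid_max k x \<omega> / c\<bar> + \<bar>grid_max k y \<omega> / c\<bar>"
    using grid_max_add[of k x y] grid_max_nonneg[of k x] grid_max_nonneg[of k y] grid_max_nonneg[of k "x + y"]
    by eventually_elim (simp add: add_divide_distrib[symmetric] divide_right_mono)
qed auto

lemma Phi_grid_max_diff: "Phi M (\<lambda>\<omega>. grid_max k (x - y) \<omega> / c) \<le> Phi M (\<lambda>\<omega>. grid_max k x \<omega> / c) + Phi M (\<lambda>\<omega>. grid_max k y \<omega> / c)"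
proof -
  have "Phi M (\<lambda>\<omega>. grid_max k (- y) \<omega> / c) = Phi M (\<lambda>\<omega>. grid_max k y \<omega> / c)"
  proof (rule Phi_cong_AE)
    show "AE \<omega> in M. \<bar>grid_max k (- y) \<omega> / c\<bar> = \<bar>grid_max k y \<omega> / c\<bar>"
      using grid_max_minus[of k y] by eventually_elim simp
  qed auto
  then show ?thesis using Phi_grid_max_add[of k x "- y" c] by simp
qed

text \<open>Summing over \<open>2 ^ k + 1\<close> grid points makes \<open>d\<close> depend on
  \<open>k\<close>. Under the Lipschitz hypothesis \<open>grid_max_equicontinuous\<close> removes
  this dependence; the present version serves limits at fixed \<open>k\<close>.\<close>

lemma grid_max_continuous_0:
  assumes e: "0 < e"
  shows "\<exists>d>0. \<forall>z. N z < d \<longrightarrow> Phi M (grid_max k z) \<le> e"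
proof -
  let ?n = "real (2 ^ k + 1)"
  have "0 < ?n" unfolding of_nat_0_less_iff by simp
  then have "0 < e / ?n" using e by (rule divide_pos_pos[rotated])
  from T_equicontinuous[OF this, of 1] obtain d where d: "d > 0"
    "\<And>t z. 0 \<le> t \<Longrightarrow> t \<le> 1 \<Longrightarrow> N z < d \<Longrightarrow> N (T t z) \<le> e / ?n" by blast
  have "Phi M (grid_max k z) \<le> e" if z: "N z < d" for z
  proof -
    have "Phi M (grid_max k z) \<le> (\<Sum>i\<in>{..2 ^ k}. Phi M (nrm (T (real i / 2 ^ k) z)))"
    proof (rule Phi_sum_bound)
      show "AE \<omega> in M. \<bar>grid_max k z \<omega>\<bar> \<le> (\<Sum>i\<in>{..2 ^ k}. \<bar>nrm (T (real i / 2 ^ k) z) \<omega>\<bar>)"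
        using grid_max_nonneg[of k z]
      proof eventually_elim
        case (elim \<omega>)
        have "grid_max k z \<omega> \<le> (\<Sum>i\<in>{..2 ^ k}. \<bar>nrm (T (real i / 2 ^ k) z) \<omega>\<bar>)"
        proof (rule grid_max_le)
          fix i :: nat assume "i \<le> 2 ^ k"
          then have "\<bar>nrm (T (real i / 2 ^ k) z) \<omega>\<bar> \<le> (\<Sum>i\<in>{..2 ^ k}. \<bar>nrm (T (real i / 2 ^ k) z) \<omega>\<bar>)"
            by (intro member_le_sum) auto
          then show "nrm (T (real i / 2 ^ k) z) \<omega> \<le> (\<Sum>i\<in>{..2 ^ k}. \<bar>nrm (T (real i / 2 ^ k) z) \<omega>\<bar>)" by linarith
        qed
        then show ?case using elim by simp
      qed
    qed auto
    also have "\<dots> \<le> (\<Sum>i\<in>{..2 ^ k::nat}. e / ?n)"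
    proof (rule sum_mono)
      fix i :: nat assume "i \<in> {..2 ^ k}"
      then have "real i \<le> real (2 ^ k)" unfolding of_nat_le_iff by simp
      then have "real i / 2 ^ k \<le> 1" by (simp add: divide_le_eq)
      then show "Phi M (nrm (T (real i / 2 ^ k) z)) \<le> e / ?n"
        using d(2)[OF _ _ z, of "real i / 2 ^ k"] by (simp add: N_def)
    qed
    also have "\<dots> = e" using \<open>0 < ?n\<close> by (simp add: add.commute)
    finally show ?thesis .
  qed
  then show ?thesis using d(1) by blast
qed

section \<open>The domain of the generator\<close>

abbreviation dom :: "'v set" where "dom \<equiv> gen_domain M smul nrm T"

text \<open>The quotients stand in for their limit \<open>A x\<close> at 0; the supremum is finite
  because \<open>N\<close> is at most 1.\<close>

definition graph_norm :: "'v \<Rightarrow> real" where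
  "graph_norm x = N x + (SUP t\<in>{0<..1}. N (quot t x))"

lemma graph_norm_bdd: "bdd_above ((\<lambda>t. N (quot t x)) ` {0<..1})"
  by (intro bdd_aboveI2[of _ _ 1] N_le_1)

lemma N_quot_le_graph_norm:
  assumes "0 < t" "t \<le> 1"
  shows "N (quot t x) \<le> graph_norm x"
proof -
  have "N (quot t x) \<le> (SUP t\<in>{0<..1}. N (quot t x))"
    using assms by (intro cSUP_upper graph_norm_bdd) auto
  then show ?thesis using N_nonneg[of x] by (simp add: graph_norm_def)
qed

lemma N_le_graph_norm: "N x \<le> graph_norm x"
proof -
  have "N (quot 1 x) \<le> (SUP t\<in>{0<..1}. N (quot t x))"
    by (intro cSUP_upper graph_norm_bdd) auto
  then show ?thesis using N_nonneg[of "quot 1 x"] by (simp add: graph_norm_def)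
qed

lemma graph_norm_le:
  assumes "N x \<le> a" "\<And>t. 0 < t \<Longrightarrow> t \<le> 1 \<Longrightarrow> N (quot t x) \<le> b"
  shows "graph_norm x \<le> a + b"
  unfolding graph_norm_def using assms by (intro add_mono cSUP_least) auto

lemma quot_diff: "0 \<le> t \<Longrightarrow> quot t (x - y) = quot t x - quot t y"
  by (simp add: T_diff rsc_diff_right)

lemma quot_csc: "0 \<le> t \<Longrightarrow> quot t (csc c x) = csc c (quot t x)"
  by (simp add: T_rsc rsc_diff_right csc_csc mult.commute)

lemma dom_diff:
  assumes "x \<in> dom" "y \<in> dom"
  shows "x - y \<in> dom"
proof -
  obtain a b where a: "((\<lambda>t. N (quot t x - a)) \<longlongrightarrow> 0) (at_right 0)" and b: "((\<lambda>t. N (quot t y - b)) \<longlongrightarrow> 0) (at_right 0)"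
    using assms gen_domain_iff by blast
  have "((\<lambda>t. N (quot t (x - y) - (a - b))) \<longlongrightarrow> 0) (at_right 0)"
  proof (rule tendsto_sandwich[OF _ _ tendsto_const])
    show "eventually (\<lambda>t. 0 \<le> N (quot t (x - y) - (a - b))) (at_right 0)" by (simp add: N_nonneg)
    show "eventually (\<lambda>t. N (quot t (x - y) - (a - b)) \<le> N (quot t x - a) + N (quot t y - b)) (at_right 0)"
      unfolding eventually_at_right_field
    proof (intro exI[of _ 1] conjI allI impI)
      fix t :: real assume "0 < t"
      then have eq: "quot t (x - y) - (a - b) = (quot t x - a) - (quot t y - b)"
        by (simp only: quot_diff[OF less_imp_le]) (simp add: algebra_simps)
      then show "N (quot t (x - y) - (a - b)) \<le> N (quot t x - a) + N (quot t y - b)"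
        by (subst eq) (rule N_diff)
    qed simp
    show "((\<lambda>t. N (quot t x - a) + N (quot t y - b)) \<longlongrightarrow> 0) (at_right 0)"
      using tendsto_add[OF a b] by simp
  qed
  then show ?thesis using gen_domain_iff by blast
qed

lemma dom_0: "0 \<in> dom"
proof -
  have "((\<lambda>t. N (quot t 0 - 0)) \<longlongrightarrow> 0) (at_right 0)"
    by (rule tendsto_eventually) (auto simp: eventually_at_right_field intro!: exI[of _ 1])
  then show ?thesis using gen_domain_iff by blast
qed

lemma dom_csc_of_nat: "x \<in> dom \<Longrightarrow> csc (real n) x \<in> dom"
proof (induction n)
  case 0
  then show ?case by (simp add: dom_0)
next
  case (Suc n)
  have "csc (real (Suc n)) x = csc (real n) x - (0 - x)"
    by (simp only: csc_of_nat sum.lessThan_Suc) simp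
  then show ?case using dom_diff[OF Suc.IH[OF Suc.prems] dom_diff[OF dom_0 Suc.prems]] by simp
qed

text \<open>At fixed \<open>t\<close> the quotient is continuous for \<open>N\<close>, so the
  quotients of \<open>X n\<close> converge to those of \<open>x\<close> uniformly in
  \<open>t\<close>. Uniformity permits exchanging the limits in \<open>t\<close> and
  \<open>n\<close>: the limits \<open>a n\<close> converge to some \<open>b\<close>, and
  \<open>b\<close> is the limit of the quotients of \<open>x\<close>.\<close>

lemma graph_norm_complete:
  assumes X: "\<And>n. X n \<in> dom" and C: "\<And>e. e > 0 \<Longrightarrow> \<exists>K. \<forall>m\<ge>K. \<forall>n\<ge>K. graph_norm (X m - X n) < e"
  shows "\<exists>x\<in>dom. (\<lambda>n. graph_norm (X n - x)) \<longlonglongrightarrow> 0"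
proof -
  have CN: "\<exists>K. \<forall>m\<ge>K. \<forall>n\<ge>K. N (X m - X n) < e" if "e > 0" for e
    using C[OF that] N_le_graph_norm by (meson le_less_trans)
  obtain x where x: "(\<lambda>n. N (X n - x)) \<longlonglongrightarrow> 0" using el_complete_N[OF complete CN] by blast
  have "\<forall>n. \<exists>a. ((\<lambda>t. N (quot t (X n) - a)) \<longlongrightarrow> 0) (at_right 0)" using X gen_domain_iff by blast
  from choice[OF this] obtain a where a: "\<And>n. ((\<lambda>t. N (quot t (X n) - a n)) \<longlongrightarrow> 0) (at_right 0)" by blast
  have quot_le: "N (quot t (X n - x)) \<le> e"
    if "0 < t" "t \<le> 1" and K: "\<And>m n. m \<ge> K \<Longrightarrow> n \<ge> K \<Longrightarrow> graph_norm (X m - X n) < e" and "n \<ge> K" for t n K e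
  proof -
    have "(\<lambda>m. N ((X n - X m) - (X n - x))) \<longlonglongrightarrow> 0"
      using x N_commute[of x] by simp
    from quot_tendsto[OF _ this, of t] have l: "(\<lambda>m. N (quot t (X n - X m) - quot t (X n - x))) \<longlonglongrightarrow> 0"
      using that(1) by simp
    have "N (quot t (X n - X m)) \<le> e" if "m \<ge> K" for m
      using N_quot_le_graph_norm[OF \<open>0 < t\<close> \<open>t \<le> 1\<close>, of "X n - X m"] K[OF \<open>n \<ge> K\<close> that] by linarith
    then have "eventually (\<lambda>m. N (quot t (X n - X m)) \<le> e) sequentially"
      unfolding eventually_sequentially by blast
    then show ?thesis by (rule N_limit_le[OF l])
  qed
  have "\<exists>K. \<forall>m\<ge>K. \<forall>n\<ge>K. N (a m - a n) < e" if e: "e > 0" for e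
  proof -
    obtain K where K: "\<And>m n. m \<ge> K \<Longrightarrow> n \<ge> K \<Longrightarrow> graph_norm (X m - X n) < e / 2"
      using C[of "e/2"] e by auto
    have "N (a m - a n) < e" if mn: "m \<ge> K" "n \<ge> K" for m n
    proof -
      have "eventually (\<lambda>t. N (a m - a n) \<le> N (quot t (X m) - a m) + N (quot t (X n) - a n) + e / 2) (at_right 0)"
        unfolding eventually_at_right_field
      proof (intro exI[of _ 1] conjI allI impI)
        fix t :: real assume t: "0 < t" "t < 1"
        have eq: "a m - a n = (quot t (X m - X n) - (quot t (X m) - a m)) + (quot t (X n) - a n)"
          using t by (simp only: quot_diff[OF less_imp_le]) (simp add: algebra_simps)
        have "N (a m - a n) \<le> N (quot t (X m - X n) - (quot t (X m) - a m)) + N (quot t (X n) - a n)"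
          by (subst eq) (rule N_add)
        moreover have "N (quot t (X m - X n) - (quot t (X m) - a m)) \<le> N (quot t (X m - X n)) + N (quot t (X m) - a m)"
          by (rule N_diff)
        moreover have "N (quot t (X m - X n)) \<le> e / 2"
          using N_quot_le_graph_norm[of t "X m - X n"] K[OF mn] t by simp
        ultimately show "N (a m - a n) \<le> N (quot t (X m) - a m) + N (quot t (X n) - a n) + e / 2" by linarith
      qed simp
      moreover have "((\<lambda>t. N (quot t (X m) - a m) + N (quot t (X n) - a n) + e / 2) \<longlongrightarrow> 0 + 0 + e / 2) (at_right 0)"
        by (intro tendsto_intros a)
      ultimately have "N (a m - a n) \<le> 0 + 0 + e / 2"
        by (intro tendsto_lowerbound[of _ _ "at_right 0"]) auto
      then show ?thesis using e by simp
    qed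
    then show ?thesis by blast
  qed
  from el_complete_N[OF complete this] obtain b where b: "(\<lambda>n. N (a n - b)) \<longlonglongrightarrow> 0" by blast
  have "((\<lambda>t. N (quot t x - b)) \<longlongrightarrow> 0) (at_right 0)"
  proof (rule tendstoI)
    fix e :: real assume e: "0 < e"
    obtain K where K: "\<And>m n. m \<ge> K \<Longrightarrow> n \<ge> K \<Longrightarrow> graph_norm (X m - X n) < e / 4"
      using C[of "e/4"] e by auto
    obtain K' where "\<And>n. n \<ge> K' \<Longrightarrow> N (a n - b) < e / 4"
      using order_tendstoD(2)[OF b, of "e/4"] e by (auto simp: eventually_sequentially)
    then obtain n where n: "n \<ge> K" "N (a n - b) < e / 4" by (meson max.cobounded1 max.cobounded2)
    have "eventually (\<lambda>t. N (quot t (X n) - a n) < e / 4) (at_right 0)"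
      using order_tendstoD(2)[OF a[of n], of "e/4"] e by simp
    then obtain h where h: "h > 0" "\<And>t. 0 < t \<Longrightarrow> t < h \<Longrightarrow> N (quot t (X n) - a n) < e / 4"
      by (auto simp: eventually_at_right_field)
    have "N (quot t x - b) < e" if t: "0 < t" "t < min h 1" for t
    proof -
      have eq: "quot t x - b = (quot t (X n) - a n) + (a n - b) - quot t (X n - x)"
        using t by (simp only: quot_diff[OF less_imp_le]) (simp add: algebra_simps)
      have "N (quot t x - b) \<le> N ((quot t (X n) - a n) + (a n - b)) + N (quot t (X n - x))"
        by (subst eq) (rule N_diff)
      moreover have "N ((quot t (X n) - a n) + (a n - b)) \<le> N (quot t (X n) - a n) + N (a n - b)" by (rule N_add)
      moreover have "N (quot t (X n - x)) \<le> e / 4" using t by (intro quot_le[OF _ _ K n(1)]) auto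
      ultimately show ?thesis using h(2)[of t] n(2) t e by simp
    qed
    then show "eventually (\<lambda>t. dist (N (quot t x - b)) 0 < e) (at_right 0)"
      unfolding eventually_at_right_field using h(1)
      by (intro exI[of _ "min h 1"]) (auto simp: N_nonneg)
  qed
  then have xd: "x \<in> dom" using gen_domain_iff by blast
  have "(\<lambda>n. graph_norm (X n - x)) \<longlonglongrightarrow> 0"
  proof (rule LIMSEQ_I)
    fix e :: real assume e: "0 < e"
    obtain K where K: "\<And>m n. m \<ge> K \<Longrightarrow> n \<ge> K \<Longrightarrow> graph_norm (X m - X n) < e / 4"
      using C[of "e/4"] e by auto
    obtain K' where K': "\<And>n. n \<ge> K' \<Longrightarrow> N (X n - x) < e / 4"
      using order_tendstoD(2)[OF x, of "e/4"] e by (auto simp: eventually_sequentially)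
    have "norm (graph_norm (X n - x) - 0) < e" if "n \<ge> max K K'" for n
    proof -
      have "graph_norm (X n - x) \<le> e / 4 + e / 4"
        using K'[of n] that by (intro graph_norm_le quot_le[OF _ _ K]) auto
      moreover have "0 \<le> graph_norm (X n - x)"
        using N_nonneg[of "X n - x"] N_le_graph_norm[of "X n - x"] by linarith
      ultimately show ?thesis using e by simp
    qed
    then show "\<exists>n0. \<forall>n\<ge>n0. norm (graph_norm (X n - x) - 0) < e" by blast
  qed
  then show ?thesis using xd by blast
qed

text \<open>\<open>dom\<close> need not be complete for the random norm \<open>\<parallel>x\<parallel> + \<parallel>A x\<parallel>\<close>; it is complete for
  \<open>graph_norm\<close>, which controls all difference quotients in probability, and there the Lipschitz
  hypothesis can be made uniform by Baire's theorem.\<close>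

lemma uniform_lipschitz:
  assumes lip: "\<And>x r. x \<in> dom \<Longrightarrow> 0 \<le> r \<Longrightarrow> L0_lipschitz_on M nrm {0..r} (\<lambda>t. T t x)"
    and e: "0 < e"
  shows "\<exists>d>0. \<forall>x\<in>dom. graph_norm x < d \<longrightarrow> (\<forall>k h. 0 < h \<longrightarrow> h \<le> 1 \<longrightarrow> Phi M (grid_max k (quot h x)) \<le> e)"
proof -
  \<comment> \<open>A pair \<open>j\<close> consists of a grid level and a step \<open>h\<close>;
    steps outside \<open>(0, 1]\<close> get the harmless value 0, so that \<open>j\<close> may range
    over the whole type.\<close>
  define q where "q n j x = (if 0 < snd j \<and> snd j \<le> 1 then Phi M (\<lambda>\<omega>. grid_max (fst j) (quot (snd j) x) \<omega> / real n) else 0)"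
    for n :: nat and j :: "nat \<times> real" and x
  obtain n d where n: "n \<ge> 1" and d: "d > 0" "\<And>x j. x \<in> dom \<Longrightarrow> graph_norm x < d \<Longrightarrow> q n j x \<le> 2 * (e / 2)"
  proof (rule Baire_uniform_continuity[where D=dom and N=graph_norm and q=q and e="e/2"])
    show "0 \<in> dom" by (rule dom_0)
    show "x - y \<in> dom" if "x \<in> dom" "y \<in> dom" for x y using that by (rule dom_diff)
    show nn: "0 \<le> graph_norm x" for x using N_nonneg[of x] N_le_graph_norm[of x] by linarith
    show "graph_norm x = 0 \<longleftrightarrow> x = 0" for x
    proof
      assume "graph_norm x = 0"
      then show "x = 0" using N_nonneg[of x] N_le_graph_norm[of x] N_eq_0_iff[of x] by linarith
    next
      assume "x = 0"
      then have "graph_norm x \<le> 0 + 0" by (intro graph_norm_le) auto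
      then show "graph_norm x = 0" using nn[of x] by simp
    qed
    show "graph_norm (x - y) \<le> graph_norm x + graph_norm y" for x y
    proof -
      have "graph_norm (x - y) \<le> (N x + N y) + ((SUP t\<in>{0<..1}. N (quot t x)) + (SUP t\<in>{0<..1}. N (quot t y)))"
      proof (rule graph_norm_le[OF N_diff])
        fix t :: real assume t: "0 < t" "t \<le> 1"
        have "N (quot t (x - y)) \<le> N (quot t x) + N (quot t y)"
          using t by (subst quot_diff) (auto intro: N_diff)
        moreover have "N (quot t x) \<le> (SUP t\<in>{0<..1}. N (quot t x))" for x
          using t by (intro cSUP_upper graph_norm_bdd) auto
        ultimately show "N (quot t (x - y)) \<le> (SUP t\<in>{0<..1}. N (quot t x)) + (SUP t\<in>{0<..1}. N (quot t y))"
          by (meson add_mono order_trans)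
      qed
      then show ?thesis by (simp add: graph_norm_def)
    qed
    show "\<exists>x\<in>dom. (\<lambda>n. graph_norm (X n - x)) \<longlonglongrightarrow> 0"
      if "\<And>n. X n \<in> dom" "\<And>e. e > 0 \<Longrightarrow> \<exists>K. \<forall>m\<ge>K. \<forall>n\<ge>K. graph_norm (X m - X n) < e" for X
      using that by (rule graph_norm_complete)
    show "q n j (x - y) \<le> q n j x + q n j y" for n j x y
    proof (cases "0 < snd j \<and> snd j \<le> 1")
      case True
      then have "quot (snd j) (x - y) = quot (snd j) x - quot (snd j) y" by (intro quot_diff) simp
      then show ?thesis unfolding q_def using True Phi_grid_max_diff by simp
    next
      case False
      then have "q n j z = 0" for z by (auto simp: q_def)
      then show ?thesis by simp
    qed
    show "\<exists>d>0. \<forall>x\<in>dom. graph_norm x < d \<longrightarrow> q n j x \<le> r" if r: "0 < r" for n j r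
    proof -
      obtain d where d: "d > 0" "\<And>z. N z < d \<Longrightarrow> Phi M (grid_max (fst j) z) \<le> r"
        using grid_max_continuous_0[OF r] by blast
      have "q n j x \<le> r" if "graph_norm x < d" for x
      proof (cases "0 < snd j \<and> snd j \<le> 1")
        case True
        then have "N (quot (snd j) x) < d" using N_quot_le_graph_norm[of "snd j" x] that by linarith
        then have "Phi M (grid_max (fst j) (quot (snd j) x)) \<le> r" by (rule d(2))
        moreover have "Phi M (\<lambda>\<omega>. grid_max (fst j) (quot (snd j) x) \<omega> / real n) \<le> Phi M (grid_max (fst j) (quot (snd j) x))"
        proof (rule Phi_mono)
          have "\<bar>a / real n\<bar> \<le> \<bar>a\<bar>" for a by (cases n) (auto simp: divide_le_eq abs_mult mult_le_cancel_left1)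
          then show "AE \<omega> in M. \<bar>grid_max (fst j) (quot (snd j) x) \<omega> / real n\<bar> \<le> \<bar>grid_max (fst j) (quot (snd j) x) \<omega>\<bar>"
            by simp
        qed auto
        ultimately show ?thesis unfolding q_def using True by simp
      qed (use r in \<open>auto simp: q_def\<close>)
      then show ?thesis using d(1) by blast
    qed
    show "\<exists>n\<ge>1. \<forall>j. q n j x \<le> e / 2" if x: "x \<in> dom" for x
    proof -
      \<comment> \<open>The interval is \<open>[0, 2]\<close> because \<open>T u (quot h x)\<close>
        compares the orbit at \<open>u\<close> and \<open>u + h\<close>, where \<open>u\<close> and
        \<open>h\<close> are at most 1.\<close>
      obtain \<xi> where \<xi>: "L0p M \<xi>"
        "\<And>s t. s \<in> {0..2} \<Longrightarrow> t \<in> {0..2} \<Longrightarrow> AE \<omega> in M. nrm (T s x - T t x) \<omega> \<le> \<xi> \<omega> * \<bar>s - t\<bar>"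
        using lip[OF x, of 2] unfolding L0_lipschitz_on_def by auto
      have [measurable]: "\<xi> \<in> borel_measurable M" using \<xi>(1) by (simp add: L0p_def)
      have le: "AE \<omega> in M. grid_max k (quot h x) \<omega> \<le> \<xi> \<omega>" if h: "0 < h" "h \<le> 1" for k h
      proof (rule grid_max_le_AE[where b="\<lambda>_. \<xi>"])
        fix u :: real assume u: "0 \<le> u" "u \<le> 1"
        have eq: "T u (quot h x) = csc (1 / h) (T (u + h) x - T u x)"
          using u h by (simp add: T_rsc T_diff T_T)
        have "AE \<omega> in M. nrm (T (u + h) x - T u x) \<omega> \<le> \<xi> \<omega> * \<bar>(u + h) - u\<bar>"
          by (rule \<xi>(2)) (use u h in auto)
        then show "AE \<omega> in M. nrm (T u (quot h x)) \<omega> \<le> \<xi> \<omega>"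
          unfolding eq using nrm_rsc[OF borel_measurable_const, of "1 / h" "T (u + h) x - T u x"]
        proof eventually_elim
          case (elim \<omega>)
          then show ?case using h by (simp add: divide_le_eq)
        qed
      qed simp
      obtain n where n: "n \<ge> 1" "Phi M (\<lambda>\<omega>. \<xi> \<omega> / real n) < e / 2"
        using Phi_divide_small[of \<xi> "e/2"] e by auto
      have "q n j x \<le> e / 2" for j
      proof (cases "0 < snd j \<and> snd j \<le> 1")
        case True
        have "Phi M (\<lambda>\<omega>. grid_max (fst j) (quot (snd j) x) \<omega> / real n) \<le> Phi M (\<lambda>\<omega>. \<xi> \<omega> / real n)"
        proof (rule Phi_mono)
          show "AE \<omega> in M. \<bar>grid_max (fst j) (quot (snd j) x) \<omega> / real n\<bar> \<le> \<bar>\<xi> \<omega> / real n\<bar>"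
            using le[of "snd j" "fst j"] True grid_max_nonneg[of "fst j" "quot (snd j) x"]
            by (auto intro!: divide_right_mono elim!: AE_mp)
        qed auto
        then show ?thesis unfolding q_def using True n(2) by simp
      qed (use e in \<open>auto simp: q_def\<close>)
      then show ?thesis using n(1) by blast
    qed
    show thesis if "n \<ge> 1" "d > 0" "\<And>x j. x \<in> dom \<Longrightarrow> graph_norm x < d \<Longrightarrow> q n j x \<le> 2 * (e / 2)" for n d
      using that by (rule \<open>\<And>n d. n \<ge> 1 \<Longrightarrow> d > 0 \<Longrightarrow> (\<And>x j. x \<in> dom \<Longrightarrow> graph_norm x < d \<Longrightarrow> q n j x \<le> 2 * (e / 2)) \<Longrightarrow> thesis\<close>)
  qed
  have "Phi M (grid_max k (quot h x)) \<le> e"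
    if x: "x \<in> dom" and small: "graph_norm x < d / real n" and h: "0 < h" "h \<le> 1" for x k h
  proof -
    \<comment> \<open>Scaling by \<open>n\<close> cancels the division by \<open>n\<close> in
      \<open>q\<close> and multiplies the graph norm by at most \<open>n\<close>.\<close>
    let ?y = "csc (real n) x"
    have "graph_norm ?y \<le> real n * N x + real n * (SUP t\<in>{0<..1}. N (quot t x))"
    proof (rule graph_norm_le[OF N_csc_of_nat])
      fix t :: real assume t: "0 < t" "t \<le> 1"
      have "N (quot t ?y) \<le> real n * N (quot t x)"
        using t by (subst quot_csc) (auto intro: N_csc_of_nat)
      also have "N (quot t x) \<le> (SUP t\<in>{0<..1}. N (quot t x))"
        using t by (intro cSUP_upper graph_norm_bdd) auto
      finally show "N (quot t ?y) \<le> real n * (SUP t\<in>{0<..1}. N (quot t x))"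
        by (simp add: mult_left_mono)
    qed
    also have "\<dots> = real n * graph_norm x" by (simp add: graph_norm_def algebra_simps)
    also have "\<dots> < d" using small n by (simp add: field_simps)
    finally have "q n (k, h) ?y \<le> e" using d(2)[OF dom_csc_of_nat[OF x], of n "(k, h)"] by simp
    moreover have "q n (k, h) ?y = Phi M (\<lambda>\<omega>. grid_max k (csc (real n) (quot h x)) \<omega> / real n)"
      using h quot_csc[of h "real n" x] by (simp add: q_def)
    moreover have "\<dots> = Phi M (grid_max k (quot h x))"
    proof (rule Phi_cong_AE)
      show "AE \<omega> in M. \<bar>grid_max k (csc (real n) (quot h x)) \<omega> / real n\<bar> = \<bar>grid_max k (quot h x) \<omega>\<bar>"
        using grid_max_rsc[of "\<lambda>_. real n" k "quot h x", OF borel_measurable_const]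
        by eventually_elim (use n in simp)
    qed auto
    ultimately show ?thesis by simp
  qed
  then show ?thesis using d(1) n by (intro exI[of _ "d / real n"]) auto
qed

section \<open>Boundedness near time zero\<close>

text \<open>The grid maxima dominate the orbit at dyadic times above \<open>u\<close>, and right
  continuity in probability passes the bound to \<open>u\<close>.\<close>

lemma orbit_le_of_grid_max_le:
  assumes [measurable]: "s \<in> borel_measurable M" and le: "\<And>k. AE \<omega> in M. grid_max k z \<omega> \<le> s \<omega>"
    and u: "0 \<le> u" "u \<le> 1"
  shows "AE \<omega> in M. nrm (T u z) \<omega> \<le> s \<omega>"
proof (rule nrm_limit_le)
  show "(\<lambda>k. N (T (real (dyadic_above k u) / 2 ^ k) z - T u z)) \<longlonglongrightarrow> 0"
    using u by (intro T_right_continuous dyadic_above dyadic_above_tendsto)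
  show "AE \<omega> in M. nrm (T (real (dyadic_above k u) / 2 ^ k) z) \<omega> \<le> s \<omega>" for k
  proof -
    have i: "dyadic_above k u \<le> 2 ^ k" using dyadic_above_le[of u 1 k] u by simp
    from le[of k] show ?thesis
    proof eventually_elim
      case (elim \<omega>)
      then show ?case using grid_max_ge[OF i, of z \<omega>] by linarith
    qed
  qed
qed measurable

text \<open>Let \<open>p\<close> dominate the orbit of \<open>z\<close>. Dividing \<open>z\<close> by \<open>max 1 p\<close> turns \<open>p\<close> into \<open>min 1 p\<close>, whose mean is what has
  to be small, and makes \<open>orbit_integral\<close> applicable. The identity \<open>T u z = T (u + 1) z - T u (T 1 z - z)\<close>
  then bounds the orbit on \<open>[0, 1]\<close> by the orbit on \<open>[1, 2]\<close> and by difference quotients of the integral.\<close>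

lemma grid_max_uniformly_small:
  assumes lip: "\<And>x r. x \<in> dom \<Longrightarrow> 0 \<le> r \<Longrightarrow> L0_lipschitz_on M nrm {0..r} (\<lambda>t. T t x)"
    and e: "0 < e"
  shows "\<exists>d>0. \<forall>z \<xi>. \<xi> \<in> borel_measurable M \<longrightarrow> (\<forall>k. AE \<omega> in M. grid_max k z \<omega> \<le> \<xi> \<omega>) \<longrightarrow> N z < d \<longrightarrow>
    (\<forall>k. Phi M (grid_max k z) \<le> e)"
proof -
  obtain K where Km [measurable]: "K \<in> borel_measurable M" and K1: "\<And>\<omega>. 1 \<le> K \<omega>"
    and K: "\<And>t x. 1 \<le> t \<Longrightarrow> t \<le> real 2 \<Longrightarrow> AE \<omega> in M. nrm (T t x) \<omega> \<le> K \<omega> * nrm x \<omega>"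
    by (rule bounded_away_from_0[of 1 2]) (simp, rule that)
  obtain d1 where d1: "d1 > 0" "\<And>x k h. x \<in> dom \<Longrightarrow> graph_norm x < d1 \<Longrightarrow> 0 < h \<Longrightarrow> h \<le> 1 \<Longrightarrow> Phi M (grid_max k (quot h x)) \<le> e / 2"
    using uniform_lipschitz[OF lip, of "e/2"] e by auto
  \<comment> \<open>With \<open>\<beta> = d1 / 6\<close>, \<open>orbit_integral\<close> yields a
    vector of graph norm at most \<open>5 * \<beta> < d1\<close>.\<close>
  obtain d2 where d2: "d2 > 0" "\<And>t z. 0 \<le> t \<Longrightarrow> t \<le> 2 \<Longrightarrow> N z < d2 \<Longrightarrow> N (T t z) \<le> d1 / 6"
    using T_equicontinuous[of "d1/6" 2] d1(1) by auto
  obtain d3 where d3: "d3 > 0" "\<And>z. N z < d3 \<Longrightarrow> Phi M (\<lambda>\<omega>. K \<omega> * nrm z \<omega>) \<le> e / 4"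
    using Phi_random_scale_small[OF Km, of "e/4"] e by auto
  have "Phi M (grid_max k0 z) \<le> e"
    if \<xi>m [measurable]: "\<xi> \<in> borel_measurable M" and \<xi>: "\<And>k. AE \<omega> in M. grid_max k z \<omega> \<le> \<xi> \<omega>" and z: "N z < d2" "N z < d3"
    for z \<xi> k0
  proof -
    have inc: "AE \<omega> in M. incseq (\<lambda>k. grid_max k z \<omega>)" using grid_max_incseq by simp
    have nn: "AE \<omega> in M. \<forall>k. 0 \<le> grid_max k z \<omega>" using grid_max_nonneg by (simp add: AE_all_countable)
    \<comment> \<open>The bound \<open>\<xi>\<close> enters only here, to make the supremum
      \<open>s\<close> of the orbit finite; \<open>d2\<close> and \<open>d3\<close> do not depend on
      it.\<close>
    have bd: "\<exists>c>0. \<forall>k. Phi M (\<lambda>\<omega>. grid_max k z \<omega> / c) \<le> r" if r: "0 < r" for r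
    proof -
      obtain n where n: "n \<ge> 1" "Phi M (\<lambda>\<omega>. \<xi> \<omega> / real n) < r" using Phi_divide_small[OF \<xi>m r] by blast
      have "Phi M (\<lambda>\<omega>. grid_max k z \<omega> / real n) \<le> Phi M (\<lambda>\<omega>. \<xi> \<omega> / real n)" for k
      proof (rule Phi_mono)
        show "AE \<omega> in M. \<bar>grid_max k z \<omega> / real n\<bar> \<le> \<bar>\<xi> \<omega> / real n\<bar>"
          using \<xi>[of k] grid_max_nonneg[of k z]
          by eventually_elim (auto intro!: divide_right_mono)
      qed auto
      then have "\<forall>k. Phi M (\<lambda>\<omega>. grid_max k z \<omega> / real n) \<le> r" using n(2) by (meson less_imp_le order_trans)
      then show ?thesis using n(1) by (intro exI[of _ "real n"]) auto
    qed
    obtain s where sm [measurable]: "s \<in> borel_measurable M" and s0: "\<And>\<omega>. 0 \<le> s \<omega>"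
      and s: "AE \<omega> in M. \<forall>k. grid_max k z \<omega> \<le> s \<omega>" and slim: "AE \<omega> in M. (\<lambda>k. grid_max k z \<omega>) \<longlonglongrightarrow> s \<omega>"
      by (rule stochastically_bounded_sup[of "\<lambda>k. grid_max k z", OF grid_max_measurable inc nn bd]) (assumption, rule that)
    \<comment> \<open>\<open>s\<close> bounds the orbit on \<open>[0, 1]\<close> and
      \<open>K * nrm z\<close> on \<open>[1, 2]\<close>; \<open>orbit_integral\<close> needs control
      on both.\<close>
    define p where "p \<omega> = max (s \<omega>) (K \<omega> * nrm z \<omega>)" for \<omega>
    have [measurable]: "p \<in> borel_measurable M" unfolding p_def by measurable
    have p0: "0 \<le> p \<omega>" for \<omega> using s0[of \<omega>] by (simp add: p_def le_max_iff_disj)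
    define f where "f \<omega> = 1 / max 1 (p \<omega>)" for \<omega>
    have fm [measurable]: "f \<in> borel_measurable M" unfolding f_def by measurable
    have f01: "0 \<le> f \<omega>" "f \<omega> \<le> 1" for \<omega> by (auto simp: f_def)
    have fp: "f \<omega> * p \<omega> = min 1 (p \<omega>)" for \<omega> by (auto simp: f_def max_def min_def)
    define z' where "z' = rsc f z"
    have sk: "AE \<omega> in M. grid_max k z \<omega> \<le> s \<omega>" for k using s by (auto elim!: AE_mp)
    have orb: "AE \<omega> in M. nrm (T u z) \<omega> \<le> p \<omega>" if u: "0 \<le> u" "u \<le> 2" for u
    proof (cases "u \<le> 1")
      case True
      have "AE \<omega> in M. nrm (T u z) \<omega> \<le> s \<omega>" using u(1) True by (intro orbit_le_of_grid_max_le[OF sm sk])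
      then show ?thesis by eventually_elim (simp add: p_def le_max_iff_disj)
    next
      case False
      then have "AE \<omega> in M. nrm (T u z) \<omega> \<le> K \<omega> * nrm z \<omega>" using u by (intro K) auto
      then show ?thesis by eventually_elim (simp add: p_def le_max_iff_disj)
    qed
    have nT: "AE \<omega> in M. nrm (T u z') \<omega> = f \<omega> * nrm (T u z) \<omega>" if "0 \<le> u" for u
      using nrm_rsc[OF fm, of "T u z"] that f01 by (simp add: z'_def T_rsc)
    have orb1: "AE \<omega> in M. nrm (T u z') \<omega> \<le> 1" if u: "0 \<le> u" "u \<le> 2" for u
      using orb[OF u] nT[OF u(1)]
    proof eventually_elim
      case (elim \<omega>)
      have "f \<omega> * nrm (T u z) \<omega> \<le> f \<omega> * p \<omega>" using elim(1) f01 by (intro mult_left_mono) auto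
      then show ?case using elim(2) fp[of \<omega>] by simp
    qed
    have NT: "N (T u z') \<le> d1 / 6" if u: "0 \<le> u" "u \<le> 2" for u
    proof -
      have "N (T u z') \<le> N (T u z)"
      proof (rule N_mono)
        show "AE \<omega> in M. nrm (T u z') \<omega> \<le> nrm (T u z) \<omega>"
          using nT[OF u(1)] nrm_nonneg[of "T u z"]
        proof eventually_elim
          case (elim \<omega>)
          then show ?case using f01[of \<omega>] by (simp add: mult_left_le_one_le)
        qed
      qed
      then show ?thesis using d2(2)[OF u z(1)] by simp
    qed
    obtain y where y: "N y \<le> d1 / 6" "\<And>t. 0 < t \<Longrightarrow> t \<le> 1 \<Longrightarrow> N (quot t y) \<le> 4 * (d1 / 6)"
      "((\<lambda>t. N (quot t y - (T 1 z' - z'))) \<longlongrightarrow> 0) (at_right 0)"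
      by (rule orbit_integral[OF orb1 NT]) (assumption+, rule that)
    define w where "w = T 1 z' - z'"
    have yd: "y \<in> dom" using y(3) gen_domain_iff by blast
    have "graph_norm y \<le> d1 / 6 + 4 * (d1 / 6)" by (rule graph_norm_le[OF y(1,2)])
    then have gy: "graph_norm y < d1" using d1(1) by simp
    \<comment> \<open>At a fixed level \<open>k\<close> the map \<open>grid_max k\<close> is
      continuous at 0, so the bound for the quotients of \<open>y\<close> passes to their limit
      \<open>w\<close>.\<close>
    have Phi_w: "Phi M (grid_max k w) \<le> e / 2" for k
    proof (rule field_le_epsilon)
      fix r :: real assume "0 < r"
      then obtain d where d: "d > 0" "\<And>x. N x < d \<Longrightarrow> Phi M (grid_max k x) \<le> r"
        using grid_max_continuous_0 by blast
      obtain h where h: "h > 0" "\<And>t. 0 < t \<Longrightarrow> t < h \<Longrightarrow> N (quot t y - w) < d"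
        using order_tendstoD(2)[OF y(3) d(1)] by (auto simp: eventually_at_right_field w_def)
      define t where "t = min h 1 / 2"
      have t: "0 < t" "t \<le> 1" "t < h" using h(1) by (auto simp: t_def)
      have "w = quot t y - (quot t y - w)" by simp
      then have "Phi M (\<lambda>\<omega>. grid_max k w \<omega> / 1) \<le> Phi M (\<lambda>\<omega>. grid_max k (quot t y) \<omega> / 1) + Phi M (\<lambda>\<omega>. grid_max k (quot t y - w) \<omega> / 1)"
        using Phi_grid_max_diff[of k "quot t y" "quot t y - w" 1] by simp
      moreover have "Phi M (grid_max k (quot t y - w)) \<le> r" using h(2) t by (intro d(2)) auto
      moreover have "Phi M (grid_max k (quot t y)) \<le> e / 2" using t by (intro d1(2) yd gy) auto
      ultimately show "Phi M (grid_max k w) \<le> e / 2 + r" by simp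
    qed
    have Kz: "Phi M (\<lambda>\<omega>. K \<omega> * nrm z \<omega>) \<le> e / 4" by (rule d3(2)[OF z(2)])
    have "Phi M (grid_max k z') \<le> e / 2 + e / 4" for k
    proof -
      have "AE \<omega> in M. grid_max k z' \<omega> \<le> grid_max k w \<omega> + K \<omega> * nrm z \<omega>"
      proof -
        have "AE \<omega> in M. \<forall>i\<in>{..2 ^ k}. nrm (T (real i / 2 ^ k) z') \<omega> \<le> nrm (T (real i / 2 ^ k) w) \<omega> + K \<omega> * nrm z' \<omega>"
        proof (subst AE_ball_countable, simp, intro ballI)
          fix i :: nat assume "i \<in> {..2 ^ k}"
          then have "real i \<le> real (2 ^ k)" unfolding of_nat_le_iff by simp
          then have i: "real i / 2 ^ k \<le> 1" by (simp add: divide_le_eq)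
          let ?u = "real i / 2 ^ k"
          have eq: "T ?u z' = T (?u + 1) z' - T ?u w"
            by (simp add: w_def T_diff T_T)
          have "AE \<omega> in M. nrm (T (?u + 1) z') \<omega> \<le> K \<omega> * nrm z' \<omega>"
            by (rule K, simp, use i in linarith)
          then show "AE \<omega> in M. nrm (T ?u z') \<omega> \<le> nrm (T ?u w) \<omega> + K \<omega> * nrm z' \<omega>"
            using nrm_diff[of "T (?u + 1) z'" "T ?u w"] unfolding eq[symmetric]
            by eventually_elim linarith
        qed
        moreover have "AE \<omega> in M. nrm z' \<omega> \<le> nrm z \<omega>"
          using nT[OF order_refl] nrm_nonneg[of z]
        proof eventually_elim
          case (elim \<omega>)
          then show ?case using f01[of \<omega>] by (simp add: mult_left_le_one_le)
        qed
        ultimately show ?thesis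
        proof eventually_elim
          case (elim \<omega>)
          have *: "K \<omega> * nrm z' \<omega> \<le> K \<omega> * nrm z \<omega>" using elim(2) K1[of \<omega>] by (intro mult_left_mono) auto
          show ?case
          proof (rule grid_max_le)
            fix i :: nat assume i: "i \<le> 2 ^ k"
            then have "nrm (T (real i / 2 ^ k) z') \<omega> \<le> nrm (T (real i / 2 ^ k) w) \<omega> + K \<omega> * nrm z' \<omega>" using elim(1) by simp
            then show "nrm (T (real i / 2 ^ k) z') \<omega> \<le> grid_max k w \<omega> + K \<omega> * nrm z \<omega>"
              using * grid_max_ge[OF i, of w \<omega>] by linarith
          qed
        qed
      qed
      then have "Phi M (grid_max k z') \<le> Phi M (grid_max k w) + Phi M (\<lambda>\<omega>. K \<omega> * nrm z \<omega>)"
      proof (intro Phi_add)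
        assume "AE \<omega> in M. grid_max k z' \<omega> \<le> grid_max k w \<omega> + K \<omega> * nrm z \<omega>"
        then show "AE \<omega> in M. \<bar>grid_max k z' \<omega>\<bar> \<le> \<bar>grid_max k w \<omega>\<bar> + \<bar>K \<omega> * nrm z \<omega>\<bar>"
          using grid_max_nonneg[of k z'] by eventually_elim linarith
      qed auto
      then show ?thesis using Phi_w[of k] Kz by linarith
    qed
    moreover have "Phi M (grid_max k z') = Phi M (\<lambda>\<omega>. f \<omega> * grid_max k z \<omega>)" for k
      unfolding z'_def
    proof (rule Phi_cong_AE)
      show "AE \<omega> in M. \<bar>grid_max k (rsc f z) \<omega>\<bar> = \<bar>f \<omega> * grid_max k z \<omega>\<bar>"
        using grid_max_rsc[OF fm, of k z] by eventually_elim (simp add: abs_mult)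
    qed auto
    moreover have "(\<lambda>k. Phi M (\<lambda>\<omega>. f \<omega> * grid_max k z \<omega>)) \<longlonglongrightarrow> Phi M (\<lambda>\<omega>. f \<omega> * s \<omega>)"
    proof (rule Phi_tendsto_AE)
      show "AE \<omega> in M. (\<lambda>k. f \<omega> * grid_max k z \<omega>) \<longlonglongrightarrow> f \<omega> * s \<omega>"
        using slim by eventually_elim (intro tendsto_mult tendsto_const)
    qed auto
    ultimately have fs: "Phi M (\<lambda>\<omega>. f \<omega> * s \<omega>) \<le> e / 2 + e / 4" by (intro LIMSEQ_le_const2) auto
    \<comment> \<open>\<open>f * p = min 1 p\<close> has the same truncated mean as
      \<open>p\<close>, so undoing the normalisation loses nothing. The budget is
      \<open>e / 2 + e / 4\<close> for \<open>f * s\<close> and \<open>e / 4\<close> for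
      \<open>K * nrm z\<close>.\<close>
    have "Phi M (grid_max k0 z) \<le> Phi M (\<lambda>\<omega>. f \<omega> * p \<omega>)"
    proof -
      have "Phi M (grid_max k0 z) \<le> Phi M p"
      proof (rule Phi_mono)
        show "AE \<omega> in M. \<bar>grid_max k0 z \<omega>\<bar> \<le> \<bar>p \<omega>\<bar>"
          using sk[of k0] grid_max_nonneg[of k0 z] by eventually_elim (simp add: p_def)
      qed auto
      also have "Phi M p = Phi M (\<lambda>\<omega>. f \<omega> * p \<omega>)"
        unfolding fp using p0 by (simp add: Phi_def)
      finally show ?thesis .
    qed
    also have "\<dots> \<le> Phi M (\<lambda>\<omega>. f \<omega> * s \<omega>) + Phi M (\<lambda>\<omega>. K \<omega> * nrm z \<omega>)"
    proof (rule Phi_add)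
      show "AE \<omega> in M. \<bar>f \<omega> * p \<omega>\<bar> \<le> \<bar>f \<omega> * s \<omega>\<bar> + \<bar>K \<omega> * nrm z \<omega>\<bar>"
        using nrm_nonneg[of z]
      proof eventually_elim
        case (elim \<omega>)
        have Kn: "0 \<le> K \<omega> * nrm z \<omega>" using elim K1[of \<omega>] by (intro mult_nonneg_nonneg) auto
        have "f \<omega> * p \<omega> \<le> f \<omega> * (s \<omega> + K \<omega> * nrm z \<omega>)"
          using f01[of \<omega>] s0[of \<omega>] Kn by (intro mult_left_mono) (auto simp: p_def)
        also have "\<dots> \<le> f \<omega> * s \<omega> + K \<omega> * nrm z \<omega>"
          using f01[of \<omega>] Kn by (simp add: distrib_left mult_left_le_one_le)
        finally show ?case using f01[of \<omega>] s0[of \<omega>] Kn p0[of \<omega>] by (simp only: abs_of_nonneg mult_nonneg_nonneg)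
      qed
    qed auto
    finally show ?thesis using fs Kz by linarith
  qed
  then show ?thesis using d2(1) d3(1) by (intro exI[of _ "min d2 d3"]) auto
qed

text \<open>\<open>T a z\<close> has an a.s. bounded orbit by \<open>bounded_away_from_0\<close>,
  and \<open>N (T a z) < d\<close> for small \<open>a\<close>. At fixed \<open>k\<close> the error
  \<open>T a z - z\<close> is negligible; \<open>a\<close> may depend on \<open>k\<close>,
  \<open>z\<close> and \<open>r\<close>, while \<open>d\<close> does not.\<close>

lemma grid_max_equicontinuous:
  assumes lip: "\<And>x r. x \<in> dom \<Longrightarrow> 0 \<le> r \<Longrightarrow> L0_lipschitz_on M nrm {0..r} (\<lambda>t. T t x)"
    and e: "0 < e"
  shows "\<exists>d>0. \<forall>z. N z < d \<longrightarrow> (\<forall>k. Phi M (grid_max k z) \<le> e)"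
proof -
  obtain d where d: "d > 0" "\<And>z \<xi> k. \<xi> \<in> borel_measurable M \<Longrightarrow> (\<And>k. AE \<omega> in M. grid_max k z \<omega> \<le> \<xi> \<omega>) \<Longrightarrow> N z < d \<Longrightarrow> Phi M (grid_max k z) \<le> e"
    using grid_max_uniformly_small[OF lip e] by blast
  have "Phi M (grid_max k z) \<le> e" if z: "N z < d" for z k
  proof (rule field_le_epsilon)
    fix r :: real assume "0 < r"
    then obtain d' where d': "d' > 0" "\<And>x. N x < d' \<Longrightarrow> Phi M (grid_max k x) \<le> r"
      using grid_max_continuous_0 by blast
    have "0 < min d' (d - N z)" using d'(1) z by simp
    from T_at_0[OF this, of z] obtain h where h: "h > 0" "\<And>t. 0 \<le> t \<Longrightarrow> t < h \<Longrightarrow> N (T t z - z) < min d' (d - N z)"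
      by blast
    define a where "a = min h 1 / 2"
    have a: "0 < a" "a \<le> 1" "a < h" using h(1) by (auto simp: a_def)
    have Na: "N (T a z - z) < d'" "N (T a z - z) < d - N z" using h(2)[of a] a by auto
    have "N (T a z) < d" using N_add[of "T a z - z" z] Na(2) by simp
    moreover obtain K where K: "K \<in> borel_measurable M"
      "\<And>t x. a \<le> t \<Longrightarrow> t \<le> real 2 \<Longrightarrow> AE \<omega> in M. nrm (T t x) \<omega> \<le> K \<omega> * nrm x \<omega>"
      by (rule bounded_away_from_0[OF a(1), of 2]) (rule that)
    note [measurable] = K(1)
    have "AE \<omega> in M. grid_max k (T a z) \<omega> \<le> K \<omega> * nrm z \<omega>" for k
    proof (rule grid_max_le_AE[where b="\<lambda>_ \<omega>. K \<omega> * nrm z \<omega>"])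
      fix u :: real assume u: "0 \<le> u" "u \<le> 1"
      have "AE \<omega> in M. nrm (T (u + a) z) \<omega> \<le> K \<omega> * nrm z \<omega>"
        using u a by (intro K(2)) auto
      then show "AE \<omega> in M. nrm (T u (T a z)) \<omega> \<le> K \<omega> * nrm z \<omega>" using u a by (simp add: T_T)
    qed simp
    moreover have "(\<lambda>\<omega>. K \<omega> * nrm z \<omega>) \<in> borel_measurable M" by measurable
    ultimately have "Phi M (grid_max k (T a z)) \<le> e" by (intro d(2)[of "\<lambda>\<omega>. K \<omega> * nrm z \<omega>"])
    moreover have "Phi M (grid_max k (T a z - z)) \<le> r" by (rule d'(2)[OF Na(1)])
    moreover have "Phi M (\<lambda>\<omega>. grid_max k (T a z - (T a z - z)) \<omega> / 1) \<le> Phi M (\<lambda>\<omega>. grid_max k (T a z) \<omega> / 1) + Phi M (\<lambda>\<omega>. grid_max k (T a z - z) \<omega> / 1)"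
      by (rule Phi_grid_max_diff)
    ultimately show "Phi M (grid_max k z) \<le> e + r" by simp
  qed
  then show ?thesis using d(1) by blast
qed

text \<open>The sharp bounds of \<open>grid_max k\<close> increase with \<open>k\<close> by
  minimality and inherit from the unit ball a bound in probability uniform in \<open>k\<close>.
  Hence their supremum is a.s. finite, and it dominates \<open>T t\<close> for all \<open>t\<close>
  in \<open>[0, 1]\<close>.\<close>

lemma as_bounded_of_lipschitz:
  assumes lip: "\<And>x r. x \<in> dom \<Longrightarrow> 0 \<le> r \<Longrightarrow> L0_lipschitz_on M nrm {0..r} (\<lambda>t. T t x)"
  shows "as_bounded M nrm T"
proof -
  have ball: "\<exists>c>0. \<forall>k x. (AE \<omega> in M. nrm x \<omega> \<le> 1) \<longrightarrow> Phi M (\<lambda>\<omega>. grid_max k x \<omega> / c) \<le> e" if e: "0 < e" for e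
  proof -
    obtain d where d: "d > 0" "\<And>z k. N z < d \<Longrightarrow> Phi M (grid_max k z) \<le> e"
      using grid_max_equicontinuous[OF lip e] by blast
    obtain n where n: "1 / real (Suc n) < d"
      using reals_Archimedean[OF d(1)] by (auto simp: inverse_eq_divide)
    have "Phi M (\<lambda>\<omega>. grid_max k x \<omega> / real (Suc n)) \<le> e" if x: "AE \<omega> in M. nrm x \<omega> \<le> 1" for k x
    proof -
      have "N (csc (1 / real (Suc n)) x) < d" using N_csc_ball[OF x, of "1 / real (Suc n)"] n by simp
      then have "Phi M (grid_max k (csc (1 / real (Suc n)) x)) \<le> e" by (rule d(2))
      moreover have "Phi M (grid_max k (csc (1 / real (Suc n)) x)) = Phi M (\<lambda>\<omega>. grid_max k x \<omega> / real (Suc n))"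
      proof (rule Phi_cong_AE)
        show "AE \<omega> in M. \<bar>grid_max k (csc (1 / real (Suc n)) x) \<omega>\<bar> = \<bar>grid_max k x \<omega> / real (Suc n)\<bar>"
          using grid_max_rsc[of "\<lambda>_. 1 / real (Suc n)" k x, OF borel_measurable_const]
          by eventually_elim (simp add: abs_mult)
      qed auto
      ultimately show ?thesis by simp
    qed
    then show ?thesis by (intro exI[of _ "real (Suc n)"]) auto
  qed
  have "\<exists>m. sharp_bound (grid_max k) m" for k
  proof (rule sharp_bound_exists)
    show "\<exists>c>0. \<forall>x. (AE \<omega> in M. nrm x \<omega> \<le> 1) \<longrightarrow> Phi M (\<lambda>\<omega>. grid_max k x \<omega> / c) \<le> e" if "0 < e" for e
      using ball[OF that] by blast
  qed (rule grid_max_measurable grid_max_nonneg grid_max_rsc; assumption)+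
  then have "\<forall>k. \<exists>m. sharp_bound (grid_max k) m" ..
  from choice[OF this] obtain m where "\<forall>k. sharp_bound (grid_max k) (m k)" ..
  then have m: "sharp_bound (grid_max k) (m k)" for k ..
  note mm [measurable] = sharp_boundD(1)[OF m] and m0 = sharp_boundD(2)[OF m] and mb = sharp_boundD(3)[OF m]
  have step: "AE \<omega> in M. m k \<omega> \<le> m (Suc k) \<omega>" for k
  proof -
    have "AE \<omega> in M. grid_max k x \<omega> \<le> m (Suc k) \<omega>" if "AE \<omega> in M. nrm x \<omega> \<le> 1" for x
      using that mb[of "Suc k" x]
    proof eventually_elim
      case (elim \<omega>)
      have "grid_max k x \<omega> \<le> grid_max (Suc k) x \<omega>" using grid_max_incseq by (rule incseq_SucD)
      moreover have "m (Suc k) \<omega> * nrm x \<omega> \<le> m (Suc k) \<omega>" using elim(1) m0 by (simp add: mult_left_le)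
      ultimately show ?case using elim(2) by linarith
    qed
    then show ?thesis by (rule sharp_boundD(5)[OF m])
  qed
  have inc: "AE \<omega> in M. incseq (\<lambda>k. m k \<omega>)"
  proof -
    have "AE \<omega> in M. \<forall>k. m k \<omega> \<le> m (Suc k) \<omega>" using step by (simp add: AE_all_countable)
    then show ?thesis by eventually_elim (auto intro: incseq_SucI)
  qed
  have bd: "\<exists>c>0. \<forall>k. Phi M (\<lambda>\<omega>. m k \<omega> / c) \<le> e" if e: "0 < e" for e
  proof -
    obtain c where c: "c > 0" "\<And>k x. AE \<omega> in M. nrm x \<omega> \<le> 1 \<Longrightarrow> Phi M (\<lambda>\<omega>. grid_max k x \<omega> / c) \<le> e"
      using ball[OF e] by blast
    have "Phi M (\<lambda>\<omega>. m k \<omega> / c) \<le> e" for k by (rule sharp_boundD(4)[OF m c(2)])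
    then show ?thesis using c(1) by blast
  qed
  obtain \<xi> where \<xi>: "\<xi> \<in> borel_measurable M" "\<And>\<omega>. 0 \<le> \<xi> \<omega>" "AE \<omega> in M. \<forall>k. m k \<omega> \<le> \<xi> \<omega>"
  proof (rule stochastically_bounded_sup[of m, OF mm inc _ bd])
    show "AE \<omega> in M. \<forall>k. 0 \<le> m k \<omega>" using m0 by simp
  qed (assumption, rule that)
  note [measurable] = \<xi>(1)
  show ?thesis
  proof (rule bound_imp_as_bounded[of 1 \<xi>])
    show "L0p M \<xi>" using \<xi>(1,2) by (simp add: L0p_def)
    show "AE \<omega> in M. nrm (T t x) \<omega> \<le> \<xi> \<omega> * nrm x \<omega>" if "0 \<le> t" "t \<le> 1" for t x
    proof (rule orbit_le_of_grid_max_le[OF _ _ that])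
      show "AE \<omega> in M. grid_max k x \<omega> \<le> \<xi> \<omega> * nrm x \<omega>" for k
        using mb[of k x] \<xi>(3) nrm_nonneg[of x]
      proof eventually_elim
        case (elim \<omega>)
        have "m k \<omega> * nrm x \<omega> \<le> \<xi> \<omega> * nrm x \<omega>" using elim(2,3) by (intro mult_right_mono) auto
        then show ?case using elim(1) by linarith
      qed
    qed measurable
  qed simp
qed

end

theorem theorem3p11:
  fixes M :: "'w measure"
    and smul :: "('w \<Rightarrow> 'k::{real_normed_field,second_countable_topology}) \<Rightarrow> 'v::ab_group_add \<Rightarrow> 'v"
    and nrm :: "'v \<Rightarrow> 'w \<Rightarrow> real"
    and T :: "real \<Rightarrow> 'v \<Rightarrow> 'v"
  assumes "rn_module M smul nrm"
    and "el_complete M nrm"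
    and "c0_semigroup M smul nrm T"
  shows "as_bounded M nrm T \<longleftrightarrow>
    (\<forall>x\<in>gen_domain M smul nrm T. \<forall>r\<ge>0. L0_lipschitz_on M nrm {0..r} (\<lambda>t. T t x))"
proof -
  interpret rn_semigroup M smul nrm T
  proof -
    have "prob_space M" using assms(1) unfolding rn_module_def by (elim conjE)
    then show "rn_semigroup M smul nrm T"
      using assms by (simp add: rn_semigroup_def random_normed_module_def
          random_normed_module_axioms_def rn_semigroup_axioms_def)
  qed
  show ?thesis
  proof
    assume "as_bounded M nrm T"
    then obtain L C where "L > 0" "C \<in> borel_measurable M" "\<And>\<omega>. 1 \<le> C \<omega>"
      "\<And>t x. 0 \<le> t \<Longrightarrow> t \<le> L \<Longrightarrow> AE \<omega> in M. nrm (T t x) \<omega> \<le> C \<omega> * nrm x \<omega>"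
      by (rule as_bounded_imp_bound) (rule that)
    then show "\<forall>x\<in>gen_domain M smul nrm T. \<forall>r\<ge>0. L0_lipschitz_on M nrm {0..r} (\<lambda>t. T t x)"
      using lipschitz_of_bounded by blast
  next
    assume "\<forall>x\<in>gen_domain M smul nrm T. \<forall>r\<ge>0. L0_lipschitz_on M nrm {0..r} (\<lambda>t. T t x)"
    then show "as_bounded M nrm T" by (intro as_bounded_of_lipschitz) blast
  qed
qed

end
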